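(* Let $(X,\mathbf p,f,\Theta)$ be a strongly positive parabolic $(U\times U,\chi^{st})$-linear bicrystal of type $w_P$, and let $\tilde\Delta_X=\mathrm{Trop}(\Delta_X|_{X^-})$ be the combinatorial central charge, a function on $\mathrm{Trop}(X^-,\Theta)$. Then $\tilde\Delta_X$ is invariant under all crystal operators $\tilde e_i^{\,n}$ ($i\in I$, $n\in\mathbb Z$). In particular, for $\lambda\in X_\star(Z(L_P))$ and $n\in\mathbb Z$, each non-empty $$\mathcal B_{f,\Theta;n}^\lambda=\{\tilde b\in\mathcal B_{f,\Theta}^\lambda:\tilde\Delta_X(\tilde b)=n\}$$ is a normal sub-crystal of the normal crystal $\mathcal B_{f,\Theta}^\lambda$.
   Context: **Group.** $G$ is a split reductive group over $\mathbb Q$, $T\subset B\subset G$ a split maximal torus and a Borel subgroup, $B^-$ the opposite Borel, $U,U^-$ the unipotent radicals of $B,B^-$; $I$ the Dynkin vertex set; $\alpha_i\in X^\star(T)$, $\alpha_i^\vee\in X_\star(T)$ simple roots and coroots. Fix homomorphisms $\phi_i:SL_2\to G$ mapping lower (upper) unitriangular matrices into $B^-$ (into $B$) with $\phi_i(\mathrm{diag}(c,c^{-1}))=\alpha_i^\vee(c)$; $x_i(a)=\phi_i\begin{pmatrix}1&a\\ 0&1\end{pmatrix}$, $y_i(a)=\phi_i\begin{pmatrix}1&0\\ a&1\end{pmatrix}$, $x_{-i}(c)=\phi_i\begin{pmatrix}c^{-1}&0\\ 1&c\end{pmatrix}$, $\overline{s_i}=\phi_i\begin{pmatrix}0&-1\\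 1&0\end{pmatrix}$, $\overline w=\overline{s_{i_1}}\cdots\overline{s_{i_\ell}}$ for any reduced word of $w\in W$. $\chi_i:U\to\mathbb G_a$, $\chi_i^-:U^-\to\mathbb G_a$ are the characters with $\chi_i(x_j(a))=\chi_i^-(y_j(a))=\delta_{ij}a$; $\chi^{st}=\sum_i\chi_i$. A standard parabolic is $P\supset B$; $L_P\supset T$ its Levi factor, $Z(L_P)$ the center of $L_P$ (treated as a split torus), $w_0^P$ the longest element of the Weyl group of $L_P$, $w_P=w_0^Pw_0$. **Bicrystals.** A $U\times U$-variety is an irreducible affine variety $X$ over $\mathbb Q$ with commuting left and right $U$-actions, each free. A $U$-bicrystal $(X,\mathbf p)$ is a $U\times U$-variety with a $U\times U$-equivariant morphism $\mathbf p:X\to G$; its type is the unique $w\in W$ with $\mathbf p(X)\cap BwB$ dense in $\mathbf p(X)$; $X^-=\mathbf p^{-1}(B^-)$. A $(U\times U,\chi^{st})$-linear bicrystal has in addition $f:X\to\mathbb A^1$ with $f(uxu')=\chi^{st}(u)+f(x)+\chi^{st}(u')$; it is parabolic if a dense $U\times U$-invariant subset of $\mathbf p(X)$ admits such a linear function (its type is then some $w_P$, and $\mathbf p(X)\cap X_P$ is dense in $\mathbf p(X)$, where $X_P=UZ(L_P)\overline{w_P}U$). $f_P:X_P\to\mathbb A^1$ is $f_P(ut\overline{w_P}u')=\chi^{st}(u)+\chi^{st}(u')$, and the central charge is the rational function $\Delta_X(x)=f(x)-f_P(\mathbf p(x))$ on $X$. **Structure on $X^-$.** For $x\in X^-$ with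 $\mathbf p(x)=u_-t$ ($u_-\in U^-,t\in T$): $\gamma(x)=t$, $\varphi_i(x)=\chi_i^-(u_-)$, $\varepsilon_i=(\alpha_i\circ\gamma)\varphi_i$; $e_i^c(x)=x_i\!\left(\frac{c-1}{\varphi_i(x)}\right)x\,x_i\!\left(\frac{c^{-1}-1}{\varepsilon_i(x)}\right)$ if $\varphi_i\not\equiv0$, else $e_i^c(x)=x$. The highest weight morphism is $hw_X(x)=t$ if $\mathbf p(x)=ut\overline wu'$ ($w$ the type). **Positivity.** On a split torus a rational function is positive if it is a ratio of combinations of characters with non-negative integer coefficients; a rational morphism of tori is positive if its composition with every character is. A toric chart is a birational isomorphism from a split torus; a positive structure is a class of toric charts whose mutual transition maps are positive in both directions; functions and morphisms are positive if they become positive in charts (for a morphism one also requires that the closure of the image meet the union of the domains of the inverse charts of the target). Tori carry the class of the identity, products the product structure. $\Theta_w^-$ is the positive structure on $B_w^-=B^-\cap U\overline wU$ containing the charts $(c_1,\dots,c_\ell)\mapsto x_{-i_1}(c_1)\cdots x_{-i_\ell}(c_\ell)$ for reduced words of $w$; $TB_w^-\cong T\times B_w^-$ has the product structure. $(X,\mathbf p,f,\Theta)$ ($\Theta$ a positive structure on $X^-$) is positive of type $w$ if $\mathbf p|_{X^-}:X^-\to TB_w^-$, $\gamma$, all $\varphi_i,\varepsilon_i$, all $e_i^\cdot:\mathbb G_m\times X^-\to X^-$, and $f|_{X^-}$ are positive; strongly positive if also $\Delta_X|_{X^-}$ is positive (zero allowed, with tropicalization $+\infty$). **Tropicalization.**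 For a nonzero rational function $h=P/Q$ on a torus $S$, $\mathrm{Trop}(h)(\lambda)=\min_{\mu\in N(P)}\langle\mu,\lambda\rangle-\min_{\mu\in N(Q)}\langle\mu,\lambda\rangle$, $\lambda\in X_\star(S)$ ($N$ = Newton polytope). For a positive morphism $h:S\to S'$ of tori, $\langle\mu',\mathrm{Trop}(h)(\lambda)\rangle=\mathrm{Trop}(\mu'\circ h)(\lambda)$. For a positive variety $(Z,\Theta)$ choose a chart $\theta:S\to Z$ in $\Theta$, put $\mathrm{Trop}(Z,\Theta)=X_\star(S)$, and tropicalize through charts. **Crystals.** On $\mathrm{Trop}(X^-,\Theta)$ put $\tilde\gamma=\mathrm{Trop}(\gamma)$, $\tilde\varphi_i=-\mathrm{Trop}(\varphi_i)$, $\tilde\varepsilon_i=-\mathrm{Trop}(\varepsilon_i)$, $\tilde e_i^{\,n}$ = tropicalization of $e_i^c$. $\mathcal B_{f,\Theta}$ is the restriction of this structure to $\{\tilde b:\mathrm{Trop}(f)(\tilde b)\ge0\}$ (with $\tilde e_i(\tilde b)$ defined iff it stays in the set), and $\mathcal B_{f,\Theta}^\lambda=\{\tilde b\in\mathcal B_{f,\Theta}:\mathrm{Trop}(hw_X)(\tilde b)=\lambda\}$. A crystal is normal if $\tilde\varepsilon_i(\tilde b)=\max\{n\ge0:\tilde e_i^{\,n}(\tilde b)\text{ defined}\}$ and $\tilde\varphi_i(\tilde b)=\max\{n\ge0:\tilde e_i^{\,-n}(\tilde b)\text{ defined}\}$ for all $i\in I$. A sub-crystal is the restriction of the structure to a subset.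 *)

theory Defs
  imports
    "HOL-Analysis.Analysis"
    "HOL-Algebra.Coset"
    "HOL-Algebra.Solvable_Groups"
    "HOL-Algebra.Group_Action"
    "HOL-Library.Poly_Mapping"
    "HOL-Library.Extended"
begin

section \<open>Affine varieties over the rational numbers\<close>

text \<open>
  A variety over the rationals is given by its complex points together with its coordinate ring, a
  ring of complex-valued functions on the points (the complex numbers serve as universal domain).
  All morphisms are morphisms over the rationals; the Zariski topology is the one whose closed sets
  are cut out by the coordinate ring. Only the values of a regular function on the points matter:
  the coordinate ring contains every function that agrees on the points with one of its members.
\<close>

record 'a variety =
  pts :: "'a set"
  reg :: "('a \<Rightarrow> complex) set"

inductive_set alg_gen :: "complex set \<Rightarrow> ('a \<Rightarrow> complex) set \<Rightarrow> ('a \<Rightarrow> complex) set"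
  for k :: "complex set" and F :: "('a \<Rightarrow> complex) set" where
  const: "c \<in> k \<Longrightarrow> (\<lambda>_. c) \<in> alg_gen k F"
| gen: "f \<in> F \<Longrightarrow> f \<in> alg_gen k F"
| add: "f \<in> alg_gen k F \<Longrightarrow> g \<in> alg_gen k F \<Longrightarrow> (\<lambda>x. f x + g x) \<in> alg_gen k F"
| mult: "f \<in> alg_gen k F \<Longrightarrow> g \<in> alg_gen k F \<Longrightarrow> (\<lambda>x. f x * g x) \<in> alg_gen k F"

definition funs_on :: "complex set \<Rightarrow> 'a set \<Rightarrow> ('a \<Rightarrow> complex) set \<Rightarrow> ('a \<Rightarrow> complex) set" where
  "funs_on k S F = {g. \<exists>h\<in>alg_gen k F. \<forall>x\<in>S. g x = h x}"

definition rat_alg_hom :: "'a variety \<Rightarrow> (('a \<Rightarrow> complex) \<Rightarrow> complex) \<Rightarrow> bool" where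
  "rat_alg_hom V \<psi> \<longleftrightarrow>
     (\<forall>c\<in>\<rat>. \<psi> (\<lambda>_. c) = c) \<and>
     (\<forall>g\<in>reg V. \<forall>h\<in>reg V. \<psi> (\<lambda>x. g x + h x) = \<psi> g + \<psi> h \<and> \<psi> (\<lambda>x. g x * h x) = \<psi> g * \<psi> h) \<and>
     (\<forall>g\<in>reg V. \<forall>h\<in>reg V. (\<forall>x\<in>pts V. g x = h x) \<longrightarrow> \<psi> g = \<psi> h)"

text \<open>
  The coordinate ring is a finitely generated algebra over the rationals, and the points are exactly
  its algebra homomorphisms to the complex numbers.
\<close>

definition affine_variety :: "'a variety \<Rightarrow> bool" where
  "affine_variety V \<longleftrightarrow>
     (\<exists>F. finite F \<and> reg V = funs_on \<rat> (pts V) F) \<and>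
     (\<forall>\<psi>. rat_alg_hom V \<psi> \<longrightarrow> (\<exists>!x. x \<in> pts V \<and> (\<forall>g\<in>reg V. \<psi> g = g x)))"

definition zclosed :: "'a variety \<Rightarrow> 'a set \<Rightarrow> bool" where
  "zclosed V Z \<longleftrightarrow> (\<exists>E\<subseteq>reg V. Z = {x\<in>pts V. \<forall>g\<in>E. g x = 0})"

definition zdense :: "'a variety \<Rightarrow> 'a set \<Rightarrow> 'a set \<Rightarrow> bool" where
  "zdense V A S \<longleftrightarrow> A \<subseteq> S \<and> (\<forall>Z. zclosed V Z \<longrightarrow> A \<subseteq> Z \<longrightarrow> S \<subseteq> Z)"

definition irreducible_variety :: "'a variety \<Rightarrow> bool" where
  "irreducible_variety V \<longleftrightarrow> pts V \<noteq> {} \<and>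
     (\<forall>Z1 Z2. zclosed V Z1 \<longrightarrow> zclosed V Z2 \<longrightarrow> pts V = Z1 \<union> Z2 \<longrightarrow> pts V = Z1 \<or> pts V = Z2)"

definition connected_variety :: "'a variety \<Rightarrow> bool" where
  "connected_variety V \<longleftrightarrow> pts V \<noteq> {} \<and>
     (\<forall>Z1 Z2. zclosed V Z1 \<longrightarrow> zclosed V Z2 \<longrightarrow> pts V = Z1 \<union> Z2 \<longrightarrow> Z1 \<inter> Z2 = {} \<longrightarrow> Z1 = {} \<or> Z2 = {})"

definition subvar :: "'a variety \<Rightarrow> 'a set \<Rightarrow> 'a variety" where
  "subvar V S = \<lparr>pts = S, reg = {g. \<exists>h\<in>reg V. \<forall>x\<in>S. g x = h x}\<rparr>"

definition princ_open :: "'a variety \<Rightarrow> ('a \<Rightarrow> complex) \<Rightarrow> 'a variety" where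
  "princ_open V q = \<lparr>pts = {x\<in>pts V. q x \<noteq> 0},
     reg = {g. \<exists>a\<in>reg V. \<exists>k::nat. \<forall>x\<in>pts V. q x \<noteq> 0 \<longrightarrow> g x = a x / q x ^ k}\<rparr>"

definition prod_var :: "'a variety \<Rightarrow> 'b variety \<Rightarrow> ('a \<times> 'b) variety" where
  "prod_var V W = \<lparr>pts = pts V \<times> pts W,
     reg = funs_on \<rat> (pts V \<times> pts W) ({g \<circ> fst | g. g \<in> reg V} \<union> {g \<circ> snd | g. g \<in> reg W})\<rparr>"

definition morphism :: "'a variety \<Rightarrow> 'b variety \<Rightarrow> ('a \<Rightarrow> 'b) \<Rightarrow> bool" where
  "morphism V W h \<longleftrightarrow> h ` pts V \<subseteq> pts W \<and> (\<forall>g\<in>reg W. g \<circ> h \<in> reg V)"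

definition isomorphism :: "'a variety \<Rightarrow> 'b variety \<Rightarrow> ('a \<Rightarrow> 'b) \<Rightarrow> bool" where
  "isomorphism V W h \<longleftrightarrow> bij_betw h (pts V) (pts W) \<and> morphism V W h \<and>
     morphism W V (inv_into (pts V) h)"

text \<open>
  A rational function or rational morphism is represented by a total function of which only the
  behaviour on a dense open subset matters; \<open>generic V A\<close> says that \<open>A\<close> holds on a dense open subset.
\<close>

definition generic :: "'a variety \<Rightarrow> ('a \<Rightarrow> bool) \<Rightarrow> bool" where
  "generic V A \<longleftrightarrow> (\<exists>q\<in>reg V. zdense V {x\<in>pts V. q x \<noteq> 0} (pts V) \<and>
     (\<forall>x\<in>pts V. q x \<noteq> 0 \<longrightarrow> A x))"

definition locally_regular_on :: "'a variety \<Rightarrow> 'a set \<Rightarrow> ('a \<Rightarrow> complex) \<Rightarrow> bool" where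
  "locally_regular_on V S h \<longleftrightarrow> (\<forall>y\<in>S. \<exists>a\<in>reg V. \<exists>b\<in>reg V. b y \<noteq> 0 \<and>
     (\<forall>z\<in>S. b z \<noteq> 0 \<longrightarrow> h z = a z / b z))"


section \<open>Affine algebraic groups\<close>

record 'a agrp = "'a monoid" +
  regfun :: "('a \<Rightarrow> complex) set"

definition var :: "'a agrp \<Rightarrow> 'a variety" where
  "var G = \<lparr>pts = carrier G, reg = regfun G\<rparr>"

definition algebraic_group :: "'a agrp \<Rightarrow> bool" where
  "algebraic_group G \<longleftrightarrow> Group.group G \<and> affine_variety (var G) \<and>
     morphism (prod_var (var G) (var G)) (var G) (\<lambda>(x, y). x \<otimes>\<^bsub>G\<^esub> y) \<and>
     morphism (var G) (var G) (\<lambda>x. inv\<^bsub>G\<^esub> x)"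

definition subgrp :: "'a agrp \<Rightarrow> 'a set \<Rightarrow> 'a agrp" where
  "subgrp G H = G\<lparr>carrier := H, regfun := reg (subvar (var G) H)\<rparr>"

text \<open>Base change to the complex numbers: same points, coordinate ring extended by scalars.\<close>

definition geo :: "'a agrp \<Rightarrow> 'a agrp" where
  "geo G = G\<lparr>regfun := funs_on UNIV (carrier G) (regfun G)\<rparr>"

definition alg_hom :: "'a agrp \<Rightarrow> 'b agrp \<Rightarrow> ('a \<Rightarrow> 'b) \<Rightarrow> bool" where
  "alg_hom G H h \<longleftrightarrow> h \<in> hom G H \<and> morphism (var G) (var H) h"

definition alg_iso :: "'a agrp \<Rightarrow> 'b agrp \<Rightarrow> ('a \<Rightarrow> 'b) \<Rightarrow> bool" where
  "alg_iso G H h \<longleftrightarrow> h \<in> hom G H \<and> isomorphism (var G) (var H) h"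

definition closed_subgroup :: "'a agrp \<Rightarrow> 'a set \<Rightarrow> bool" where
  "closed_subgroup G H \<longleftrightarrow> subgroup H G \<and> zclosed (var G) H"

definition Ga :: "complex agrp" where
  "Ga = \<lparr>carrier = UNIV, monoid.mult = (+), one = 0, regfun = funs_on \<rat> UNIV {\<lambda>z. z}\<rparr>"

definition Gm :: "complex agrp" where
  "Gm = \<lparr>carrier = {z. z \<noteq> 0}, monoid.mult = (*), one = 1,
     regfun = funs_on \<rat> {z. z \<noteq> 0} {\<lambda>z. z, inverse}\<rparr>"

text \<open>The standard split torus of rank \<open>n\<close>; coordinates with index \<open>\<ge> n\<close> are padded by \<open>1\<close>.\<close>

definition Tpts :: "nat \<Rightarrow> (nat \<Rightarrow> complex) set" where
  "Tpts n = {z. (\<forall>i<n. z i \<noteq> 0) \<and> (\<forall>i\<ge>n. z i = 1)}"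

definition torus :: "nat \<Rightarrow> (nat \<Rightarrow> complex) agrp" where
  "torus n = \<lparr>carrier = Tpts n, monoid.mult = (\<lambda>x y i. x i * y i), one = (\<lambda>_. 1),
     regfun = funs_on \<rat> (Tpts n) ({\<lambda>z. z i | i. i < n} \<union> {\<lambda>z. inverse (z i) | i. i < n})\<rparr>"

definition mat2 :: "complex \<Rightarrow> complex \<Rightarrow> complex \<Rightarrow> complex \<Rightarrow> complex^2^2" where
  "mat2 a b c d = vector [vector [a, b], vector [c, d]]"

definition SL2 :: "(complex^2^2) agrp" where
  "SL2 = \<lparr>carrier = {A. det A = 1}, monoid.mult = (**), one = mat 1,
     regfun = funs_on \<rat> {A. det A = 1} {\<lambda>A. A $ i $ j | i j. True}\<rparr>"

definition chars :: "'a agrp \<Rightarrow> ('a \<Rightarrow> complex) set" where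
  "chars S = {\<mu>. \<mu> \<in> extensional (carrier S) \<and> alg_hom S Gm \<mu>}"

definition cochars :: "'a agrp \<Rightarrow> (complex \<Rightarrow> 'a) set" where
  "cochars S = {\<nu>. \<nu> \<in> extensional (carrier Gm) \<and> alg_hom Gm S \<nu>}"

definition pairing :: "('a \<Rightarrow> complex) \<Rightarrow> (complex \<Rightarrow> 'a) \<Rightarrow> int" where
  "pairing \<mu> \<nu> = (THE k. \<forall>c. c \<noteq> 0 \<longrightarrow> \<mu> (\<nu> c) = c powi k)"

definition split_torus :: "'a agrp \<Rightarrow> bool" where
  "split_torus S \<longleftrightarrow> (\<exists>n \<tau>. alg_iso (torus n) S \<tau>)"

definition geo_torus :: "'a agrp \<Rightarrow> bool" where
  "geo_torus S \<longleftrightarrow> (\<exists>n \<tau>. alg_iso (geo (torus n)) S \<tau>)"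

text \<open>An element is unipotent if right translation by it is locally unipotent on the coordinate ring.\<close>

definition unipotent_elt :: "'a agrp \<Rightarrow> 'a \<Rightarrow> bool" where
  "unipotent_elt G g \<longleftrightarrow> g \<in> carrier G \<and>
     (\<forall>h\<in>regfun G. \<exists>n. \<forall>x\<in>carrier G. ((\<lambda>k y. k (y \<otimes>\<^bsub>G\<^esub> g) - k y) ^^ n) h x = 0)"

text \<open>
  The largest closed connected normal unipotent subgroup; being the largest, it is the union of all
  of them. It is always applied to a group over the complex numbers.
\<close>

definition unipotent_radical :: "'a agrp \<Rightarrow> 'a set" where
  "unipotent_radical G = \<Union> {N. closed_subgroup G N \<and> connected_variety (var (subgrp G N)) \<and>
     N \<lhd> G \<and> (\<forall>g\<in>N. unipotent_elt G g)}"

definition reductive_group :: "'a agrp \<Rightarrow> bool" where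
  "reductive_group G \<longleftrightarrow> algebraic_group G \<and> connected_variety (var (geo G)) \<and>
     unipotent_radical (geo G) = {\<one>\<^bsub>G\<^esub>}"

definition split_maximal_torus :: "'a agrp \<Rightarrow> 'a set \<Rightarrow> bool" where
  "split_maximal_torus G T \<longleftrightarrow> closed_subgroup G T \<and> split_torus (subgrp G T) \<and>
     (\<forall>T'. closed_subgroup (geo G) T' \<longrightarrow> geo_torus (subgrp (geo G) T') \<longrightarrow> T \<subseteq> T' \<longrightarrow> T' = T)"

definition connected_solvable :: "'a agrp \<Rightarrow> 'a set \<Rightarrow> bool" where
  "connected_solvable G H \<longleftrightarrow> closed_subgroup (geo G) H \<and>
     connected_variety (var (subgrp (geo G) H)) \<and> solvable (subgrp (geo G) H)"

definition borel_subgroup :: "'a agrp \<Rightarrow> 'a set \<Rightarrow> bool" where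
  "borel_subgroup G B \<longleftrightarrow> closed_subgroup G B \<and> connected_solvable G B \<and>
     (\<forall>H. connected_solvable G H \<longrightarrow> B \<subseteq> H \<longrightarrow> H = B)"


section \<open>Pinned split reductive groups\<close>

record ('g, 'i) pinned_group =
  grp :: "'g agrp"
  tor :: "'g set"
  bor :: "'g set"
  opp :: "'g set"                        \<comment> \<open>the opposite Borel subgroup\<close>
  idx :: "'i set"
  sroot :: "'i \<Rightarrow> 'g \<Rightarrow> complex"
  scoroot :: "'i \<Rightarrow> complex \<Rightarrow> 'g"
  phi2 :: "'i \<Rightarrow> complex^2^2 \<Rightarrow> 'g"     \<comment> \<open>the homomorphisms from \<open>SL2\<close>\<close>
  chi :: "'i \<Rightarrow> 'g \<Rightarrow> complex"           \<comment> \<open>characters of \<open>U\<close>\<close>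
  chim :: "'i \<Rightarrow> 'g \<Rightarrow> complex"          \<comment> \<open>characters of the opposite \<open>U\<close>\<close>

definition uni :: "('g, 'i) pinned_group \<Rightarrow> 'g set" where
  "uni D = unipotent_radical (geo (subgrp (grp D) (bor D)))"

definition unim :: "('g, 'i) pinned_group \<Rightarrow> 'g set" where
  "unim D = unipotent_radical (geo (subgrp (grp D) (opp D)))"

definition root_hom :: "('g, 'i) pinned_group \<Rightarrow> ('g \<Rightarrow> complex) \<Rightarrow> (complex \<Rightarrow> 'g) \<Rightarrow> bool" where
  "root_hom D \<alpha> x \<longleftrightarrow> alg_hom Ga (grp D) x \<and> inj x \<and>
     (\<forall>t\<in>tor D. \<forall>a. t \<otimes>\<^bsub>grp D\<^esub> x a \<otimes>\<^bsub>grp D\<^esub> inv\<^bsub>grp D\<^esub> t = x (\<alpha> t * a))"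

definition positive_roots :: "('g, 'i) pinned_group \<Rightarrow> ('g \<Rightarrow> complex) set" where
  "positive_roots D = {\<alpha>\<in>chars (subgrp (grp D) (tor D)). (\<exists>t\<in>tor D. \<alpha> t \<noteq> 1) \<and>
     (\<exists>x. root_hom D \<alpha> x \<and> range x \<subseteq> bor D)}"

text \<open>The character group is written multiplicatively.\<close>

definition simple_roots :: "('g, 'i) pinned_group \<Rightarrow> ('g \<Rightarrow> complex) set" where
  "simple_roots D = {\<alpha>\<in>positive_roots D.
     \<not> (\<exists>\<beta>\<in>positive_roots D. \<exists>\<beta>'\<in>positive_roots D. \<forall>t\<in>tor D. \<alpha> t = \<beta> t * \<beta>' t)}"

definition xp :: "('g, 'i) pinned_group \<Rightarrow> 'i \<Rightarrow> complex \<Rightarrow> 'g" where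
  "xp D i a = phi2 D i (mat2 1 a 0 1)"

definition yp :: "('g, 'i) pinned_group \<Rightarrow> 'i \<Rightarrow> complex \<Rightarrow> 'g" where
  "yp D i a = phi2 D i (mat2 1 0 a 1)"

definition xneg :: "('g, 'i) pinned_group \<Rightarrow> 'i \<Rightarrow> complex \<Rightarrow> 'g" where
  "xneg D i c = phi2 D i (mat2 (inverse c) 0 1 c)"

definition sbar :: "('g, 'i) pinned_group \<Rightarrow> 'i \<Rightarrow> 'g" where
  "sbar D i = phi2 D i (mat2 0 (-1) 1 0)"

text \<open>
  The simple coroot of a simple root is the cocharacter of \<open>T\<close> obtained by restricting to the
  diagonal a homomorphism from \<open>SL2\<close> whose upper and lower unitriangular parts parametrize the root
  subgroups of the root and of its inverse. The images of the unitriangular matrices consist of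
  unipotent elements, so lying in a Borel subgroup they lie in its unipotent radical.
\<close>

definition pinned_split_reductive :: "('g, 'i) pinned_group \<Rightarrow> bool" where
  "pinned_split_reductive D \<longleftrightarrow>
     reductive_group (grp D) \<and>
     split_maximal_torus (grp D) (tor D) \<and>
     borel_subgroup (grp D) (bor D) \<and>
     borel_subgroup (grp D) (opp D) \<and>
     bor D \<inter> opp D = tor D \<and>
     finite (idx D) \<and>
     bij_betw (sroot D) (idx D) (simple_roots D) \<and>
     (\<forall>i\<in>idx D.
        scoroot D i \<in> cochars (subgrp (grp D) (tor D)) \<and>
        alg_hom SL2 (grp D) (phi2 D i) \<and>
        (\<forall>c. c \<noteq> 0 \<longrightarrow> phi2 D i (mat2 c 0 0 (inverse c)) = scoroot D i c) \<and>
        root_hom D (sroot D i) (xp D i) \<and>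
        root_hom D (\<lambda>t. inverse (sroot D i t)) (yp D i) \<and>
        range (xp D i) \<subseteq> uni D \<and>
        range (yp D i) \<subseteq> unim D \<and>
        alg_hom (subgrp (grp D) (uni D)) Ga (chi D i) \<and>
        alg_hom (subgrp (grp D) (unim D)) Ga (chim D i) \<and>
        (\<forall>j\<in>idx D. \<forall>a. chi D i (xp D j a) = (if i = j then a else 0)) \<and>
        (\<forall>j\<in>idx D. \<forall>a. chim D i (yp D j a) = (if i = j then a else 0)))"

definition chi_st :: "('g, 'i) pinned_group \<Rightarrow> 'g \<Rightarrow> complex" where
  "chi_st D u = (\<Sum>i\<in>idx D. chi D i u)"

definition weyl :: "('g, 'i) pinned_group \<Rightarrow> 'g set monoid" where
  "weyl D = ((grp D)\<lparr>carrier := normalizer (grp D) (tor D)\<rparr>) Mod (tor D)"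

definition word_bar :: "('g, 'i) pinned_group \<Rightarrow> 'i list \<Rightarrow> 'g" where
  "word_bar D ws = foldr (\<lambda>i g. sbar D i \<otimes>\<^bsub>grp D\<^esub> g) ws \<one>\<^bsub>grp D\<^esub>"

definition word_of :: "('g, 'i) pinned_group \<Rightarrow> 'g set \<Rightarrow> 'i list \<Rightarrow> bool" where
  "word_of D w ws \<longleftrightarrow> set ws \<subseteq> idx D \<and> w = tor D #>\<^bsub>grp D\<^esub> word_bar D ws"

definition weyl_length :: "('g, 'i) pinned_group \<Rightarrow> 'g set \<Rightarrow> nat" where
  "weyl_length D w = (LEAST l. \<exists>ws. word_of D w ws \<and> length ws = l)"

definition reduced_word :: "('g, 'i) pinned_group \<Rightarrow> 'g set \<Rightarrow> 'i list \<Rightarrow> bool" where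
  "reduced_word D w ws \<longleftrightarrow> word_of D w ws \<and> length ws = weyl_length D w"

text \<open>The lift of \<open>w\<close>; it does not depend on the reduced word chosen.\<close>

definition wbar :: "('g, 'i) pinned_group \<Rightarrow> 'g set \<Rightarrow> 'g" where
  "wbar D w = word_bar D (SOME ws. reduced_word D w ws)"

definition longest :: "('g, 'i) pinned_group \<Rightarrow> 'g set set \<Rightarrow> 'g set \<Rightarrow> bool" where
  "longest D W w \<longleftrightarrow> w \<in> W \<and> (\<forall>v\<in>W. weyl_length D v \<le> weyl_length D w)"

definition standard_parabolic :: "('g, 'i) pinned_group \<Rightarrow> 'g set \<Rightarrow> bool" where
  "standard_parabolic D P \<longleftrightarrow> closed_subgroup (grp D) P \<and> bor D \<subseteq> P"

definition levi_factor :: "('g, 'i) pinned_group \<Rightarrow> 'g set \<Rightarrow> 'g set \<Rightarrow> bool" where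
  "levi_factor D P L \<longleftrightarrow> closed_subgroup (grp D) L \<and> tor D \<subseteq> L \<and>
     L \<inter> unipotent_radical (geo (subgrp (grp D) P)) = {\<one>\<^bsub>grp D\<^esub>} \<and>
     L <#>\<^bsub>grp D\<^esub> unipotent_radical (geo (subgrp (grp D) P)) = P"

definition centre :: "('g, 'i) pinned_group \<Rightarrow> 'g set \<Rightarrow> 'g set" where
  "centre D L = {z\<in>L. \<forall>l\<in>L. z \<otimes>\<^bsub>grp D\<^esub> l = l \<otimes>\<^bsub>grp D\<^esub> z}"

definition weyl_levi :: "('g, 'i) pinned_group \<Rightarrow> 'g set \<Rightarrow> 'g set set" where
  "weyl_levi D L = {tor D #>\<^bsub>grp D\<^esub> n | n. n \<in> normalizer (grp D) (tor D) \<inter> L}"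

text \<open>\<open>w\<close> is the product of the longest element of the Weyl group of \<open>L\<close> and the longest element.\<close>

definition is_wP :: "('g, 'i) pinned_group \<Rightarrow> 'g set \<Rightarrow> 'g set \<Rightarrow> bool" where
  "is_wP D L w \<longleftrightarrow> (\<exists>w0P w0. longest D (weyl_levi D L) w0P \<and> longest D (carrier (weyl D)) w0 \<and>
     w = w0P \<otimes>\<^bsub>weyl D\<^esub> w0)"

definition double_coset :: "('g, 'i) pinned_group \<Rightarrow> 'g set \<Rightarrow> 'g \<Rightarrow> 'g set" where
  "double_coset D H g = {h \<otimes>\<^bsub>grp D\<^esub> g \<otimes>\<^bsub>grp D\<^esub> h' | h h'. h \<in> H \<and> h' \<in> H}"

text \<open>
  The set \<open>U w U\<close> is an orbit of a unipotent group acting on an affine variety, hence closed in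
  \<open>G\<close>; so is its intersection with the opposite Borel subgroup.
\<close>

definition Bminus :: "('g, 'i) pinned_group \<Rightarrow> 'g set \<Rightarrow> 'g set" where
  "Bminus D w = opp D \<inter> double_coset D (uni D) (wbar D w)"

definition XP :: "('g, 'i) pinned_group \<Rightarrow> 'g set \<Rightarrow> 'g set \<Rightarrow> 'g set" where
  "XP D L w = {u \<otimes>\<^bsub>grp D\<^esub> t \<otimes>\<^bsub>grp D\<^esub> wbar D w \<otimes>\<^bsub>grp D\<^esub> u' | u t u'.
     u \<in> uni D \<and> t \<in> centre D L \<and> u' \<in> uni D}"

text \<open>
  The function \<open>f_P\<close>, given by its defining equation on \<open>XP\<close>; values off \<open>XP\<close> are irrelevant.
\<close>

definition is_fP :: "('g, 'i) pinned_group \<Rightarrow> 'g set \<Rightarrow> 'g set \<Rightarrow> ('g \<Rightarrow> complex) \<Rightarrow> bool" where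
  "is_fP D L w fP \<longleftrightarrow> (\<forall>u\<in>uni D. \<forall>t\<in>centre D L. \<forall>u'\<in>uni D.
     fP (u \<otimes>\<^bsub>grp D\<^esub> t \<otimes>\<^bsub>grp D\<^esub> wbar D w \<otimes>\<^bsub>grp D\<^esub> u') = chi_st D u + chi_st D u')"


section \<open>Unipotent bicrystals\<close>

record ('g, 'x) bicrystal =
  bvar :: "'x variety"
  lact :: "'g \<Rightarrow> 'x \<Rightarrow> 'x"
  ract :: "'x \<Rightarrow> 'g \<Rightarrow> 'x"
  bp :: "'x \<Rightarrow> 'g"
  bf :: "'x \<Rightarrow> complex"

definition UU_variety :: "('g, 'i) pinned_group \<Rightarrow> ('g, 'x) bicrystal \<Rightarrow> bool" where
  "UU_variety D X \<longleftrightarrow>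
     affine_variety (bvar X) \<and> irreducible_variety (bvar X) \<and>
     morphism (prod_var (subvar (var (grp D)) (uni D)) (bvar X)) (bvar X) (\<lambda>(u, x). lact X u x) \<and>
     morphism (prod_var (bvar X) (subvar (var (grp D)) (uni D))) (bvar X) (\<lambda>(x, u). ract X x u) \<and>
     (\<forall>x\<in>pts (bvar X). lact X \<one>\<^bsub>grp D\<^esub> x = x \<and> ract X x \<one>\<^bsub>grp D\<^esub> = x) \<and>
     (\<forall>x\<in>pts (bvar X). \<forall>u\<in>uni D. \<forall>u'\<in>uni D.
        lact X u (lact X u' x) = lact X (u \<otimes>\<^bsub>grp D\<^esub> u') x \<and>
        ract X (ract X x u) u' = ract X x (u \<otimes>\<^bsub>grp D\<^esub> u') \<and>
        ract X (lact X u x) u' = lact X u (ract X x u')) \<and>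
     (\<forall>x\<in>pts (bvar X). \<forall>u\<in>uni D. (lact X u x = x \<longrightarrow> u = \<one>\<^bsub>grp D\<^esub>) \<and>
        (ract X x u = x \<longrightarrow> u = \<one>\<^bsub>grp D\<^esub>))"

definition unipotent_bicrystal :: "('g, 'i) pinned_group \<Rightarrow> ('g, 'x) bicrystal \<Rightarrow> bool" where
  "unipotent_bicrystal D X \<longleftrightarrow> UU_variety D X \<and> morphism (bvar X) (var (grp D)) (bp X) \<and>
     (\<forall>x\<in>pts (bvar X). \<forall>u\<in>uni D. \<forall>u'\<in>uni D.
        bp X (ract X (lact X u x) u') = u \<otimes>\<^bsub>grp D\<^esub> bp X x \<otimes>\<^bsub>grp D\<^esub> u')"

definition linear_bicrystal :: "('g, 'i) pinned_group \<Rightarrow> ('g, 'x) bicrystal \<Rightarrow> bool" where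
  "linear_bicrystal D X \<longleftrightarrow> unipotent_bicrystal D X \<and> bf X \<in> reg (bvar X) \<and>
     (\<forall>x\<in>pts (bvar X). \<forall>u\<in>uni D. \<forall>u'\<in>uni D.
        bf X (ract X (lact X u x) u') = chi_st D u + bf X x + chi_st D u')"

definition has_type :: "('g, 'i) pinned_group \<Rightarrow> ('g, 'x) bicrystal \<Rightarrow> 'g set \<Rightarrow> bool" where
  "has_type D X w \<longleftrightarrow> w \<in> carrier (weyl D) \<and>
     zdense (var (grp D)) (bp X ` pts (bvar X) \<inter> double_coset D (bor D) (wbar D w))
       (bp X ` pts (bvar X))"

definition parabolic_bicrystal :: "('g, 'i) pinned_group \<Rightarrow> ('g, 'x) bicrystal \<Rightarrow> bool" where
  "parabolic_bicrystal D X \<longleftrightarrow> (\<exists>Y f0. zdense (var (grp D)) Y (bp X ` pts (bvar X)) \<and>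
     locally_regular_on (var (grp D)) Y f0 \<and>
     (\<forall>g\<in>Y. \<forall>u\<in>uni D. \<forall>u'\<in>uni D. u \<otimes>\<^bsub>grp D\<^esub> g \<otimes>\<^bsub>grp D\<^esub> u' \<in> Y \<and>
        f0 (u \<otimes>\<^bsub>grp D\<^esub> g \<otimes>\<^bsub>grp D\<^esub> u') = chi_st D u + f0 g + chi_st D u'))"

definition Xm :: "('g, 'i) pinned_group \<Rightarrow> ('g, 'x) bicrystal \<Rightarrow> 'x variety" where
  "Xm D X = subvar (bvar X) {x\<in>pts (bvar X). bp X x \<in> opp D}"

definition unim_part :: "('g, 'i) pinned_group \<Rightarrow> ('g, 'x) bicrystal \<Rightarrow> 'x \<Rightarrow> 'g" where
  "unim_part D X x = (THE u. u \<in> unim D \<and> (\<exists>t\<in>tor D. bp X x = u \<otimes>\<^bsub>grp D\<^esub> t))"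

definition gam :: "('g, 'i) pinned_group \<Rightarrow> ('g, 'x) bicrystal \<Rightarrow> 'x \<Rightarrow> 'g" where
  "gam D X x = (THE t. t \<in> tor D \<and> (\<exists>u\<in>unim D. bp X x = u \<otimes>\<^bsub>grp D\<^esub> t))"

definition phi :: "('g, 'i) pinned_group \<Rightarrow> ('g, 'x) bicrystal \<Rightarrow> 'i \<Rightarrow> 'x \<Rightarrow> complex" where
  "phi D X i x = chim D i (unim_part D X x)"

definition eps :: "('g, 'i) pinned_group \<Rightarrow> ('g, 'x) bicrystal \<Rightarrow> 'i \<Rightarrow> 'x \<Rightarrow> complex" where
  "eps D X i x = sroot D i (gam D X x) * phi D X i x"

definition geom_e :: "('g, 'i) pinned_group \<Rightarrow> ('g, 'x) bicrystal \<Rightarrow> 'i \<Rightarrow> complex \<Rightarrow> 'x \<Rightarrow> 'x" where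
  "geom_e D X i c x = (if \<exists>y\<in>pts (Xm D X). phi D X i y \<noteq> 0
     then ract X (lact X (xp D i ((c - 1) / phi D X i x)) x) (xp D i ((inverse c - 1) / eps D X i x))
     else x)"

text \<open>The highest weight morphism, given by its defining equation.\<close>

definition is_hw :: "('g, 'i) pinned_group \<Rightarrow> ('g, 'x) bicrystal \<Rightarrow> 'g set \<Rightarrow> ('x \<Rightarrow> 'g) \<Rightarrow> bool" where
  "is_hw D X w hw \<longleftrightarrow> (\<forall>x\<in>pts (Xm D X). \<forall>u\<in>uni D. \<forall>t\<in>tor D. \<forall>u'\<in>uni D.
     bp X x = u \<otimes>\<^bsub>grp D\<^esub> t \<otimes>\<^bsub>grp D\<^esub> wbar D w \<otimes>\<^bsub>grp D\<^esub> u' \<longrightarrow> hw x = t)"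

definition central_charge :: "('g, 'x) bicrystal \<Rightarrow> ('g \<Rightarrow> complex) \<Rightarrow> 'x \<Rightarrow> complex" where
  "central_charge X fP x = bf X x - fP (bp X x)"


section \<open>Positivity and tropicalization on standard tori\<close>

text \<open>
  Every split torus is isomorphic to a standard one. The characters of \<open>torus n\<close> are the monomials
  with exponent vectors in \<open>expo n\<close>, its cocharacters are the vectors in \<open>cochar_lattice n\<close>, and its
  rational functions are the quotients of Laurent polynomials with rational coefficients.
\<close>

type_synonym laurent = "(nat \<Rightarrow>\<^sub>0 int) \<Rightarrow>\<^sub>0 rat"

definition expo :: "nat \<Rightarrow> (nat \<Rightarrow>\<^sub>0 int) set" where
  "expo n = {m. Poly_Mapping.keys m \<subseteq> {..<n}}"

definition cochar_lattice :: "nat \<Rightarrow> (nat \<Rightarrow> int) set" where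
  "cochar_lattice n = {l. \<forall>i\<ge>n. l i = 0}"

definition monomial :: "(nat \<Rightarrow>\<^sub>0 int) \<Rightarrow> (nat \<Rightarrow> complex) \<Rightarrow> complex" where
  "monomial m z = (\<Prod>i\<in>Poly_Mapping.keys m. z i powi Poly_Mapping.lookup m i)"

definition epair :: "(nat \<Rightarrow>\<^sub>0 int) \<Rightarrow> (nat \<Rightarrow> int) \<Rightarrow> int" where
  "epair m l = (\<Sum>i\<in>Poly_Mapping.keys m. Poly_Mapping.lookup m i * l i)"

definition laurents :: "nat \<Rightarrow> laurent set" where
  "laurents n = {p. Poly_Mapping.keys p \<subseteq> expo n}"

definition leval :: "laurent \<Rightarrow> (nat \<Rightarrow> complex) \<Rightarrow> complex" where
  "leval p z = (\<Sum>m\<in>Poly_Mapping.keys p. of_rat (Poly_Mapping.lookup p m) * monomial m z)"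

definition is_quotient :: "nat \<Rightarrow> laurent \<Rightarrow> laurent \<Rightarrow> ((nat \<Rightarrow> complex) \<Rightarrow> complex) \<Rightarrow> bool" where
  "is_quotient n p q h \<longleftrightarrow> p \<in> laurents n \<and> q \<in> laurents n \<and> q \<noteq> 0 \<and>
     generic (var (torus n)) (\<lambda>z. h z = leval p z / leval q z)"

definition nonneg_coeffs :: "laurent \<Rightarrow> bool" where
  "nonneg_coeffs p \<longleftrightarrow> (\<forall>m. Poly_Mapping.lookup p m \<in> \<nat>)"

definition positive_or_zero :: "nat \<Rightarrow> ((nat \<Rightarrow> complex) \<Rightarrow> complex) \<Rightarrow> bool" where
  "positive_or_zero n h \<longleftrightarrow> (\<exists>p q. nonneg_coeffs p \<and> nonneg_coeffs q \<and> is_quotient n p q h)"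

definition positive :: "nat \<Rightarrow> ((nat \<Rightarrow> complex) \<Rightarrow> complex) \<Rightarrow> bool" where
  "positive n h \<longleftrightarrow> (\<exists>p q. p \<noteq> 0 \<and> nonneg_coeffs p \<and> nonneg_coeffs q \<and> is_quotient n p q h)"

definition positive_map :: "nat \<Rightarrow> nat \<Rightarrow> ((nat \<Rightarrow> complex) \<Rightarrow> nat \<Rightarrow> complex) \<Rightarrow> bool" where
  "positive_map n n' h \<longleftrightarrow> generic (var (torus n)) (\<lambda>z. h z \<in> Tpts n') \<and>
     (\<forall>m\<in>expo n'. positive n (\<lambda>z. monomial m (h z)))"

text \<open>
  The minimum of a linear functional over a Newton polytope is attained at an exponent. The zero
  function has tropicalization \<open>Pinf\<close>.
\<close>

definition newton_min :: "laurent \<Rightarrow> (nat \<Rightarrow> int) \<Rightarrow> int" where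
  "newton_min p l = Min ((\<lambda>m. epair m l) ` Poly_Mapping.keys p)"

definition trop :: "nat \<Rightarrow> ((nat \<Rightarrow> complex) \<Rightarrow> complex) \<Rightarrow> (nat \<Rightarrow> int) \<Rightarrow> int extended" where
  "trop n h l = (if generic (var (torus n)) (\<lambda>z. h z = 0) then Pinf
     else Fin (THE k. \<exists>p q. p \<noteq> 0 \<and> is_quotient n p q h \<and> k = newton_min p l - newton_min q l))"

definition trop_map ::
  "nat \<Rightarrow> nat \<Rightarrow> ((nat \<Rightarrow> complex) \<Rightarrow> nat \<Rightarrow> complex) \<Rightarrow> (nat \<Rightarrow> int) \<Rightarrow> nat \<Rightarrow> int" where
  "trop_map n n' h l = (THE l'. l' \<in> cochar_lattice n' \<and>
     (\<forall>m\<in>expo n'. trop n (\<lambda>z. monomial m (h z)) l = Fin (epair m l')))"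

definition trop_to_torus ::
  "nat \<Rightarrow> 'a agrp \<Rightarrow> ((nat \<Rightarrow> complex) \<Rightarrow> 'a) \<Rightarrow> (nat \<Rightarrow> int) \<Rightarrow> complex \<Rightarrow> 'a" where
  "trop_to_torus n S h l = (THE \<nu>. \<nu> \<in> cochars S \<and>
     (\<forall>\<mu>\<in>chars S. trop n (\<lambda>z. \<mu> (h z)) l = Fin (pairing \<mu> \<nu>)))"


section \<open>Positive structures\<close>

text \<open>
  A toric chart is a birational isomorphism from a standard torus, recorded with a dense open domain
  on which it is an isomorphism onto a dense open subset of the target.
\<close>

record 'z chart =
  cdim :: nat
  cdom :: "(nat \<Rightarrow> complex) set"
  cmap :: "(nat \<Rightarrow> complex) \<Rightarrow> 'z"

definition toric_chart :: "'z variety \<Rightarrow> 'z chart \<Rightarrow> bool" where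
  "toric_chart Z c \<longleftrightarrow> (\<exists>q\<in>regfun (torus (cdim c)). \<exists>r\<in>reg Z.
     cdom c = {z\<in>Tpts (cdim c). q z \<noteq> 0} \<and> cdom c \<noteq> {} \<and>
     zdense Z {x\<in>pts Z. r x \<noteq> 0} (pts Z) \<and>
     isomorphism (princ_open (var (torus (cdim c))) q) (princ_open Z r) (cmap c))"

definition chart_expr :: "'y chart \<Rightarrow> 'z chart \<Rightarrow> ('y \<Rightarrow> 'z) \<Rightarrow> (nat \<Rightarrow> complex) \<Rightarrow> nat \<Rightarrow> complex" where
  "chart_expr c c' g z = inv_into (cdom c') (cmap c') (g (cmap c z))"

text \<open>
  The source of a chart is irreducible, so the closure of the image of the morphism read in the
  chart \<open>c\<close> meets the (open) domain of the inverse of \<open>c'\<close> iff generic points are mapped into it.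
\<close>

definition meets :: "'y chart \<Rightarrow> 'z chart \<Rightarrow> ('y \<Rightarrow> 'z) \<Rightarrow> bool" where
  "meets c c' g \<longleftrightarrow>
     generic (var (torus (cdim c))) (\<lambda>z. z \<in> cdom c \<and> g (cmap c z) \<in> cmap c' ` cdom c')"

definition positive_in_charts :: "'y chart \<Rightarrow> 'z chart \<Rightarrow> ('y \<Rightarrow> 'z) \<Rightarrow> bool" where
  "positive_in_charts c c' g \<longleftrightarrow> meets c c' g \<and> positive_map (cdim c) (cdim c') (chart_expr c c' g)"

definition chart_equiv :: "'z chart \<Rightarrow> 'z chart \<Rightarrow> bool" where
  "chart_equiv c c' \<longleftrightarrow> positive_in_charts c c' (\<lambda>x. x) \<and> positive_in_charts c' c (\<lambda>x. x)"

definition chart_class :: "'z variety \<Rightarrow> 'z chart \<Rightarrow> 'z chart set" where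
  "chart_class Z c = {c'. toric_chart Z c' \<and> chart_equiv c c'}"

definition positive_structure :: "'z variety \<Rightarrow> 'z chart set \<Rightarrow> bool" where
  "positive_structure Z \<Theta> \<longleftrightarrow> (\<exists>c. toric_chart Z c \<and> \<Theta> = chart_class Z c)"

definition positive_fun :: "'z chart set \<Rightarrow> ('z \<Rightarrow> complex) \<Rightarrow> bool" where
  "positive_fun \<Theta> h \<longleftrightarrow> (\<forall>c\<in>\<Theta>. positive (cdim c) (\<lambda>z. h (cmap c z)))"

definition positive_or_zero_fun :: "'z chart set \<Rightarrow> ('z \<Rightarrow> complex) \<Rightarrow> bool" where
  "positive_or_zero_fun \<Theta> h \<longleftrightarrow> (\<forall>c\<in>\<Theta>. positive_or_zero (cdim c) (\<lambda>z. h (cmap c z)))"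

definition positive_morphism :: "'y chart set \<Rightarrow> 'z chart set \<Rightarrow> ('y \<Rightarrow> 'z) \<Rightarrow> bool" where
  "positive_morphism \<Theta> \<Theta>' g \<longleftrightarrow> (\<forall>c\<in>\<Theta>. (\<exists>c'\<in>\<Theta>'. meets c c' g) \<and>
     (\<forall>c'\<in>\<Theta>'. meets c c' g \<longrightarrow> positive_in_charts c c' g))"

text \<open>A split torus carries the class of the identity, that is, of its isomorphisms from \<open>torus n\<close>.\<close>

definition torus_structure :: "'a agrp \<Rightarrow> 'a chart set" where
  "torus_structure S = (\<Union>{chart_class (var S) \<lparr>cdim = n, cdom = Tpts n, cmap = \<tau>\<rparr> | n \<tau>.
     alg_iso (torus n) S \<tau>})"

definition gm_chart :: "complex chart" where
  "gm_chart = \<lparr>cdim = 1, cdom = Tpts 1, cmap = (\<lambda>z. z 0)\<rparr>"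

definition take_coords :: "nat \<Rightarrow> (nat \<Rightarrow> complex) \<Rightarrow> nat \<Rightarrow> complex" where
  "take_coords n z = (\<lambda>i. if i < n then z i else 1)"

definition drop_coords :: "nat \<Rightarrow> (nat \<Rightarrow> complex) \<Rightarrow> nat \<Rightarrow> complex" where
  "drop_coords n z = (\<lambda>i. z (n + i))"

definition prod_chart :: "'y chart \<Rightarrow> 'z chart \<Rightarrow> ('y \<times> 'z) chart" where
  "prod_chart c c' = \<lparr>cdim = cdim c + cdim c',
     cdom = {z\<in>Tpts (cdim c + cdim c'). take_coords (cdim c) z \<in> cdom c \<and>
       drop_coords (cdim c) z \<in> cdom c'},
     cmap = (\<lambda>z. (cmap c (take_coords (cdim c) z), cmap c' (drop_coords (cdim c) z)))\<rparr>"

definition prod_structure ::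
  "'y variety \<Rightarrow> 'z variety \<Rightarrow> 'y chart set \<Rightarrow> 'z chart set \<Rightarrow> ('y \<times> 'z) chart set" where
  "prod_structure Y Z \<Theta> \<Theta>' = (\<Union>c\<in>\<Theta>. \<Union>c'\<in>\<Theta>'. chart_class (prod_var Y Z) (prod_chart c c'))"

definition word_chart :: "('g, 'i) pinned_group \<Rightarrow> 'i list \<Rightarrow> 'g chart" where
  "word_chart D ws = \<lparr>cdim = length ws, cdom = Tpts (length ws),
     cmap = (\<lambda>z. foldr (\<lambda>k g. xneg D (ws ! k) (z k) \<otimes>\<^bsub>grp D\<^esub> g) [0..<length ws] \<one>\<^bsub>grp D\<^esub>)\<rparr>"

definition theta_minus :: "('g, 'i) pinned_group \<Rightarrow> 'g set \<Rightarrow> 'g chart set" where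
  "theta_minus D w = (\<Union>{chart_class (subvar (var (grp D)) (Bminus D w)) (word_chart D ws) | ws.
     reduced_word D w ws})"

text \<open>
  A rational map to \<open>T Bminus\<close> (inside \<open>G\<close>) is positive if it is so as a map to \<open>T \<times> Bminus\<close>,
  through the inverse of multiplication.
\<close>

definition positive_to_TB ::
  "('g, 'i) pinned_group \<Rightarrow> 'g set \<Rightarrow> 'x variety \<Rightarrow> 'x chart set \<Rightarrow> ('x \<Rightarrow> 'g) \<Rightarrow> bool" where
  "positive_to_TB D w V \<Theta> g \<longleftrightarrow>
     generic V (\<lambda>x. g x \<in> (\<lambda>(t, b). t \<otimes>\<^bsub>grp D\<^esub> b) ` (tor D \<times> Bminus D w)) \<and>
     positive_morphism \<Theta>
       (prod_structure (var (subgrp (grp D) (tor D))) (subvar (var (grp D)) (Bminus D w))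
          (torus_structure (subgrp (grp D) (tor D))) (theta_minus D w))
       (\<lambda>x. inv_into (tor D \<times> Bminus D w) (\<lambda>(t, b). t \<otimes>\<^bsub>grp D\<^esub> b) (g x))"

definition positive_bicrystal ::
  "('g, 'i) pinned_group \<Rightarrow> 'g set \<Rightarrow> ('g, 'x) bicrystal \<Rightarrow> 'x chart set \<Rightarrow> bool" where
  "positive_bicrystal D w X \<Theta> \<longleftrightarrow>
     linear_bicrystal D X \<and> has_type D X w \<and>
     positive_structure (Xm D X) \<Theta> \<and>
     positive_to_TB D w (Xm D X) \<Theta> (bp X) \<and>
     positive_morphism \<Theta> (torus_structure (subgrp (grp D) (tor D))) (gam D X) \<and>
     (\<forall>i\<in>idx D. positive_fun \<Theta> (phi D X i) \<and> positive_fun \<Theta> (eps D X i) \<and>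
        positive_morphism (prod_structure (var Gm) (Xm D X) (torus_structure Gm) \<Theta>) \<Theta>
          (\<lambda>(c, x). geom_e D X i c x)) \<and>
     positive_fun \<Theta> (bf X)"

text \<open>
  That the central charge is a rational function on \<open>Xm\<close> means in particular that it is defined at
  generic points, which are therefore mapped into the domain \<open>XP\<close> of \<open>f_P\<close>.
\<close>

definition strongly_positive_bicrystal ::
  "('g, 'i) pinned_group \<Rightarrow> 'g set \<Rightarrow> 'g set \<Rightarrow> ('g \<Rightarrow> complex) \<Rightarrow> ('g, 'x) bicrystal \<Rightarrow>
   'x chart set \<Rightarrow> bool" where
  "strongly_positive_bicrystal D L w fP X \<Theta> \<longleftrightarrow>
     positive_bicrystal D w X \<Theta> \<and>
     generic (Xm D X) (\<lambda>x. bp X x \<in> XP D L w) \<and>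
     positive_or_zero_fun \<Theta> (central_charge X fP)"


section \<open>Crystals\<close>

text \<open>
  The component \<open>cop C i n\<close> is the partially defined \<open>n\<close>-th power of the crystal operator of index \<open>i\<close>.
\<close>

record ('g, 'i, 'b) crystal =
  celts :: "'b set"
  cwt :: "'b \<Rightarrow> complex \<Rightarrow> 'g"
  cphi :: "'i \<Rightarrow> 'b \<Rightarrow> int extended"
  ceps :: "'i \<Rightarrow> 'b \<Rightarrow> int extended"
  cop :: "'i \<Rightarrow> int \<Rightarrow> 'b \<Rightarrow> 'b option"

definition rstep :: "('g, 'i, 'b) crystal \<Rightarrow> 'b set \<Rightarrow> 'i \<Rightarrow> int \<Rightarrow> 'b \<Rightarrow> 'b option" where
  "rstep C S i s b = (case cop C i s b of None \<Rightarrow> None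
     | Some b' \<Rightarrow> if b \<in> S \<and> b' \<in> S then Some b' else None)"

text \<open>
  In the restriction to a subset, an operator or its inverse is defined iff it stays in the subset;
  the other powers are the iterates.
\<close>

definition restrict_crystal :: "('g, 'i, 'b) crystal \<Rightarrow> 'b set \<Rightarrow> ('g, 'i, 'b) crystal" where
  "restrict_crystal C S = C\<lparr>celts := celts C \<inter> S,
     cop := (\<lambda>i n b. ((\<lambda>o'. Option.bind o' (rstep C S i (sgn n))) ^^ nat \<bar>n\<bar>) (Some b))\<rparr>"

definition subcrystal :: "('g, 'i, 'b) crystal \<Rightarrow> ('g, 'i, 'b) crystal \<Rightarrow> bool" where
  "subcrystal C' C \<longleftrightarrow> (\<exists>S\<subseteq>celts C. C' = restrict_crystal C S)"

definition normal_crystal :: "'i set \<Rightarrow> ('g, 'i, 'b) crystal \<Rightarrow> bool" where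
  "normal_crystal I C \<longleftrightarrow> (\<forall>b\<in>celts C. \<forall>i\<in>I.
     (\<exists>m::nat. ceps C i b = Fin (int m) \<and> cop C i (int m) b \<noteq> None \<and>
        (\<forall>n::nat. cop C i (int n) b \<noteq> None \<longrightarrow> n \<le> m)) \<and>
     (\<exists>m::nat. cphi C i b = Fin (int m) \<and> cop C i (- int m) b \<noteq> None \<and>
        (\<forall>n::nat. cop C i (- int n) b \<noteq> None \<longrightarrow> n \<le> m)))"

definition trop_in :: "'z chart \<Rightarrow> ('z \<Rightarrow> complex) \<Rightarrow> (nat \<Rightarrow> int) \<Rightarrow> int extended" where
  "trop_in c h b = trop (cdim c) (\<lambda>z. h (cmap c z)) b"

text \<open>
  The tropicalization of the geometric operator is a map on cocharacters of the torus with the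
  coordinates of the multiplicative group first, hence the argument \<open>case_nat n b\<close>.
\<close>

definition trop_e ::
  "('g, 'i) pinned_group \<Rightarrow> ('g, 'x) bicrystal \<Rightarrow> 'x chart \<Rightarrow> 'i \<Rightarrow> int \<Rightarrow> (nat \<Rightarrow> int) \<Rightarrow> nat \<Rightarrow> int" where
  "trop_e D X c i n b = trop_map (1 + cdim c) (cdim c)
     (chart_expr (prod_chart gm_chart c) c (\<lambda>(a, x). geom_e D X i a x)) (case_nat n b)"

definition trop_crystal ::
  "('g, 'i) pinned_group \<Rightarrow> ('g, 'x) bicrystal \<Rightarrow> 'x chart \<Rightarrow> ('g, 'i, nat \<Rightarrow> int) crystal" where
  "trop_crystal D X c = \<lparr>
     celts = cochar_lattice (cdim c),
     cwt = trop_to_torus (cdim c) (subgrp (grp D) (tor D)) (\<lambda>z. gam D X (cmap c z)),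
     cphi = (\<lambda>i b. - trop_in c (phi D X i) b),
     ceps = (\<lambda>i b. - trop_in c (eps D X i) b),
     cop = (\<lambda>i n b. Some (trop_e D X c i n b))\<rparr>"

definition crystal_f ::
  "('g, 'i) pinned_group \<Rightarrow> ('g, 'x) bicrystal \<Rightarrow> 'x chart \<Rightarrow> ('g, 'i, nat \<Rightarrow> int) crystal" where
  "crystal_f D X c = restrict_crystal (trop_crystal D X c)
     {b\<in>cochar_lattice (cdim c). Fin 0 \<le> trop_in c (bf X) b}"

definition crystal_f_hw ::
  "('g, 'i) pinned_group \<Rightarrow> ('g, 'x) bicrystal \<Rightarrow> 'x chart \<Rightarrow> ('x \<Rightarrow> 'g) \<Rightarrow> (complex \<Rightarrow> 'g) \<Rightarrow>
   ('g, 'i, nat \<Rightarrow> int) crystal" where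
  "crystal_f_hw D X c hw \<nu> = restrict_crystal (crystal_f D X c)
     {b\<in>celts (crystal_f D X c).
        trop_to_torus (cdim c) (subgrp (grp D) (tor D)) (\<lambda>z. hw (cmap c z)) b = \<nu>}"

definition trop_charge ::
  "('g, 'x) bicrystal \<Rightarrow> ('g \<Rightarrow> complex) \<Rightarrow> 'x chart \<Rightarrow> (nat \<Rightarrow> int) \<Rightarrow> int extended" where
  "trop_charge X fP c b = trop_in c (central_charge X fP) b"

definition crystal_f_hw_n ::
  "('g, 'i) pinned_group \<Rightarrow> ('g, 'x) bicrystal \<Rightarrow> 'x chart \<Rightarrow> ('x \<Rightarrow> 'g) \<Rightarrow> ('g \<Rightarrow> complex) \<Rightarrow>
   (complex \<Rightarrow> 'g) \<Rightarrow> int \<Rightarrow> ('g, 'i, nat \<Rightarrow> int) crystal" where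
  "crystal_f_hw_n D X c hw fP \<nu> n = restrict_crystal (crystal_f_hw D X c hw \<nu>)
     {b\<in>celts (crystal_f_hw D X c hw \<nu>). trop_charge X fP c b = Fin n}"

end

theory Submission
  imports Defs "HOL-Algebra.Zassenhaus" "HOL-Library.Function_Algebras"
begin

text \<open>
  The geometric operator multiplies \<open>bp X y\<close> on both sides by elements of \<open>U\<close>. Hence it fixes the
  highest weight, and it changes \<open>bf X y\<close> and the value of \<open>fP\<close> at \<open>bp X y\<close> by the same amount, so it
  fixes the central charge. (That the unipotent radical of the Borel subgroup is a group requires
  Kolchin's theorem.) Tropicalizing these identities gives the invariance under the combinatorial
  operators. Normality compares \<open>bf\<close> before and after the operator: the difference
  \<open>(a - 1) / phi + (1 / a - 1) / eps\<close> forces \<open>Trop bf \<le> min (- Trop phi) (- Trop eps)\<close> and determines when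
  \<open>Trop bf\<close> stays nonnegative.

  Rational functions and maps are evaluated at generic points of the torus, whose coordinates are
  algebraically independent, and the tropicalization of a positive function is its order of growth
  along a sequence of generic points that degenerates in the direction of a cocharacter.
\<close>

section \<open>Algebras of functions\<close>

text \<open>The obstacle is composition: a rational function need not be defined on the image of a
  rational map, and \<open>trop\<close> refers to the Newton polytopes of whichever quotient
  represents a function. Generic points remove both difficulties. The operator with parameter 1 is
  the identity, so a regular function that does not vanish on all of \<open>Xm\<close> does not
  vanish after an operator with generic parameter either; hence generic points go to generic points,
  and every identity can be evaluated there literally. Two orders of growth are used: nonzero limits
  show that the tropicalization is independent of the quotient, positive limits exclude
  cancellation, so that a sum has the minimum of the orders. Kolchin's theorem enters because the
  unipotent radical is defined as a union of normal subgroups: the product of elements of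
  \<open>N1\<close> and \<open>N0\<close> is found in it as a member of the Zariski closure of
  \<open>N1 N0\<close>, which has to be shown unipotent and connected. Without this,
  \<open>chi_st D\<close> could not be split over the unipotent factors that the operator
  creates.\<close>

definition fun_alg :: "complex set \<Rightarrow> 'a set \<Rightarrow> ('a \<Rightarrow> complex) set \<Rightarrow> bool" where
  "fun_alg k S R \<longleftrightarrow> (\<forall>c\<in>k. (\<lambda>_. c) \<in> R) \<and>
     (\<forall>f\<in>R. \<forall>g\<in>R. (\<lambda>x. f x + g x) \<in> R \<and> (\<lambda>x. f x * g x) \<in> R) \<and>
     (\<forall>f g. f \<in> R \<longrightarrow> (\<forall>x\<in>S. g x = f x) \<longrightarrow> g \<in> R)"

lemma fun_alg_const: "fun_alg k S R \<Longrightarrow> c \<in> k \<Longrightarrow> (\<lambda>_. c) \<in> R"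
  and fun_alg_add: "fun_alg k S R \<Longrightarrow> f \<in> R \<Longrightarrow> g \<in> R \<Longrightarrow> (\<lambda>x. f x + g x) \<in> R"
  and fun_alg_mult: "fun_alg k S R \<Longrightarrow> f \<in> R \<Longrightarrow> g \<in> R \<Longrightarrow> (\<lambda>x. f x * g x) \<in> R"
  by (simp_all add: fun_alg_def)

lemma fun_alg_cong: "fun_alg k S R \<Longrightarrow> f \<in> R \<Longrightarrow> (\<And>x. x \<in> S \<Longrightarrow> g x = f x) \<Longrightarrow> g \<in> R"
  unfolding fun_alg_def by blast

lemma fun_alg_cmult: "fun_alg k S R \<Longrightarrow> c \<in> k \<Longrightarrow> f \<in> R \<Longrightarrow> (\<lambda>x. c * f x) \<in> R"
  using fun_alg_mult[OF _ fun_alg_const] by fast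

lemma fun_alg_diff:
  assumes "fun_alg k S R" "-1 \<in> k" "f \<in> R" "g \<in> R" shows "(\<lambda>x. f x - g x) \<in> R"
  using fun_alg_add[OF assms(1,3) fun_alg_cmult[OF assms(1,2,4)]] by simp

lemma fun_alg_power:
  assumes "fun_alg k S R" "1 \<in> k" "f \<in> R" shows "(\<lambda>x. f x ^ n) \<in> R"
  by (induction n) (auto intro: fun_alg_const[OF assms(1,2)] fun_alg_mult[OF assms(1)] assms(3))

lemma fun_alg_sum:
  assumes "fun_alg k S R" "0 \<in> k" "\<And>j. j \<in> J \<Longrightarrow> f j \<in> R" shows "(\<lambda>x. \<Sum>j\<in>J. f j x) \<in> R"
  using assms(3)
  by (induction J rule: infinite_finite_induct)
     (auto intro: fun_alg_const[OF assms(1,2)] fun_alg_add[OF assms(1)])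

lemma fun_alg_sum_list:
  assumes "fun_alg k S R" "0 \<in> k" "\<And>j. j \<in> set js \<Longrightarrow> f j \<in> R"
  shows "(\<lambda>x. \<Sum>j\<leftarrow>js. f j x) \<in> R"
  using assms(3)
  by (induction js) (auto intro: fun_alg_const[OF assms(1,2)] fun_alg_add[OF assms(1)])

lemma fun_alg_funs_on: "fun_alg k S (funs_on k S F)"
proof -
  have "(\<lambda>x. f x + g x) \<in> funs_on k S F \<and> (\<lambda>x. f x * g x) \<in> funs_on k S F"
    if fg: "f \<in> funs_on k S F" "g \<in> funs_on k S F" for f g
  proof -
    obtain f' where f': "f' \<in> alg_gen k F" "\<forall>x\<in>S. f x = f' x"
      using fg(1) by (auto simp: funs_on_def)
    obtain g' where g': "g' \<in> alg_gen k F" "\<forall>x\<in>S. g x = g' x"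
      using fg(2) by (auto simp: funs_on_def)
    show ?thesis unfolding funs_on_def using alg_gen.add[OF f'(1) g'(1)] alg_gen.mult[OF f'(1) g'(1)] f'(2) g'(2)
      by (auto 4 4)
  qed
  moreover have "(\<lambda>_. c) \<in> funs_on k S F" if "c \<in> k" for c
    using alg_gen.const[OF that] unfolding funs_on_def by fastforce
  moreover have "g \<in> funs_on k S F" if "f \<in> funs_on k S F" "\<forall>x\<in>S. g x = f x" for f g
    using that by (auto simp: funs_on_def)
  ultimately show ?thesis unfolding fun_alg_def by blast
qed

lemma gen_in_funs_on: "f \<in> F \<Longrightarrow> f \<in> funs_on k S F"
  unfolding funs_on_def using alg_gen.gen by fastforce

text \<open>The property \<open>P\<close> may be sensitive to values off \<open>S\<close>, so the
  induction only delivers a representative \<open>h\<close> that agrees with \<open>g\<close> on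
  \<open>S\<close>; the transfer to \<open>g\<close> is left to each application.\<close>

lemma funs_on_induct [consumes 1, case_names const gen add mult]:
  assumes g: "g \<in> funs_on k S F"
    and "\<And>c. c \<in> k \<Longrightarrow> P (\<lambda>_. c)" "\<And>f. f \<in> F \<Longrightarrow> P f"
      "\<And>f g. P f \<Longrightarrow> P g \<Longrightarrow> P (\<lambda>x. f x + g x)" "\<And>f g. P f \<Longrightarrow> P g \<Longrightarrow> P (\<lambda>x. f x * g x)"
  shows "\<exists>h. P h \<and> (\<forall>x\<in>S. g x = h x)"
proof -
  obtain h where h: "h \<in> alg_gen k F" "\<forall>x\<in>S. g x = h x"
    using g by (auto simp: funs_on_def)
  from h(1) have "P h" by (induction rule: alg_gen.induct) (use assms(2-) in auto)
  with h(2) show ?thesis by blast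
qed

text \<open>A pullback is regular as soon as the pullbacks of generators are. The target
  \<open>R\<close> is any algebra of functions, which later allows choices that are not coordinate
  rings.\<close>

lemma funs_on_comp:
  assumes R: "fun_alg k S R" and \<psi>: "\<And>x. x \<in> S \<Longrightarrow> \<psi> x \<in> S'"
    and gens: "\<And>f. f \<in> F \<Longrightarrow> (\<lambda>x. f (\<psi> x)) \<in> R" and g: "g \<in> funs_on k S' F"
  shows "(\<lambda>x. g (\<psi> x)) \<in> R"
proof -
  have "\<exists>h. (\<lambda>x. h (\<psi> x)) \<in> R \<and> (\<forall>x\<in>S'. g x = h x)"
    using g by (rule funs_on_induct)
      (auto intro: fun_alg_const[OF R] gens fun_alg_add[OF R] fun_alg_mult[OF R])
  then show ?thesis using \<psi> by (auto intro: fun_alg_cong[OF R])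
qed

lemma fun_alg_subvar:
  assumes "fun_alg k S (reg V)" shows "fun_alg k S' (reg (subvar V S'))"
proof -
  let ?R = "reg (subvar V S')"
  have mem: "g \<in> ?R \<longleftrightarrow> (\<exists>h\<in>reg V. \<forall>x\<in>S'. g x = h x)" for g by (simp add: subvar_def)
  have "(\<lambda>x. f x + g x) \<in> ?R \<and> (\<lambda>x. f x * g x) \<in> ?R" if fg: "f \<in> ?R" "g \<in> ?R" for f g
  proof -
    obtain f' g' where "f' \<in> reg V" "\<forall>x\<in>S'. f x = f' x" "g' \<in> reg V" "\<forall>x\<in>S'. g x = g' x"
      using fg unfolding mem by blast
    then show ?thesis unfolding mem
      using fun_alg_add[OF assms, of f' g'] fun_alg_mult[OF assms, of f' g'] by fastforce
  qed
  moreover have "(\<lambda>_. c) \<in> ?R" if "c \<in> k" for c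
    unfolding mem by (rule bexI[OF _ fun_alg_const[OF assms that]]) simp
  moreover have "g \<in> ?R" if "f \<in> ?R" "\<forall>x\<in>S'. g x = f x" for f g
    using that unfolding mem by auto
  ultimately show ?thesis unfolding fun_alg_def by blast
qed

lemma reg_subvarI: "h \<in> reg V \<Longrightarrow> h \<in> reg (subvar V S)"
  by (auto simp: subvar_def)

section \<open>Unipotent groups of operators\<close>

text \<open>The set \<open>B\<close> stands for finite dimensionality: every subspace of
  \<open>V\<close> has dimension at most \<open>card B\<close>. The unit law is demanded on
  \<open>V\<close> only, because in the regular representation below the unit acts on an arbitrary
  function by erasing its values off the group.\<close>

locale group_rep = group H + vector_space scale
  for H :: "('a, 'b) monoid_scheme" (structure)
    and scale :: "complex \<Rightarrow> 'v::ab_group_add \<Rightarrow> 'v" +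
  fixes act :: "'a \<Rightarrow> 'v \<Rightarrow> 'v" and V :: "'v set" and B :: "'v set"
  assumes act_add: "g \<in> carrier H \<Longrightarrow> act g (u + v) = act g u + act g v"
    and act_scale: "g \<in> carrier H \<Longrightarrow> act g (scale c v) = scale c (act g v)"
    and act_mult: "g \<in> carrier H \<Longrightarrow> h \<in> carrier H \<Longrightarrow> v \<in> V \<Longrightarrow> act (g \<otimes> h) v = act g (act h v)"
    and act_one: "v \<in> V \<Longrightarrow> act \<one> v = v"
    and subspace_V: "subspace V"
    and act_V: "g \<in> carrier H \<Longrightarrow> v \<in> V \<Longrightarrow> act g v \<in> V"
    and finite_B: "finite B" and V_span: "V \<subseteq> span B"
begin

definition nab :: "'a \<Rightarrow> 'v \<Rightarrow> 'v" where "nab g v = act g v - v"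

lemma act_diff: "g \<in> carrier H \<Longrightarrow> act g (u - v) = act g u - act g v"
  using act_add[of g "u - v" v] by (simp add: algebra_simps)

lemma act_zero: "g \<in> carrier H \<Longrightarrow> act g 0 = 0"
  using act_diff[of g 0 0] by simp

text \<open>Here \<open>dim\<close> is the size of some basis; the finite spanning set
  \<open>B\<close> makes all bases finite, so that their sizes can be compared.\<close>

lemma dim_strict:
  assumes "subspace U1" "U1 \<subset> U2" "U2 \<subseteq> V" shows "dim U1 < dim U2"
proof -
  obtain b1 where b1: "b1 \<subseteq> U1" "independent b1" "U1 \<subseteq> span b1" "card b1 = dim U1"
    using basis_exists by blast
  obtain b2 where b2: "b2 \<subseteq> U2" "independent b2" "U2 \<subseteq> span b2" "card b2 = dim U2"
    using basis_exists by blast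
  have "b2 \<subseteq> span B" using b2(1) assms(3) V_span by order
  then have f2: "finite b2" using independent_span_bound[OF finite_B b2(2)] by simp
  obtain v where v: "v \<in> U2" "v \<notin> U1" using assms(2) by blast
  have "span b1 \<subseteq> U1" using b1(1) assms(1) span_minimal by blast
  then have vb: "v \<notin> span b1" using v(2) by blast
  then have "independent (insert v b1)" using b1(2) by (simp add: independent_insertI)
  moreover have "insert v b1 \<subseteq> span b2" using v(1) b1(1) b2(3) assms(2) by blast
  ultimately have i: "finite (insert v b1) \<and> card (insert v b1) \<le> card b2"
    by (rule independent_span_bound[OF f2])
  have "v \<notin> b1" using vb span_base by blast
  then show ?thesis using i b1(4) b2(4) by auto
qed

lemma dim_bound:
  assumes "U \<subseteq> V" shows "dim U \<le> card B"
proof -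
  obtain b1 where b1: "b1 \<subseteq> U" "independent b1" "U \<subseteq> span b1" "card b1 = dim U"
    using basis_exists by blast
  have "b1 \<subseteq> span B" using b1(1) assms V_span by order
  then show ?thesis using independent_span_bound[OF finite_B b1(2)] b1(4) by simp
qed

definition stable :: "'a set \<Rightarrow> 'v set \<Rightarrow> bool" where
  "stable N U \<longleftrightarrow> subspace U \<and> U \<subseteq> V \<and> (\<forall>g\<in>N. \<forall>u\<in>U. act g u \<in> U)"

definition nilp :: "'a \<Rightarrow> 'v set \<Rightarrow> bool" where
  "nilp g U \<longleftrightarrow> (\<forall>v\<in>U. \<exists>n. (nab g ^^ n) v = 0)"

lemma nab_in: "subspace U \<Longrightarrow> act g u \<in> U \<Longrightarrow> u \<in> U \<Longrightarrow> nab g u \<in> U"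
  by (simp add: nab_def subspace_diff)

lemma nab_pow_in:
  "stable N U \<Longrightarrow> g \<in> N \<Longrightarrow> u \<in> U \<Longrightarrow> (nab g ^^ n) u \<in> U"
  by (induction n) (auto simp: stable_def intro: nab_in)

text \<open>Starting outside \<open>W\<close>, the iterates of \<open>nab g\<close> reach 0 and thus
  enter \<open>W\<close>; the last one before that is the witness.\<close>

lemma nilp_step:
  assumes "stable {g} U" "nilp g U" "W \<subset> U" "0 \<in> W"
  shows "\<exists>u\<in>U - W. nab g u \<in> W"
proof -
  obtain v where v: "v \<in> U" "v \<notin> W" using assms(3) by blast
  obtain n where "(nab g ^^ n) v = 0" using assms(2) v by (auto simp: nilp_def)
  then have "\<exists>n. (nab g ^^ n) v \<in> W" using assms(4) by (intro exI[of _ n]) simp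
  then obtain n where n: "(nab g ^^ n) v \<in> W" "\<forall>m<n. (nab g ^^ m) v \<notin> W"
    using exists_least_iff[of "\<lambda>n. (nab g ^^ n) v \<in> W"] by blast
  then obtain m where m: "n = Suc m" using v by (cases n) auto
  show ?thesis using n m nab_pow_in[OF assms(1) _ v(1), of g m] by (intro bexI[of _ "(nab g ^^ m) v"]) auto
qed

lemma subspace_fixed_mod:
  assumes "subspace W" "subspace U" "N \<subseteq> carrier H"
  shows "subspace {u\<in>U. \<forall>g\<in>N. nab g u \<in> W}"
proof -
  have 1: "nab g (u + v) = nab g u + nab g v" "nab g (scale c u) = scale c (nab g u)"
    if "g \<in> N" for g u v c
    using that assms(3) by (auto simp: nab_def act_add act_scale scale_right_diff_distrib)
  have 2: "nab g 0 = 0" if "g \<in> N" for g using that assms(3) by (auto simp: nab_def act_zero)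
  show ?thesis
    unfolding subspace_def using assms(1,2)
    by (auto simp: 1 2 subspace_0 subspace_add subspace_scale)
qed

text \<open>Since \<open>g h = h (h^-1 g h)\<close>, an element \<open>h\<close> normalizing
  \<open>N\<close> permutes the conditions that define the subspace.\<close>

lemma fixed_mod_stable:
  assumes W: "stable M W" and U: "stable M U" and M: "subgroup M H" and N: "N \<subseteq> carrier H"
    and conj: "\<And>h g u. h \<in> M \<Longrightarrow> g \<in> N \<Longrightarrow> inv h \<otimes> g \<otimes> h \<in> N"
  shows "stable M {u\<in>U. \<forall>g\<in>N. nab g u \<in> W}"
proof -
  have "act h u \<in> U \<and> (\<forall>g\<in>N. nab g (act h u) \<in> W)"
    if h: "h \<in> M" and u: "u \<in> U" "\<forall>g\<in>N. nab g u \<in> W" for h u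
  proof (intro conjI ballI)
    show "act h u \<in> U" using U h u by (auto simp: stable_def)
    fix g assume g: "g \<in> N"
    have hc: "h \<in> carrier H" using M h subgroup.mem_carrier by fastforce
    have gc: "g \<in> carrier H" using g N by blast
    have uV: "u \<in> V" using U u by (auto simp: stable_def)
    have "act g (act h u) = act (h \<otimes> (inv h \<otimes> g \<otimes> h)) u"
      using hc gc uV by (simp add: act_mult[symmetric] m_assoc[symmetric])
    also have "\<dots> = act h (act (inv h \<otimes> g \<otimes> h) u)" using hc gc uV by (simp add: act_mult)
    finally have "nab g (act h u) = act h (nab (inv h \<otimes> g \<otimes> h) u)"
      using hc by (simp add: nab_def act_diff)
    moreover have "nab (inv h \<otimes> g \<otimes> h) u \<in> W" using conj[OF h g] u by blast
    ultimately show "nab g (act h u) \<in> W" using W h by (auto simp: stable_def)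
  qed
  moreover have "subspace {u\<in>U. \<forall>g\<in>N. nab g u \<in> W}"
    using subspace_fixed_mod[OF _ _ N] W U by (auto simp: stable_def)
  ultimately show ?thesis using U by (auto simp: stable_def)
qed

lemma stable_mono: "stable N U \<Longrightarrow> M \<subseteq> N \<Longrightarrow> stable M U"
  by (auto simp: stable_def)

lemma subset_fixed_mod: "stable N W \<Longrightarrow> W \<subseteq> U \<Longrightarrow> W \<subseteq> {u\<in>U. \<forall>g\<in>N. nab g u \<in> W}"
  by (auto simp: stable_def intro: nab_in)

text \<open>Kolchin's theorem, by induction along a solvable series.\<close>

lemma kolchin:
  assumes "solvable_seq H N" and "\<forall>g\<in>N. nilp g V" and "stable N W" "stable N U" "W \<subset> U"
  shows "\<exists>u\<in>U - W. \<forall>g\<in>N. nab g u \<in> W"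
  using assms
proof (induction arbitrary: W U rule: solvable_seq.induct)
  case unity
  then obtain u where u: "u \<in> U - W" by blast
  then have "nab \<one> u = 0" using unity by (auto simp: nab_def stable_def act_one)
  moreover have "0 \<in> W" using unity by (auto simp: stable_def subspace_0)
  ultimately show ?case using u by (intro bexI[of _ u]) auto
next
  case (extension K N)
  have NC: "N \<subseteq> carrier H" using extension.hyps subgroup.subset by blast
  have K: "subgroup K (H\<lparr>carrier := N\<rparr>)" using extension.hyps normal_imp_subgroup by blast
  then have KN: "K \<subseteq> N" using subgroup.subset by fastforce
  have KC: "K \<subseteq> carrier H" using KN NC by blast
  have der: "derived H N \<subseteq> K" using derived_of_subgroup_minimal extension.hyps by blast
  have comm: "inv g \<otimes> inv h \<otimes> g \<otimes> h \<in> K" if "g \<in> N" "h \<in> N" for g h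
  proof -
    have "inv g \<in> N" "inv h \<in> N" using that extension.hyps subgroup.m_inv_closed by fastforce+
    then have "inv g \<otimes> inv h \<otimes> inv (inv g) \<otimes> inv (inv h) \<in> derived H N"
      unfolding derived_def by (intro generate.incl) blast
    moreover have "inv (inv g) = g" "inv (inv h) = h" using that NC by auto
    ultimately show ?thesis using der by auto
  qed
  have conjK: "inv h \<otimes> g \<otimes> h \<in> K" if "h \<in> N" "g \<in> K" for h g
  proof -
    have gN: "g \<in> N" "g \<in> carrier H" "h \<in> carrier H" using that KN NC by auto
    have "g \<otimes> (inv g \<otimes> inv h \<otimes> g \<otimes> h) \<in> K"
      using subgroup.m_closed[OF K that(2) comm[OF gN(1) that(1)]] by simp
    then show ?thesis using gN by (simp add: m_assoc[symmetric])
  qed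
  \<comment> \<open>By induction \<open>K\<close> fixes some vector of \<open>U - W\<close> modulo
    \<open>W\<close>. On the space \<open>V1\<close> of all such vectors the commutators of
    \<open>N\<close> act trivially modulo \<open>W\<close>, so \<open>N\<close> acts on
    \<open>V1 / W\<close> by commuting operators.\<close>
  define V1 where "V1 = {u\<in>U. \<forall>g\<in>K. nab g u \<in> W}"
  have V1: "stable N V1" unfolding V1_def
    using fixed_mod_stable[OF extension.prems(2,3) \<open>subgroup N H\<close> KC] conjK by blast
  have WV1: "W \<subset> V1"
  proof -
    have "\<exists>u\<in>U - W. \<forall>g\<in>K. nab g u \<in> W"
      using extension.IH[OF _ stable_mono[OF _ KN] stable_mono[OF _ KN]] extension.prems KN by blast
    moreover have "W \<subseteq> V1" unfolding V1_def
      using subset_fixed_mod[OF stable_mono[OF _ KN]] extension.prems by blast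
    ultimately show ?thesis unfolding V1_def by blast
  qed
  \<comment> \<open>Of the stable subspaces strictly above \<open>W\<close> inside
    \<open>V1\<close>, one of least dimension is taken. For \<open>g\<close> in \<open>N\<close>,
    its vectors fixed by \<open>g\<close> modulo \<open>W\<close> form such a subspace again: stable
    because the operators commute modulo \<open>W\<close>, larger than \<open>W\<close> because
    \<open>g\<close> is unipotent. By minimality all of \<open>U'\<close> is fixed modulo
    \<open>W\<close>.\<close>
  define P where "P = (\<lambda>U'. stable N U' \<and> W \<subset> U' \<and> U' \<subseteq> V1)"
  have "P V1" using V1 WV1 by (simp add: P_def)
  then obtain U' where U': "P U'" "\<And>y. P y \<Longrightarrow> dim U' \<le> dim y"
    using ex_has_least_nat[of P V1 dim] by blast
  have sU': "stable N U'" "W \<subset> U'" "U' \<subseteq> V1" using U'(1) by (auto simp: P_def)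
  have all: "nab g u \<in> W" if g: "g \<in> N" and u: "u \<in> U'" for g u
  proof -
    let ?Ug = "{u\<in>U'. \<forall>k\<in>{g}. nab k u \<in> W}"
    have gc: "g \<in> carrier H" using g NC by blast
    have "act h v \<in> ?Ug" if h: "h \<in> N" and v: "v \<in> ?Ug" for h v
    proof -
      have hc: "h \<in> carrier H" using h NC by blast
      have vV: "v \<in> V" using v sU' by (auto simp: stable_def)
      let ?k = "inv g \<otimes> inv h \<otimes> g \<otimes> h"
      have kc: "?k \<in> carrier H" using gc hc by simp
      have kw: "nab ?k v \<in> W" using v sU'(3) comm[OF g h] by (auto simp: V1_def)
      have "g \<otimes> h = h \<otimes> (g \<otimes> ?k)" using gc hc by (simp add: m_assoc[symmetric] inv_solve_right)
      then have "act g (act h v) = act h (act g (act ?k v))"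
        using gc hc kc vV by (simp add: act_mult[symmetric] act_V)
      moreover define w where "w = nab ?k v"
      moreover from w_def have "act ?k v = v + w" by (simp add: nab_def)
      ultimately have "act g (act h v) = act h (act g v) + act h (act g w)"
        using gc hc by (simp add: act_add)
      then have "nab g (act h v) = act h (nab g v) + act h (act g w)"
        using hc by (simp add: nab_def act_diff)
      then have "nab g (act h v) \<in> W"
        using v kw w_def extension.prems(2) g h by (auto simp: stable_def intro: subspace_add)
      then show ?thesis using v h sU' by (auto simp: stable_def)
    qed
    moreover have "subspace ?Ug"
      using subspace_fixed_mod[of W U' "{g}"] extension.prems(2) sU' gc by (auto simp: stable_def)
    ultimately have st: "stable N ?Ug" using sU' by (auto simp: stable_def)
    have sg: "stable {g} U'" using stable_mono[OF sU'(1)] g by blast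
    have "nilp g U'" using extension.prems(1) g sU' by (auto simp: nilp_def stable_def)
    then have "\<exists>u\<in>U' - W. nab g u \<in> W"
      using nilp_step[OF sg] sU' extension.prems(2) by (auto simp: stable_def subspace_0)
    moreover have "W \<subseteq> ?Ug" using sU' extension.prems(2) g by (auto simp: stable_def intro: nab_in)
    ultimately have "P ?Ug" using st sU' by (auto simp: P_def)
    then have "dim U' \<le> dim ?Ug" using U'(2) by blast
    then have "\<not> ?Ug \<subset> U'" using dim_strict[of ?Ug U'] st sU' by (auto simp: stable_def)
    then show ?thesis using u by blast
  qed
  obtain u where "u \<in> U'" "u \<notin> W" using sU' by blast
  then show ?case using all sU' by (intro bexI[of _ u]) (auto simp: V1_def)
qed

text \<open>Kolchin's theorem is applied to the normal factor only. If a stable subspace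
  \<open>W\<close> of greatest dimension on which the product is nilpotent were not
  \<open>V\<close>, the vectors fixed by \<open>N\<close> modulo \<open>W\<close> would form a
  larger one: there \<open>g1 g0\<close> agrees with \<open>g1\<close> modulo
  \<open>W\<close>.\<close>

lemma nilp_mult:
  assumes N: "solvable_seq H N" "N \<lhd> H" "\<forall>g\<in>N. nilp g V"
    and g1: "g1 \<in> carrier H" "nilp g1 V" and g0: "g0 \<in> N"
  shows "nilp (g1 \<otimes> g0) V"
proof -
  let ?g = "g1 \<otimes> g0"
  have sN: "subgroup N H" using N(2) normal_imp_subgroup by blast
  have NC: "N \<subseteq> carrier H" using sN subgroup.subset by blast
  have gc: "?g \<in> carrier H" "g0 \<in> carrier H" using g1 g0 NC by auto
  define P where "P = (\<lambda>W. stable (carrier H) W \<and> nilp ?g W)"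
  have P0: "P {0}"
    using subspace_V by (auto simp: P_def stable_def nilp_def act_zero subspace_0 intro: exI[of _ 0])
  have "\<exists>W. P W \<and> (\<forall>W'. P W' \<longrightarrow> dim W' \<le> dim W)"
    using dim_bound
    by (intro ex_has_greatest_nat[where P = P and f = dim and k = "{0}" and b = "Suc (card B)"] P0)
       (auto simp: P_def stable_def less_Suc_eq_le)
  then obtain W where W: "P W" and maxi: "\<And>W'. P W' \<Longrightarrow> dim W' \<le> dim W" by blast
  have sW: "stable (carrier H) W" using W by (simp add: P_def)
  have sV: "stable (carrier H) V" using subspace_V act_V by (auto simp: stable_def)
  have "W = V"
  proof (rule ccontr)
    assume "W \<noteq> V"
    then have "W \<subset> V" using sW by (auto simp: stable_def)
    then obtain u where u: "u \<in> V - W" "\<forall>g\<in>N. nab g u \<in> W"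
      using kolchin[OF N(1,3) stable_mono[OF sW NC] stable_mono[OF sV NC]] by blast
    let ?V2 = "{u\<in>V. \<forall>g\<in>N. nab g u \<in> W}"
    have "inv h \<otimes> g \<otimes> h \<in> N" if "h \<in> carrier H" "g \<in> N" for h g
      using normal.inv_op_closed1[OF N(2) that] .
    then have s2: "stable (carrier H) ?V2"
      using fixed_mod_stable[OF sW sV subgroup_self NC] by blast
    have pw: "(nab ?g ^^ n) v - (nab g1 ^^ n) v \<in> W" if v: "v \<in> ?V2" for v n
    proof (induction n)
      case 0 then show ?case using sW by (simp add: stable_def subspace_0)
    next
      case (Suc n)
      let ?a = "(nab ?g ^^ n) v" and ?b = "(nab g1 ^^ n) v"
      have b: "?b \<in> ?V2" by (rule nab_pow_in[OF s2 g1(1) v])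
      have "nab ?g ?a - nab g1 ?b = (nab ?g ?a - nab ?g ?b) + (nab ?g ?b - nab g1 ?b)" by simp
      moreover have "nab ?g ?a - nab ?g ?b = nab ?g (?a - ?b)"
        using gc by (simp add: nab_def act_diff)
      moreover have "nab ?g (?a - ?b) \<in> W"
        using Suc sW gc by (auto simp: stable_def intro!: nab_in)
      moreover have "nab ?g ?b - nab g1 ?b = act g1 (nab g0 ?b)"
        using b g1 gc by (simp add: nab_def act_mult act_diff)
      moreover have "act g1 (nab g0 ?b) \<in> W" using b g0 g1 sW by (auto simp: stable_def)
      ultimately show ?case using sW by (simp add: stable_def subspace_add)
    qed
    have "nilp ?g ?V2" unfolding nilp_def
    proof
      fix v assume v: "v \<in> ?V2"
      then obtain n where "(nab g1 ^^ n) v = 0" using g1 by (auto simp: nilp_def)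
      then have "(nab ?g ^^ n) v \<in> W" using pw[OF v, of n] by simp
      then obtain m where "(nab ?g ^^ m) ((nab ?g ^^ n) v) = 0"
        using W by (auto simp: P_def nilp_def)
      then show "\<exists>n. (nab ?g ^^ n) v = 0" by (metis comp_apply funpow_add)
    qed
    then have "dim ?V2 \<le> dim W" using maxi s2 by (simp add: P_def)
    moreover have "W \<subset> ?V2"
      using u subset_fixed_mod[OF stable_mono[OF sW NC], of V] sW by (auto simp: stable_def)
    ultimately show False using dim_strict[of W ?V2] sW by (auto simp: stable_def)
  qed
  then show ?thesis using W by (simp add: P_def)
qed

text \<open>The kernels of the powers of \<open>nab g\<close> grow strictly until they exhaust
  \<open>V\<close>, which bounds the number of steps independently of \<open>g\<close>. Only a
  uniform exponent lets unipotency pass to a Zariski closure.\<close>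

lemma nilp_uniform:
  assumes g: "g \<in> carrier H" "nilp g V" and v: "v \<in> V" shows "(nab g ^^ card B) v = 0"
proof -
  define K where "K = (\<lambda>j. {v\<in>V. (nab g ^^ j) v = 0})"
  have lin: "(nab g ^^ j) (u + w) = (nab g ^^ j) u + (nab g ^^ j) w"
    "(nab g ^^ j) (scale c u) = scale c ((nab g ^^ j) u)" for j u w c
    using g by (induction j) (simp_all add: nab_def act_add act_scale scale_right_diff_distrib)
  have z: "(nab g ^^ j) 0 = 0" for j using lin(2)[of j 0 0] by simp
  have sK: "subspace (K j)" for j
    unfolding subspace_def K_def using subspace_V
    by (auto simp: lin z subspace_0 subspace_add subspace_scale)
  have "K j = V \<or> j \<le> dim (K j)" for j
  proof (induction j)
    case 0 then show ?case by simp
  next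
    case (Suc j)
    have sub: "K j \<subseteq> K (Suc j)" "K (Suc j) \<subseteq> V"
      using g z[of 1] by (auto simp: K_def)
    show ?case
    proof (cases "K j = V")
      case True then show ?thesis using sub by blast
    next
      case False
      then have "K j \<subset> V" by (auto simp: K_def)
      moreover have "stable {g} V" using subspace_V act_V g by (auto simp: stable_def)
      ultimately obtain u where "u \<in> V - K j" "nab g u \<in> K j"
        using nilp_step[of g V "K j"] g sK subspace_0 by blast
      then have "u \<in> K (Suc j)" "u \<notin> K j"
        by (auto simp: K_def funpow_Suc_right simp del: funpow.simps)
      then have "K j \<subset> K (Suc j)" using sub by blast
      then have "dim (K j) < dim (K (Suc j))" using dim_strict sK sub by blast
      then show ?thesis using Suc False by linarith
    qed
  qed
  note this[of "card B"]
  moreover have "K (card B) = V" if "card B \<le> dim (K (card B))"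
  proof (rule ccontr)
    assume "K (card B) \<noteq> V"
    then have "K (card B) \<subset> V" by (auto simp: K_def)
    then show False using dim_strict[OF sK, of "card B" V] dim_bound[of V] that by simp
  qed
  ultimately have "K (card B) = V" by blast
  then show ?thesis using v by (auto simp: K_def)
qed

end

section \<open>The unipotent radical is closed under multiplication\<close>

text \<open>The function of two variables comes from the tensor square of \<open>R\<close>, the list
  enumerating pure tensors. For the function \<open>h (x y)\<close> this is the comultiplication of
  the coordinate ring.\<close>

definition splits :: "('a \<Rightarrow> complex) set \<Rightarrow> 'a set \<Rightarrow> ('a \<times> 'a \<Rightarrow> complex) \<Rightarrow> bool" where
  "splits R S h \<longleftrightarrow> (\<exists>xs. set xs \<subseteq> R \<times> R \<and> (\<forall>x\<in>S. \<forall>y\<in>S. h (x, y) = (\<Sum>p\<leftarrow>xs. fst p x * snd p y)))"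

lemma sum_list_product:
  fixes f :: "'c \<Rightarrow> 'd::comm_semiring_0"
  shows "(\<Sum>p\<leftarrow>List.product xs ys. f (fst p) * g (snd p)) = (\<Sum>x\<leftarrow>xs. f x) * (\<Sum>y\<leftarrow>ys. g y)"
  by (induction xs) (auto simp: o_def sum_list_const_mult algebra_simps)

lemma splits_add: "splits R S h \<Longrightarrow> splits R S h' \<Longrightarrow> splits R S (\<lambda>z. h z + h' z)"
  unfolding splits_def
  by (elim exE conjE, rename_tac xs ys, rule_tac x = "xs @ ys" in exI) auto

lemma splits_mult:
  assumes R: "fun_alg k S R" and "splits R S h" "splits R S h'"
  shows "splits R S (\<lambda>z. h z * h' z)"
proof -
  obtain xs where xs: "set xs \<subseteq> R \<times> R"
    "\<And>x y. x \<in> S \<Longrightarrow> y \<in> S \<Longrightarrow> h (x, y) = (\<Sum>p\<leftarrow>xs. fst p x * snd p y)"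
    using assms(2) by (auto simp: splits_def)
  obtain ys where ys: "set ys \<subseteq> R \<times> R"
    "\<And>x y. x \<in> S \<Longrightarrow> y \<in> S \<Longrightarrow> h' (x, y) = (\<Sum>p\<leftarrow>ys. fst p x * snd p y)"
    using assms(3) by (auto simp: splits_def)
  let ?f = "\<lambda>(p, q). ((\<lambda>x. fst p x * fst q x), (\<lambda>y. snd p y * snd q y))"
  have "set (map ?f (List.product xs ys)) \<subseteq> R \<times> R"
    using xs(1) ys(1) fun_alg_mult[OF R] by (auto simp: subset_iff)
  moreover have "h (x, y) * h' (x, y) = (\<Sum>p\<leftarrow>map ?f (List.product xs ys). fst p x * snd p y)"
    if "x \<in> S" "y \<in> S" for x y
    unfolding xs(2)[OF that] ys(2)[OF that] sum_list_product[symmetric]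
    by (intro arg_cong[where f = sum_list]) (auto simp: algebra_simps)
  ultimately show ?thesis unfolding splits_def by blast
qed

lemma splits_prod:
  assumes R: "fun_alg k S R" "1 \<in> k" and f: "f \<in> R" and g: "g \<in> R"
  shows "splits R S (\<lambda>(x, y). f x * g y)"
  unfolding splits_def by (rule exI[of _ "[(f, g)]"]) (use f g in auto)

section \<open>The regular representation and unipotent elements\<close>

locale complex_alg_group = group H for H :: "'a agrp" (structure) +
  assumes alg: "fun_alg UNIV (carrier H) (regfun H)"
    and split: "h \<in> regfun H \<Longrightarrow> splits (regfun H) (carrier H) (\<lambda>(x, y). h (x \<otimes> y))"
begin

abbreviation R where "R \<equiv> regfun H"

text \<open>Both factors may vary with \<open>x\<close>, as is needed for iterated differences in
  which the group element also occurs in the argument.\<close>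

lemma reg_comp_mult:
  assumes h: "h \<in> R" and \<alpha>: "\<And>r. r \<in> R \<Longrightarrow> (\<lambda>x. r (\<alpha> x)) \<in> R" "\<And>x. x \<in> carrier H \<Longrightarrow> \<alpha> x \<in> carrier H"
    and \<beta>: "\<And>r. r \<in> R \<Longrightarrow> (\<lambda>x. r (\<beta> x)) \<in> R" "\<And>x. x \<in> carrier H \<Longrightarrow> \<beta> x \<in> carrier H"
  shows "(\<lambda>x. h (\<alpha> x \<otimes> \<beta> x)) \<in> R"
proof -
  obtain xs where xs: "set xs \<subseteq> R \<times> R"
    "\<And>x y. x \<in> carrier H \<Longrightarrow> y \<in> carrier H \<Longrightarrow> h (x \<otimes> y) = (\<Sum>p\<leftarrow>xs. fst p x * snd p y)"
    using split[OF h] by (auto simp: splits_def)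
  have "(\<lambda>x. \<Sum>p\<leftarrow>xs. fst p (\<alpha> x) * snd p (\<beta> x)) \<in> R"
    using xs(1) by (intro fun_alg_sum_list[OF alg] fun_alg_mult[OF alg] \<alpha>(1) \<beta>(1)) (auto simp: subset_iff)
  then show ?thesis by (rule fun_alg_cong[OF alg]) (simp add: xs(2) \<alpha> \<beta>)
qed

lemma reg_const: "(\<lambda>_. c) \<in> R"
  by (rule fun_alg_const[OF alg]) simp

lemma reg_left: "h \<in> R \<Longrightarrow> g \<in> carrier H \<Longrightarrow> (\<lambda>x. h (g \<otimes> x)) \<in> R"
  using reg_comp_mult[of h "\<lambda>_. g" "\<lambda>x. x"] reg_const by simp

lemma reg_right: "h \<in> R \<Longrightarrow> g \<in> carrier H \<Longrightarrow> (\<lambda>x. h (x \<otimes> g)) \<in> R"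
  using reg_comp_mult[of h "\<lambda>x. x" "\<lambda>_. g"] reg_const by simp

definition scl :: "complex \<Rightarrow> ('a \<Rightarrow> complex) \<Rightarrow> 'a \<Rightarrow> complex" where "scl c f = (\<lambda>x. c * f x)"

text \<open>In the vector space of functions equality is literal, so the arbitrary values off the
  group have to be normalized.\<close>

definition rs :: "('a \<Rightarrow> complex) \<Rightarrow> 'a \<Rightarrow> complex" where "rs f = (\<lambda>x. if x \<in> carrier H then f x else 0)"

definition rtr :: "'a \<Rightarrow> ('a \<Rightarrow> complex) \<Rightarrow> 'a \<Rightarrow> complex" where "rtr g f = rs (\<lambda>x. f (x \<otimes> g))"

abbreviation dlt :: "'a \<Rightarrow> ('a \<Rightarrow> complex) \<Rightarrow> 'a \<Rightarrow> complex" where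
  "dlt g \<equiv> (\<lambda>k y. k (y \<otimes> g) - k y)"

sublocale fs: vector_space scl
  by unfold_locales (auto simp: scl_def fun_eq_iff algebra_simps)

text \<open>Local finiteness of the regular representation: comultiplication writes the right
  translate of \<open>h\<close> by \<open>g\<close> as a combination of the finitely many left
  tensor factors, with coefficients depending on \<open>g\<close>. Hence the translates of
  \<open>h\<close> span a stable subspace of finite dimension.\<close>

lemma translates_rep:
  assumes h: "h \<in> R"
  shows "\<exists>V B. group_rep H scl rtr V B \<and> V \<subseteq> R \<and> (\<forall>v\<in>V. rs v = v) \<and> rs h \<in> V"
proof -
  obtain xs where xs: "set xs \<subseteq> R \<times> R"
    "\<And>x y. x \<in> carrier H \<Longrightarrow> y \<in> carrier H \<Longrightarrow> h (x \<otimes> y) = (\<Sum>p\<leftarrow>xs. fst p x * snd p y)"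
    using split[OF h] by (auto simp: splits_def)
  define B where "B = (\<lambda>p. rs (fst p)) ` set xs"
  define V where "V = fs.span ((\<lambda>g. rtr g h) ` carrier H)"
  have sub: "fs.subspace {v\<in>R. rs v = v}"
    unfolding fs.subspace_def
    by (auto simp: rs_def scl_def fun_eq_iff plus_fun_def zero_fun_def
        intro: reg_const fun_alg_add[OF alg] fun_alg_cmult[OF alg])
  have "rtr g h \<in> R \<and> rs (rtr g h) = rtr g h" if "g \<in> carrier H" for g
    using fun_alg_cong[OF alg reg_right[OF h that]] by (auto simp: rtr_def rs_def)
  then have VR: "V \<subseteq> {v\<in>R. rs v = v}"
    unfolding V_def by (intro fs.span_minimal sub) auto
  have add: "rtr g (u + v) = rtr g u + rtr g v" and scale: "rtr g (scl c v) = scl c (rtr g v)" for g u v c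
    by (auto simp: rtr_def rs_def scl_def fun_eq_iff plus_fun_def)
  have mult: "rtr (g \<otimes> k) v = rtr g (rtr k v)" if "g \<in> carrier H" "k \<in> carrier H" for g k v
    using that by (auto simp: rtr_def rs_def fun_eq_iff m_assoc)
  have zero: "rtr g 0 = 0" for g by (auto simp: rtr_def rs_def fun_eq_iff)
  have "rtr g v \<in> V" if g: "g \<in> carrier H" and v: "v \<in> V" for g v
  proof -
    have "fs.subspace {v. rtr g v \<in> V}"
      unfolding fs.subspace_def V_def by (auto simp: add scale zero fs.span_zero fs.span_add fs.span_scale)
    moreover have "rtr g (rtr k h) \<in> V" if "k \<in> carrier H" for k
      unfolding mult[OF g that, symmetric] V_def using g that by (intro fs.span_base) auto
    ultimately have "V \<subseteq> {v. rtr g v \<in> V}"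
      by (subst (1) V_def) (intro fs.span_minimal, auto)
    then show ?thesis using v by blast
  qed
  moreover have "V \<subseteq> fs.span B"
  proof -
    have "rtr g h \<in> fs.span B" if g: "g \<in> carrier H" for g
    proof -
      have "rtr g h = (\<Sum>p\<leftarrow>xs. scl (snd p g) (rs (fst p)))"
      proof
        fix x
        have "(\<Sum>p\<leftarrow>ys. scl (snd p g) (rs (fst p))) x = (\<Sum>p\<leftarrow>ys. scl (snd p g) (rs (fst p)) x)" for ys
          by (induction ys) auto
        moreover have "(\<Sum>p\<leftarrow>ys. scl (snd p g) (rs (fst p)) x) = (if x \<in> carrier H then (\<Sum>p\<leftarrow>ys. fst p x * snd p g) else 0)" for ys
          by (induction ys) (auto simp: scl_def rs_def)
        ultimately show "rtr g h x = (\<Sum>p\<leftarrow>xs. scl (snd p g) (rs (fst p))) x"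
          using g by (simp add: rtr_def rs_def xs(2))
      qed
      moreover have "(\<Sum>p\<leftarrow>ys. scl (snd p g) (rs (fst p))) \<in> fs.span B" if "set ys \<subseteq> set xs" for ys
        using that
      proof (induction ys)
        case Nil then show ?case using fs.span_zero[of B] by (simp add: zero_fun_def)
      next
        case (Cons p ys)
        then have "rs (fst p) \<in> B" by (auto simp: B_def)
        then have "scl (snd p g) (rs (fst p)) \<in> fs.span B" by (intro fs.span_scale fs.span_base)
        from fs.span_add[OF this Cons.IH] show ?case using Cons.prems by (simp add: plus_fun_def)
      qed
      ultimately show ?thesis by simp
    qed
    then show ?thesis unfolding V_def by (intro fs.span_minimal fs.subspace_span) auto
  qed
  moreover have "rtr \<one> v = v" if "v \<in> V" for v
  proof -
    have "rs v = v" using that VR by blast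
    then show ?thesis by (auto simp: rtr_def rs_def fun_eq_iff split: if_splits)
  qed
  moreover have "fs.subspace V" unfolding V_def by (rule fs.subspace_span)
  moreover have "finite B" by (simp add: B_def)
  ultimately have "group_rep H scl rtr V B"
    by unfold_locales (auto simp: add scale mult)
  moreover have "rs h = rtr \<one> h" by (auto simp: rtr_def rs_def fun_eq_iff)
  then have "rs h \<in> V" unfolding V_def using fs.span_base by auto
  ultimately show ?thesis using VR by blast
qed

text \<open>For constant \<open>\<alpha>\<close> this makes unipotency of exponent \<open>m\<close>,
  tested on one function at one point, a closed condition on \<open>g\<close>. The induction needs a
  varying \<open>\<alpha>\<close>, since each difference also evaluates at \<open>\<alpha> g\<close>
  times \<open>g\<close>.\<close>

lemma dlt_reg:
  assumes "h \<in> R" "\<And>r. r \<in> R \<Longrightarrow> (\<lambda>x. r (\<alpha> x)) \<in> R" "\<And>x. x \<in> carrier H \<Longrightarrow> \<alpha> x \<in> carrier H"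
  shows "(\<lambda>g. (dlt g ^^ m) h (\<alpha> g)) \<in> R"
  using assms(2,3)
proof (induction m arbitrary: \<alpha>)
  case 0 then show ?case using assms(1) by simp
next
  case (Suc m)
  have "(\<lambda>g. (dlt g ^^ m) h (\<alpha> g \<otimes> g)) \<in> R"
    using Suc.prems by (intro Suc.IH reg_comp_mult) auto
  then show ?case using fun_alg_diff[OF alg _ _ Suc.IH] Suc.prems by simp
qed

lemma unipotent_rep:
  assumes V: "group_rep H scl rtr V B" "V \<subseteq> R" "\<forall>v\<in>V. rs v = v"
  shows dlt_eq: "x \<in> carrier H \<Longrightarrow> g \<in> carrier H \<Longrightarrow>
      (group_rep.nab rtr g ^^ n) (rs w) x = (dlt g ^^ n) w x"
    and unipotent_nilp: "unipotent_elt H g \<Longrightarrow> group_rep.nilp rtr g V"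
proof -
  interpret group_rep H scl rtr V B by (rule V(1))
  have eq: "(nab g ^^ n) (rs w) x = (dlt g ^^ n) w x" if "x \<in> carrier H" "g \<in> carrier H" for x g n w
    using that(1)
  proof (induction n arbitrary: x)
    case 0 then show ?case by (simp add: rs_def)
  next
    case (Suc n)
    have "nab g f x = f (x \<otimes> g) - f x" for f
      unfolding nab_def using Suc.prems by (simp add: rtr_def rs_def)
    then show ?case using Suc that(2) by simp
  qed
  then show "x \<in> carrier H \<Longrightarrow> g \<in> carrier H \<Longrightarrow> (nab g ^^ n) (rs w) x = (dlt g ^^ n) w x" .
  \<comment> \<open>Off the group every translate is 0 by normalization, so \<open>nab g\<close> is
    negation there and preserves the value 0.\<close>
  have off: "(nab g ^^ n) (rs w) x = 0" if "x \<notin> carrier H" for x g n w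
  proof (induction n)
    case 0 then show ?case using that by (simp add: rs_def)
  next
    case (Suc n)
    have "nab g f x = - f x" for f
      unfolding nab_def using that by (simp add: rtr_def rs_def)
    then show ?case using Suc by simp
  qed
  assume g: "unipotent_elt H g"
  show "nilp g V" unfolding nilp_def
  proof
    fix v assume v: "v \<in> V"
    then obtain n where n: "\<forall>x\<in>carrier H. (dlt g ^^ n) v x = 0"
      using g V(2) unfolding unipotent_elt_def by blast
    have "(nab g ^^ n) (rs v) x = 0" for x
      using eq[of x g n v] off[of x n g v] n g by (cases "x \<in> carrier H") (auto simp: unipotent_elt_def)
    then have "(nab g ^^ n) v = 0" using V(3) v by (auto simp: fun_eq_iff)
    then show "\<exists>n. (nab g ^^ n) v = 0" by blast
  qed
qed

lemma unipotent_uniform: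
  assumes "h \<in> R"
  shows "\<exists>m. \<forall>g. unipotent_elt H g \<longrightarrow> (\<forall>x\<in>carrier H. (dlt g ^^ m) h x = 0)"
proof -
  obtain V B where V: "group_rep H scl rtr V B" "V \<subseteq> R" "\<forall>v\<in>V. rs v = v" "rs h \<in> V"
    using translates_rep[OF assms] by blast
  interpret group_rep H scl rtr V B by (rule V(1))
  have "(dlt g ^^ card B) h x = 0" if "unipotent_elt H g" "x \<in> carrier H" for g x
  proof -
    have g: "g \<in> carrier H" using that by (simp add: unipotent_elt_def)
    have "(nab g ^^ card B) (rs h) = 0"
      by (rule nilp_uniform[OF g unipotent_nilp[OF V(1-3) that(1)] V(4)])
    then show ?thesis using dlt_eq[OF V(1-3) that(2) g, of "card B" h] by simp
  qed
  then show ?thesis by blast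
qed

lemma unipotent_mult:
  assumes N: "solvable_seq H N" "N \<lhd> H" "\<forall>g\<in>N. unipotent_elt H g"
    and g1: "unipotent_elt H g1" and g0: "g0 \<in> N"
  shows "unipotent_elt H (g1 \<otimes> g0)"
proof -
  have g1c: "g1 \<in> carrier H" "g0 \<in> carrier H" using g1 g0 N by (auto simp: unipotent_elt_def)
  have "\<exists>n. \<forall>x\<in>carrier H. (dlt (g1 \<otimes> g0) ^^ n) h x = 0" if h: "h \<in> R" for h
  proof -
    obtain V B where V: "group_rep H scl rtr V B" "V \<subseteq> R" "\<forall>v\<in>V. rs v = v" "rs h \<in> V"
      using translates_rep[OF h] by blast
    interpret group_rep H scl rtr V B by (rule V(1))
    have "nilp (g1 \<otimes> g0) V"
      using nilp_mult[OF N(1,2) _ g1c(1) unipotent_nilp[OF V(1-3) g1] g0] unipotent_nilp[OF V(1-3)] N(3)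
      by blast
    then obtain n where n: "(nab (g1 \<otimes> g0) ^^ n) (rs h) = 0" using V(4) by (auto simp: nilp_def)
    have "(dlt (g1 \<otimes> g0) ^^ n) h x = 0" if "x \<in> carrier H" for x
      using dlt_eq[OF V(1-3) that, of "g1 \<otimes> g0" n h] n g1c by simp
    then show ?thesis by blast
  qed
  then show ?thesis using g1c by (auto simp: unipotent_elt_def)
qed

section \<open>Zariski closures of subgroups and of products of subgroups\<close>

definition zcl :: "'a set \<Rightarrow> 'a set" where
  "zcl M = {x\<in>carrier H. \<forall>r\<in>R. (\<forall>m\<in>M. r m = 0) \<longrightarrow> r x = 0}"

lemma zcl_incl: "M \<subseteq> carrier H \<Longrightarrow> M \<subseteq> zcl M"
  by (auto simp: zcl_def)

lemma zcl_closed: "zclosed (var H) (zcl M)"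
  unfolding zclosed_def zcl_def var_def by (intro exI[of _ "{r\<in>R. \<forall>m\<in>M. r m = 0}"]) auto

lemma zcl_induct: "x \<in> zcl M \<Longrightarrow> r \<in> R \<Longrightarrow> (\<And>m. m \<in> M \<Longrightarrow> r m = 0) \<Longrightarrow> r x = 0"
  by (auto simp: zcl_def)

text \<open>Products take two steps: a function vanishing on \<open>M\<close>, translated by an
  element of \<open>M\<close>, still vanishes on \<open>M\<close>, hence at \<open>y\<close>; so its
  translate by \<open>y\<close> on the other side vanishes on \<open>M\<close>, hence at
  \<open>x\<close>.\<close>

lemma zcl_subgroup:
  assumes M: "subgroup M H" and inv_reg: "\<And>h. h \<in> R \<Longrightarrow> (\<lambda>x. h (inv x)) \<in> R"
  shows "subgroup (zcl M) H"
proof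
  have MC: "M \<subseteq> carrier H" using M subgroup.subset by blast
  show "zcl M \<subseteq> carrier H" by (auto simp: zcl_def)
  show "\<one> \<in> zcl M" using zcl_incl[OF MC] M subgroup.one_closed by blast
  fix x assume x: "x \<in> zcl M"
  then have xc: "x \<in> carrier H" by (simp add: zcl_def)
  have "r (inv x) = 0" if "r \<in> R" "\<forall>m\<in>M. r m = 0" for r
    by (rule zcl_induct[OF x inv_reg[OF that(1)]]) (use M that subgroup.m_inv_closed in fastforce)
  then show "inv x \<in> zcl M" using xc by (auto simp: zcl_def)
  fix y assume y: "y \<in> zcl M"
  then have yc: "y \<in> carrier H" by (simp add: zcl_def)
  have "r (x \<otimes> y) = 0" if r: "r \<in> R" "\<forall>m\<in>M. r m = 0" for r
  proof -
    have "r (m \<otimes> y) = 0" if m: "m \<in> M" for m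
      by (rule zcl_induct[OF y reg_left[OF r(1)]]) (use M m r MC subgroup.m_closed in fastforce)+
    then show ?thesis using zcl_induct[OF x reg_right[OF r(1) yc]] by simp
  qed
  then show "x \<otimes> y \<in> zcl M" using xc yc by (auto simp: zcl_def)
qed

lemma zcl_normal:
  assumes M: "M \<lhd> H" and inv_reg: "\<And>h. h \<in> R \<Longrightarrow> (\<lambda>x. h (inv x)) \<in> R"
  shows "zcl M \<lhd> H"
  unfolding normal_inv_iff
proof (intro conjI ballI)
  show "subgroup (zcl M) H" using zcl_subgroup[OF normal_imp_subgroup[OF M] inv_reg] .
  fix g x assume g: "g \<in> carrier H" and x: "x \<in> zcl M"
  have "r (g \<otimes> x \<otimes> inv g) = 0" if r: "r \<in> R" "\<forall>m\<in>M. r m = 0" for r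
  proof (rule zcl_induct[OF x])
    show "(\<lambda>x. r (g \<otimes> x \<otimes> inv g)) \<in> R"
      by (rule reg_left[OF reg_right[OF r(1)]]) (use g in auto)
    show "r (g \<otimes> m \<otimes> inv g) = 0" if "m \<in> M" for m
      using r normal.inv_op_closed2[OF M g that] by blast
  qed
  then show "g \<otimes> x \<otimes> inv g \<in> zcl M" using g x by (auto simp: zcl_def)
qed

lemma zclosed_subgrp:
  "zclosed (var (subgrp H N)) Z \<longleftrightarrow> (\<exists>E\<subseteq>R. Z = {x\<in>N. \<forall>g\<in>E. g x = 0})"
proof
  assume "zclosed (var (subgrp H N)) Z"
  then obtain E where E: "E \<subseteq> reg (subvar (var H) N)" "Z = {x\<in>N. \<forall>g\<in>E. g x = 0}"
    by (auto simp: zclosed_def var_def subgrp_def)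
  have "Z = {x\<in>N. \<forall>g\<in>{h\<in>R. \<forall>z\<in>Z. h z = 0}. g x = 0}"
  proof (intro equalityI subsetI)
    fix x assume x: "x \<in> {x\<in>N. \<forall>g\<in>{h\<in>R. \<forall>z\<in>Z. h z = 0}. g x = 0}"
    have "g x = 0" if g: "g \<in> E" for g
    proof -
      obtain h where h: "h \<in> R" "\<forall>x\<in>N. g x = h x" using g E by (auto simp: subvar_def var_def)
      then have "\<forall>z\<in>Z. h z = 0" using g E by auto
      then show ?thesis using h x by auto
    qed
    then show "x \<in> Z" using x E by auto
  qed (use E in auto)
  then show "\<exists>E\<subseteq>R. Z = {x\<in>N. \<forall>g\<in>E. g x = 0}" by (intro exI[of _ "{h\<in>R. \<forall>z\<in>Z. h z = 0}"] conjI) auto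
next
  assume "\<exists>E\<subseteq>R. Z = {x\<in>N. \<forall>g\<in>E. g x = 0}"
  then obtain E where "E \<subseteq> R" "Z = {x\<in>N. \<forall>g\<in>E. g x = 0}" by blast
  moreover from this have "E \<subseteq> reg (subvar (var H) N)" by (auto simp: var_def subvar_def)
  ultimately show "zclosed (var (subgrp H N)) Z"
    by (auto simp: zclosed_def var_def subgrp_def)
qed

text \<open>A separation of the closure into two disjoint closed sets cuts neither \<open>N1\<close>
  nor any coset \<open>u N0\<close> with \<open>u\<close> in \<open>N1\<close>. As each coset meets
  \<open>N1\<close> in \<open>u\<close>, all of \<open>N1 N0\<close> falls into one of the two sets,
  and so does its closure.\<close>

lemma zcl_mult_connected:
  assumes N1: "connected_variety (var (subgrp H N1))" "subgroup N1 H"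
    and N0: "connected_variety (var (subgrp H N0))" "subgroup N0 H"
  shows "connected_variety (var (subgrp H (zcl (N1 <#> N0))))"
proof -
  let ?C = "zcl (N1 <#> N0)"
  have c: "N1 \<subseteq> carrier H" "N0 \<subseteq> carrier H" using N1 N0 subgroup.subset by blast+
  have MC: "N1 <#> N0 \<subseteq> carrier H" using c by (rule set_mult_closed)
  have one: "\<one> \<in> N1" "\<one> \<in> N0" using N1 N0 subgroup.one_closed by blast+
  have mem: "u \<otimes> x \<in> ?C" if "u \<in> N1" "x \<in> N0" for u x
    using zcl_incl[OF MC] that by (auto simp: set_mult_def)
  have memN1: "u \<in> ?C" if "u \<in> N1" for u using mem[OF that one(2)] that c by auto
  have pts: "pts (var (subgrp H N)) = N" for N by (simp add: var_def subgrp_def)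
  have conn: "Z1 = {} \<or> Z2 = {}"
    if "connected_variety (var (subgrp H N))" "E1 \<subseteq> R" "E2 \<subseteq> R" "Z1 = {x\<in>N. \<forall>g\<in>E1. g x = 0}"
      "Z2 = {x\<in>N. \<forall>g\<in>E2. g x = 0}" "N \<subseteq> Z1 \<union> Z2" "Z1 \<inter> Z2 = {}" for N E1 E2 Z1 Z2
  proof -
    have "zclosed (var (subgrp H N)) Z1" "zclosed (var (subgrp H N)) Z2"
      unfolding zclosed_subgrp using that by blast+
    moreover have "N = Z1 \<union> Z2" using that by blast
    ultimately show ?thesis using that(1,7) unfolding connected_variety_def pts by blast
  qed
  have step: "Z2 = {}"
    if E: "E1 \<subseteq> R" "E2 \<subseteq> R" and Z: "Z1 = {x\<in>?C. \<forall>g\<in>E1. g x = 0}" "Z2 = {x\<in>?C. \<forall>g\<in>E2. g x = 0}"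
      and u: "?C = Z1 \<union> Z2" "Z1 \<inter> Z2 = {}" and N1Z: "N1 \<subseteq> Z1" for E1 E2 Z1 Z2
  proof -
    have "u \<otimes> x \<in> Z1" if ux: "u \<in> N1" "x \<in> N0" for u x
    proof -
      let ?T = "\<lambda>E. (\<lambda>g y. g (u \<otimes> y)) ` E"
      let ?Y1 = "{x\<in>N0. \<forall>g\<in>?T E1. g x = 0}" and ?Y2 = "{x\<in>N0. \<forall>g\<in>?T E2. g x = 0}"
      have y: "y \<in> ?Y1 \<longleftrightarrow> u \<otimes> y \<in> Z1" "y \<in> ?Y2 \<longleftrightarrow> u \<otimes> y \<in> Z2" if "y \<in> N0" for y
        using mem[OF ux(1) that] that Z by auto
      have "?Y1 = {} \<or> ?Y2 = {}"
      proof (rule conn[OF N0(1)])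
        have "?T E \<subseteq> R" if "E \<subseteq> R" for E
        proof
          fix f assume "f \<in> ?T E"
          then obtain g where g: "g \<in> E" "f = (\<lambda>y. g (u \<otimes> y))" by blast
          show "f \<in> R" unfolding g(2) by (rule reg_left) (use g that ux c in auto)
        qed
        then show "?T E1 \<subseteq> R" "?T E2 \<subseteq> R" using E by auto
        show "N0 \<subseteq> ?Y1 \<union> ?Y2"
        proof
          fix x assume x: "x \<in> N0"
          then have "u \<otimes> x \<in> Z1 \<union> Z2" using mem[OF ux(1)] u(1) by simp
          then show "x \<in> ?Y1 \<union> ?Y2" unfolding Un_iff y(1)[OF x] y(2)[OF x] .
        qed
        show "?Y1 \<inter> ?Y2 = {}"
        proof -
          have False if x: "x \<in> ?Y1" "x \<in> ?Y2" for x
          proof -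
            have "x \<in> N0" using x(1) by simp
            then have "u \<otimes> x \<in> Z1 \<inter> Z2" using y(1)[of x] y(2)[of x] x by blast
            then show False using u(2) by simp
          qed
          then show ?thesis by blast
        qed
      qed auto
      moreover have "u \<otimes> \<one> \<in> Z1" using subsetD[OF c(1) ux(1)] subsetD[OF N1Z ux(1)] by simp
      then have "\<one> \<in> ?Y1" unfolding y(1)[OF one(2)] .
      ultimately have "x \<notin> ?Y2" by blast
      then have "u \<otimes> x \<notin> Z2" unfolding y(2)[OF ux(2)] .
      then show ?thesis using mem[OF ux] unfolding u(1) by simp
    qed
    then have "g m = 0" if "g \<in> E1" "m \<in> N1 <#> N0" for g m
      using that Z by (auto simp: set_mult_def)
    then have "?C \<subseteq> Z1" using Z E zcl_induct by blast
    then show ?thesis using u by blast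
  qed
  show ?thesis unfolding connected_variety_def pts
  proof (intro conjI allI impI)
    show "?C \<noteq> {}" using memN1 one by blast
    fix Z1 Z2 assume z: "zclosed (var (subgrp H ?C)) Z1" "zclosed (var (subgrp H ?C)) Z2"
      and u: "?C = Z1 \<union> Z2" "Z1 \<inter> Z2 = {}"
    obtain E1 where E1: "E1 \<subseteq> R" "Z1 = {x\<in>?C. \<forall>g\<in>E1. g x = 0}" using z unfolding zclosed_subgrp by blast
    obtain E2 where E2: "E2 \<subseteq> R" "Z2 = {x\<in>?C. \<forall>g\<in>E2. g x = 0}" using z unfolding zclosed_subgrp by blast
    let ?Y1 = "{x\<in>N1. \<forall>g\<in>E1. g x = 0}" and ?Y2 = "{x\<in>N1. \<forall>g\<in>E2. g x = 0}"
    have y: "x \<in> ?Y1 \<longleftrightarrow> x \<in> Z1" "x \<in> ?Y2 \<longleftrightarrow> x \<in> Z2" if "x \<in> N1" for x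
      using memN1[OF that] that E1 E2 by auto
    have "?Y1 = {} \<or> ?Y2 = {}"
    proof (rule conn[OF N1(1) E1(1) E2(1)])
      have m: "x \<in> Z1 \<or> x \<in> Z2" if "x \<in> N1" for x using memN1[OF that] unfolding u(1) by simp
      show "N1 \<subseteq> ?Y1 \<union> ?Y2"
      proof
        fix x assume x: "x \<in> N1"
        show "x \<in> ?Y1 \<union> ?Y2" unfolding Un_iff y(1)[OF x] y(2)[OF x] by (rule m[OF x])
      qed
      have "x \<notin> ?Y2" if xY: "x \<in> ?Y1" for x
      proof -
        have x: "x \<in> N1" using xY by simp
        have "x \<in> Z1" using xY unfolding y(1)[OF x] .
        then show ?thesis using u(2) unfolding y(2)[OF x] by blast
      qed
      then show "?Y1 \<inter> ?Y2 = {}" by (simp add: disjoint_iff)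
    qed auto
    moreover have m: "x \<in> Z1 \<or> x \<in> Z2" if "x \<in> N1" for x using memN1[OF that] unfolding u(1) by simp
    moreover have "N1 \<subseteq> Z2" if "?Y1 = {}"
    proof
      fix x assume x: "x \<in> N1"
      have "x \<notin> ?Y1" unfolding that by simp
      then show "x \<in> Z2" using m[OF x] unfolding y(1)[OF x] by simp
    qed
    moreover have "N1 \<subseteq> Z1" if "?Y2 = {}"
    proof
      fix x assume x: "x \<in> N1"
      have "x \<notin> ?Y2" unfolding that by simp
      then show "x \<in> Z1" using m[OF x] unfolding y(2)[OF x] by simp
    qed
    ultimately have "N1 \<subseteq> Z1 \<or> N1 \<subseteq> Z2" by argo
    then show "Z1 = {} \<or> Z2 = {}"
      using step[OF E1(1) E2(1) E1(2) E2(2) u] step[OF E2(1) E1(1) E2(2) E1(2)] u by blast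
  qed
qed

theorem unipotent_radical_mult:
  assumes solv: "solvable H" and inv_reg: "\<And>h. h \<in> R \<Longrightarrow> (\<lambda>x. h (inv x)) \<in> R"
    and u: "u1 \<in> unipotent_radical H" "u0 \<in> unipotent_radical H"
  shows "u1 \<otimes> u0 \<in> unipotent_radical H"
proof -
  obtain N1 where N1: "closed_subgroup H N1" "connected_variety (var (subgrp H N1))" "N1 \<lhd> H"
    "\<forall>g\<in>N1. unipotent_elt H g" "u1 \<in> N1" using u(1) by (auto simp: unipotent_radical_def)
  obtain N0 where N0: "closed_subgroup H N0" "connected_variety (var (subgrp H N0))" "N0 \<lhd> H"
    "\<forall>g\<in>N0. unipotent_elt H g" "u0 \<in> N0" using u(2) by (auto simp: unipotent_radical_def)
  let ?M = "N1 <#> N0"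
  have s: "subgroup N1 H" "subgroup N0 H" using N1 N0 by (auto simp: closed_subgroup_def)
  have MC: "?M \<subseteq> carrier H" using s by (intro set_mult_closed) (auto dest: subgroup.subset)
  have sol: "solvable_seq H N0" using solvable_subgroup[OF s(2) solv] .
  have sM: "subgroup ?M H" using mult_norm_subgroup[OF N1(3) s(2)] .
  have nM: "?M \<lhd> H" unfolding normal_inv_iff
  proof (intro conjI sM ballI)
    fix g x assume g: "g \<in> carrier H" and "x \<in> ?M"
    then obtain a b where ab: "a \<in> N1" "b \<in> N0" "x = a \<otimes> b" by (auto simp: set_mult_def)
    have abc: "a \<in> carrier H" "b \<in> carrier H" using ab s subgroup.mem_carrier by fastforce+
    have "g \<otimes> x \<otimes> inv g = (g \<otimes> a \<otimes> inv g) \<otimes> (g \<otimes> b \<otimes> inv g)"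
      using g abc ab by (simp add: m_assoc inv_solve_left)
    moreover have "g \<otimes> a \<otimes> inv g \<in> N1" "g \<otimes> b \<otimes> inv g \<in> N0"
      by (rule normal.inv_op_closed2[OF N1(3) g ab(1)], rule normal.inv_op_closed2[OF N0(3) g ab(2)])
    ultimately show "g \<otimes> x \<otimes> inv g \<in> ?M" by (auto simp: set_mult_def)
  qed
  have uM: "unipotent_elt H g" if "g \<in> ?M" for g
    using that unipotent_mult[OF sol N0(3,4)] N1(4) by (auto simp: set_mult_def)
  \<comment> \<open>For one exponent \<open>m\<close> depending on \<open>h\<close> only, the
    \<open>m\<close>-th difference vanishes for all elements of \<open>N1 N0\<close>; being regular
    in the group element, it vanishes on the closure.\<close>
  have "unipotent_elt H x" if x: "x \<in> zcl ?M" for x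
  proof -
    have xc: "x \<in> carrier H" using x by (simp add: zcl_def)
    have "\<exists>n. \<forall>y\<in>carrier H. (dlt x ^^ n) h y = 0" if h: "h \<in> R" for h
    proof -
      obtain m where m: "\<And>g y. unipotent_elt H g \<Longrightarrow> y \<in> carrier H \<Longrightarrow> (dlt g ^^ m) h y = 0"
        using unipotent_uniform[OF h] by blast
      have "(dlt x ^^ m) h y = 0" if y: "y \<in> carrier H" for y
        by (rule zcl_induct[OF x dlt_reg[OF h, of "\<lambda>_. y"]]) (use y m uM reg_const in auto)
      then show ?thesis by blast
    qed
    then show ?thesis using xc by (auto simp: unipotent_elt_def)
  qed
  moreover have "closed_subgroup H (zcl ?M)"
    using zcl_subgroup[OF sM inv_reg] zcl_closed by (simp add: closed_subgroup_def)
  moreover have "u1 \<otimes> u0 \<in> zcl ?M" using zcl_incl[OF MC] N1(5) N0(5) by (auto simp: set_mult_def)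
  ultimately show ?thesis unfolding unipotent_radical_def
    using zcl_normal[OF nM inv_reg] zcl_mult_connected[OF N1(2) s(1) N0(2) s(2)] by blast
qed

end

section \<open>Coordinate rings over the rationals and their base change to the complex
  numbers\<close>

lemma algebraic_group_split:
  assumes G: "algebraic_group G" and h: "h \<in> regfun G"
  shows "splits (regfun G) (carrier G) (\<lambda>(x, y). h (x \<otimes>\<^bsub>G\<^esub> y))"
proof -
  let ?S = "carrier G" and ?R = "regfun G"
  obtain F where "?R = funs_on \<rat> ?S F"
    using G by (auto simp: algebraic_group_def affine_variety_def var_def)
  then have R: "fun_alg \<rat> ?S ?R" by (simp add: fun_alg_funs_on)
  have "h \<circ> (\<lambda>(x, y). x \<otimes>\<^bsub>G\<^esub> y) \<in> reg (prod_var (var G) (var G))"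
    using G h by (auto simp: algebraic_group_def morphism_def var_def)
  then have "h \<circ> (\<lambda>(x, y). x \<otimes>\<^bsub>G\<^esub> y) \<in> funs_on \<rat> (?S \<times> ?S) ({g \<circ> fst | g. g \<in> ?R} \<union> {g \<circ> snd | g. g \<in> ?R})"
    by (simp add: prod_var_def var_def)
  then have "\<exists>h'. splits ?R ?S h' \<and> (\<forall>z\<in>?S \<times> ?S. (h \<circ> (\<lambda>(x, y). x \<otimes>\<^bsub>G\<^esub> y)) z = h' z)"
  proof (rule funs_on_induct)
    have one: "(\<lambda>_. 1) \<in> ?R" by (rule fun_alg_const[OF R]) simp
    show "splits ?R ?S (\<lambda>_. c)" if "c \<in> \<rat>" for c
      using splits_prod[OF R _ fun_alg_const[OF R that] one] by (simp add: case_prod_unfold)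
    show "splits ?R ?S f" if "f \<in> {g \<circ> fst | g. g \<in> ?R} \<union> {g \<circ> snd | g. g \<in> ?R}" for f
      using that splits_prod[OF R _ _ one] splits_prod[OF R _ one] by (auto simp: o_def case_prod_unfold)
  qed (auto intro: splits_add splits_mult[OF R])
  then show ?thesis by (auto simp: splits_def)
qed

text \<open>A function of \<open>subgrp G S\<close> extends to one of \<open>G\<close>, whose
  comultiplication restricts to \<open>S\<close>; the extension of scalars is absorbed by the
  closure of \<open>splits\<close> under sums and products.\<close>

lemma complex_alg_group_geo:
  assumes G: "algebraic_group G" and S: "subgroup S G"
  shows "complex_alg_group (geo (subgrp G S))"
    and geo_inv_reg: "h \<in> regfun (geo (subgrp G S)) \<Longrightarrow>
      (\<lambda>x. h (inv\<^bsub>geo (subgrp G S)\<^esub> x)) \<in> regfun (geo (subgrp G S))"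
proof -
  let ?H = "geo (subgrp G S)"
  have gG: "Group.group G" using G by (simp add: algebraic_group_def)
  have mult: "x \<otimes>\<^bsub>?H\<^esub> y = x \<otimes>\<^bsub>G\<^esub> y" "\<one>\<^bsub>?H\<^esub> = \<one>\<^bsub>G\<^esub>" "carrier ?H = S" for x y
    by (simp_all add: geo_def subgrp_def)
  have SC: "S \<subseteq> carrier G" using S subgroup.subset by blast
  interpret G: Group.group G by (rule gG)
  interpret H: Group.group ?H
  proof (rule groupI)
    show "\<exists>y\<in>carrier ?H. y \<otimes>\<^bsub>?H\<^esub> x = \<one>\<^bsub>?H\<^esub>" if "x \<in> carrier ?H" for x
      using that S SC unfolding mult by (intro bexI[of _ "inv\<^bsub>G\<^esub> x"]) (auto intro: subgroup.m_inv_closed)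
  qed (use S SC in \<open>auto simp: mult subgroup.m_closed subgroup.one_closed G.m_assoc subset_iff\<close>)
  let ?R0 = "reg (subvar (var G) S)"
  have R: "regfun ?H = funs_on UNIV S ?R0" by (simp add: geo_def subgrp_def)
  have alg: "fun_alg UNIV S (regfun ?H)" unfolding R by (rule fun_alg_funs_on)
  have R0R: "a \<in> regfun ?H" if "a \<in> regfun G" for a
    unfolding R using that by (intro gen_in_funs_on reg_subvarI) (simp add: var_def)
  have spl: "splits (regfun ?H) S (\<lambda>(x, y). h (x \<otimes>\<^bsub>G\<^esub> y))" if "h \<in> regfun ?H" for h
  proof -
    have one: "(\<lambda>_. 1) \<in> regfun ?H" by (rule fun_alg_const[OF alg]) simp
    have "\<exists>h'. splits (regfun ?H) S (\<lambda>(x, y). h' (x \<otimes>\<^bsub>G\<^esub> y)) \<and> (\<forall>z\<in>S. h z = h' z)"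
      using that unfolding R
    proof (rule funs_on_induct, fold R)
      show "splits (regfun ?H) S (\<lambda>(x, y). (\<lambda>_. c) (x \<otimes>\<^bsub>G\<^esub> y))" for c
        using splits_prod[OF alg _ fun_alg_const[OF alg, of c] one] by simp
      show "splits (regfun ?H) S (\<lambda>(x, y). f (x \<otimes>\<^bsub>G\<^esub> y))" if "f \<in> ?R0" for f
      proof -
        from that have "\<exists>f'\<in>regfun G. \<forall>x\<in>S. f x = f' x" by (simp add: subvar_def var_def)
        then obtain f' where f': "f' \<in> regfun G" "\<forall>x\<in>S. f x = f' x" by blast
        obtain xs where xs: "set xs \<subseteq> regfun G \<times> regfun G"
          "\<forall>x\<in>carrier G. \<forall>y\<in>carrier G. f' (x \<otimes>\<^bsub>G\<^esub> y) = (\<Sum>p\<leftarrow>xs. fst p x * snd p y)"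
          using algebraic_group_split[OF G f'(1)] by (auto simp: splits_def)
        show ?thesis unfolding splits_def
        proof (intro exI[of _ xs] conjI ballI)
          show "set xs \<subseteq> regfun ?H \<times> regfun ?H" using xs(1) R0R by (auto simp: subset_iff)
          fix x y assume xy: "x \<in> S" "y \<in> S"
          then have "x \<otimes>\<^bsub>G\<^esub> y \<in> S" using S subgroup.m_closed by fast
          then show "(case (x, y) of (x, y) \<Rightarrow> f (x \<otimes>\<^bsub>G\<^esub> y)) = (\<Sum>p\<leftarrow>xs. fst p x * snd p y)"
            using xy xs(2) f'(2) SC by (simp add: subset_iff)
        qed
      qed
    next
      fix f g assume fg: "splits (regfun ?H) S (\<lambda>(x, y). f (x \<otimes>\<^bsub>G\<^esub> y))" "splits (regfun ?H) S (\<lambda>(x, y). g (x \<otimes>\<^bsub>G\<^esub> y))"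
      show "splits (regfun ?H) S (\<lambda>(x, y). (\<lambda>z. f z + g z) (x \<otimes>\<^bsub>G\<^esub> y))"
        using splits_add[OF fg] by (simp add: case_prod_unfold)
      show "splits (regfun ?H) S (\<lambda>(x, y). (\<lambda>z. f z * g z) (x \<otimes>\<^bsub>G\<^esub> y))"
        using splits_mult[OF alg fg] by (simp add: case_prod_unfold)
    qed
    then obtain h' where h': "splits (regfun ?H) S (\<lambda>(x, y). h' (x \<otimes>\<^bsub>G\<^esub> y))" "\<forall>z\<in>S. h z = h' z" by blast
    have "h (x \<otimes>\<^bsub>G\<^esub> y) = h' (x \<otimes>\<^bsub>G\<^esub> y)" if "x \<in> S" "y \<in> S" for x y
      using h'(2) subgroup.m_closed[OF S that] by blast
    then show ?thesis using h'(1) by (simp add: splits_def)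
  qed
  show "complex_alg_group ?H"
    by unfold_locales (use alg spl in \<open>simp_all add: mult\<close>)
  have inv_eq: "inv\<^bsub>?H\<^esub> x = inv\<^bsub>G\<^esub> x" if "x \<in> S" for x
  proof (rule H.inv_equality)
    show "inv\<^bsub>G\<^esub> x \<otimes>\<^bsub>?H\<^esub> x = \<one>\<^bsub>?H\<^esub>" "x \<in> carrier ?H" "inv\<^bsub>G\<^esub> x \<in> carrier ?H"
      using that S SC by (auto simp: mult intro: subgroup.m_inv_closed)
  qed
  assume h: "h \<in> regfun ?H"
  show "(\<lambda>x. h (inv\<^bsub>?H\<^esub> x)) \<in> regfun ?H"
  proof (rule funs_on_comp[OF alg, where S' = S and F = ?R0])
    show "inv\<^bsub>?H\<^esub> x \<in> S" if "x \<in> S" for x using H.inv_closed[of x] that by (simp add: mult)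
    show "h \<in> funs_on UNIV S ?R0" using h R by simp
    fix f assume "f \<in> ?R0"
    then have "\<exists>f'\<in>regfun G. \<forall>x\<in>S. f x = f' x" by (simp add: subvar_def var_def)
    then obtain f' where f': "f' \<in> regfun G" "\<forall>x\<in>S. f x = f' x" by blast
    have "f' \<circ> (\<lambda>x. inv\<^bsub>G\<^esub> x) \<in> regfun G"
      using G f' by (auto simp: algebraic_group_def morphism_def var_def)
    then have r: "(\<lambda>x. f' (inv\<^bsub>G\<^esub> x)) \<in> regfun G" by (simp add: o_def)
    have "f (inv\<^bsub>?H\<^esub> x) = f' (inv\<^bsub>G\<^esub> x)" if "x \<in> S" for x
      using f'(2) inv_eq[OF that] subgroup.m_inv_closed[OF S that] by simp
    then show "(\<lambda>x. f (inv\<^bsub>?H\<^esub> x)) \<in> regfun ?H" by (rule fun_alg_cong[OF alg R0R[OF r]])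
  qed
qed

lemma uni_mult:
  assumes D: "pinned_split_reductive D" and u: "u \<in> uni D" "u' \<in> uni D"
  shows "u \<otimes>\<^bsub>grp D\<^esub> u' \<in> uni D"
proof -
  let ?G = "grp D" and ?H = "geo (subgrp (grp D) (bor D))"
  have G: "algebraic_group ?G" and S: "subgroup (bor D) ?G"
    using D by (auto simp: pinned_split_reductive_def reductive_group_def borel_subgroup_def closed_subgroup_def)
  interpret H: complex_alg_group ?H by (rule complex_alg_group_geo[OF G S])
  \<comment> \<open>Solvability of the Borel subgroup is stated for base change followed by
    restriction, the unipotent radical is formed after restriction followed by base change. The two
    groups differ at most in their coordinate rings, so the identity carries solvability
    over.\<close>
  let ?K = "subgrp (geo ?G) (bor D)"
  have "solvable ?K"
    using D by (auto simp: pinned_split_reductive_def borel_subgroup_def connected_solvable_def)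
  moreover have gK: "Group.group ?K"
    using H.is_group unfolding Group.group_def group_axioms_def monoid_def Units_def
    by (simp add: subgrp_def geo_def)
  have "group_hom ?H ?K (\<lambda>x. x)"
    unfolding group_hom_def group_hom_axioms_def
    using H.is_group gK by (auto simp: hom_def subgrp_def geo_def)
  ultimately have "solvable ?H" using group_hom.inj_hom_imp_solvable[of ?H ?K "\<lambda>x. x"] by (simp add: inj_on_def)
  then have "u \<otimes>\<^bsub>?H\<^esub> u' \<in> unipotent_radical ?H"
    using H.unipotent_radical_mult geo_inv_reg[OF G S] u unfolding uni_def by blast
  then show ?thesis by (simp add: uni_def geo_def subgrp_def)
qed

lemma uni_basic:
  assumes D: "pinned_split_reductive D" and u: "u \<in> uni D"
  shows uni_bor: "u \<in> bor D"
    and uni_conj: "t \<in> tor D \<Longrightarrow> t \<otimes>\<^bsub>grp D\<^esub> u \<otimes>\<^bsub>grp D\<^esub> inv\<^bsub>grp D\<^esub> t \<in> uni D"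
proof -
  let ?G = "grp D" and ?H = "geo (subgrp (grp D) (bor D))"
  have G: "algebraic_group ?G" and S: "subgroup (bor D) ?G"
    using D by (auto simp: pinned_split_reductive_def reductive_group_def borel_subgroup_def closed_subgroup_def)
  interpret G: Group.group ?G using G by (simp add: algebraic_group_def)
  interpret H: complex_alg_group ?H by (rule complex_alg_group_geo[OF G S])
  have mult: "x \<otimes>\<^bsub>?H\<^esub> y = x \<otimes>\<^bsub>?G\<^esub> y" "\<one>\<^bsub>?H\<^esub> = \<one>\<^bsub>?G\<^esub>" "carrier ?H = bor D" for x y
    by (simp_all add: geo_def subgrp_def)
  obtain N where N: "closed_subgroup ?H N" "connected_variety (var (subgrp ?H N))" "N \<lhd> ?H"
    "\<forall>g\<in>N. unipotent_elt ?H g" "u \<in> N" using u by (auto simp: uni_def unipotent_radical_def)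
  show "u \<in> bor D" using N(4,5) by (auto simp: unipotent_elt_def mult)
  assume "t \<in> tor D"
  then have t: "t \<in> bor D" using D by (auto simp: pinned_split_reductive_def)
  have inv: "inv\<^bsub>?H\<^esub> t = inv\<^bsub>?G\<^esub> t"
  proof (rule H.inv_equality)
    show "inv\<^bsub>?G\<^esub> t \<otimes>\<^bsub>?H\<^esub> t = \<one>\<^bsub>?H\<^esub>" "t \<in> carrier ?H" "inv\<^bsub>?G\<^esub> t \<in> carrier ?H"
      using t S subgroup.mem_carrier[OF S t] by (auto simp: mult intro: subgroup.m_inv_closed)
  qed
  have "t \<otimes>\<^bsub>?H\<^esub> u \<otimes>\<^bsub>?H\<^esub> inv\<^bsub>?H\<^esub> t \<in> N"
    using normal.inv_op_closed2[OF N(3), of t u] t N(5) by (simp add: mult)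
  then show "t \<otimes>\<^bsub>?G\<^esub> u \<otimes>\<^bsub>?G\<^esub> inv\<^bsub>?G\<^esub> t \<in> uni D"
    using N unfolding uni_def unipotent_radical_def inv by (auto simp: mult)
qed

section \<open>Laurent polynomials\<close>

abbreviation lookup where "lookup \<equiv> Poly_Mapping.lookup"
abbreviation keys where "keys \<equiv> Poly_Mapping.keys"
abbreviation single where "single \<equiv> Poly_Mapping.single"

lemma pm_induct [case_names zero add]:
  assumes "P 0" "\<And>m a p. P p \<Longrightarrow> P (single m a + p)"
  shows "P (p :: 'a \<Rightarrow>\<^sub>0 'b::comm_monoid_add)"
proof (induction p rule: Poly_Mapping.update_induct)
  case const then show ?case by (rule assms)
next
  case (update f a b)
  have "Poly_Mapping.update a b f = single a b + f"
    using update(1) by (intro poly_mapping_eqI)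
      (auto simp: Poly_Mapping.lookup_update lookup_add lookup_single when_def in_keys_iff)
  then show ?case using assms(2) update by simp
qed

lemma monomial_superset:
  "finite A \<Longrightarrow> keys m \<subseteq> A \<Longrightarrow> monomial m z = (\<Prod>i\<in>A. z i powi lookup m i)"
  unfolding monomial_def by (rule prod.mono_neutral_left) (auto simp: in_keys_iff)

lemma epair_superset:
  "finite A \<Longrightarrow> keys m \<subseteq> A \<Longrightarrow> epair m l = (\<Sum>i\<in>A. lookup m i * l i)"
  unfolding epair_def by (rule sum.mono_neutral_left) (auto simp: in_keys_iff)

lemma monomial_0 [simp]: "monomial 0 z = 1"
  by (simp add: monomial_def)

lemma monomial_single: "monomial (single i k) z = z i powi k"
  by (subst monomial_superset[of "{i}"]) auto

lemma epair_single: "epair (single i 1) l = l i"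
  by (subst epair_superset[of "{i}"]) auto

lemma monomial_add:
  assumes "\<And>i. z i \<noteq> 0" shows "monomial (m + m') z = monomial m z * monomial m' z"
proof -
  let ?A = "keys m \<union> keys m'"
  have "keys (m + m') \<subseteq> ?A" by (rule Poly_Mapping.keys_add)
  then show ?thesis
    using assms by (simp add: monomial_superset[of ?A] lookup_add power_int_add prod.distrib)
qed

lemma monomial_mult: "monomial m (\<lambda>i. x i * y i) = monomial m x * monomial m y"
  by (simp add: monomial_def power_int_mult_distrib prod.distrib)

lemma leval_superset:
  "finite A \<Longrightarrow> keys p \<subseteq> A \<Longrightarrow> leval p z = (\<Sum>m\<in>A. of_rat (lookup p m) * monomial m z)"
  unfolding leval_def by (rule sum.mono_neutral_left) (auto simp: in_keys_iff)

lemma leval_0 [simp]: "leval 0 z = 0"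
  by (simp add: leval_def)

lemma leval_single: "leval (single m a) z = of_rat a * monomial m z"
  by (subst leval_superset[of "{m}"]) auto

lemma leval_add: "leval (p + q) z = leval p z + leval q z"
proof -
  let ?A = "keys p \<union> keys q"
  have "keys (p + q) \<subseteq> ?A" by (rule Poly_Mapping.keys_add)
  then show ?thesis
    by (simp add: leval_superset[of ?A] lookup_add of_rat_add algebra_simps sum.distrib)
qed

lemma leval_sum: "leval (\<Sum>j\<in>J. f j) z = (\<Sum>j\<in>J. leval (f j) z)"
  by (induction J rule: infinite_finite_induct) (auto simp: leval_add)

lemma leval_mult:
  assumes "\<And>i. z i \<noteq> 0" shows "leval (p * q) z = leval p z * leval q z"
proof (induction p rule: pm_induct)
  case (add m a p)
  have "leval (single m a * q) z = leval (single m a) z * leval q z"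
    by (induction q rule: pm_induct)
       (simp_all add: distrib_left leval_add mult_single leval_single monomial_add[OF assms] of_rat_mult algebra_simps)
  then show ?case using add by (simp add: leval_add algebra_simps)
qed simp

lemma laurents_closed:
  "0 \<in> laurents n" "m \<in> expo n \<Longrightarrow> single m a \<in> laurents n"
  "p \<in> laurents n \<Longrightarrow> q \<in> laurents n \<Longrightarrow> p + q \<in> laurents n"
  "p \<in> laurents n \<Longrightarrow> q \<in> laurents n \<Longrightarrow> p * q \<in> laurents n"
proof -
  show "p + q \<in> laurents n" if "p \<in> laurents n" "q \<in> laurents n"
    using that Poly_Mapping.keys_add[of p q] by (auto simp: laurents_def)
  have add: "m + m' \<in> expo n" if "m \<in> expo n" "m' \<in> expo n" for m m'
    using that Poly_Mapping.keys_add[of m m'] by (auto simp: expo_def)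
  show "p * q \<in> laurents n" if "p \<in> laurents n" "q \<in> laurents n"
    using that keys_mult[of p q] add by (fastforce simp: laurents_def)
qed (auto simp: laurents_def)

lemma expo_closed: "0 \<in> expo n" "i < n \<Longrightarrow> single i k \<in> expo n"
  by (auto simp: expo_def)

lemma one_laurents: "1 \<in> laurents n" and leval_1 [simp]: "leval 1 z = 1"
  using laurents_closed(2)[OF expo_closed(1), of 1 n] leval_single[of 0 1 z] by simp_all

lemma laurents_sum: "(\<And>j. j \<in> J \<Longrightarrow> f j \<in> laurents n) \<Longrightarrow> (\<Sum>j\<in>J. f j) \<in> laurents n"
  by (induction J rule: infinite_finite_induct) (auto simp: laurents_closed)

lemma Tpts_nz: "z \<in> Tpts n \<Longrightarrow> z i \<noteq> 0"
  unfolding Tpts_def by (cases "i < n") auto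

lemma Tpts_mult: "x \<in> Tpts n \<Longrightarrow> y \<in> Tpts n \<Longrightarrow> (\<lambda>i. x i * y i) \<in> Tpts n"
  by (auto simp: Tpts_def)

lemma torus_simps: "pts (var (torus n)) = Tpts n" "reg (var (torus n)) = regfun (torus n)"
  "carrier (torus n) = Tpts n"
  by (simp_all add: var_def torus_def)

lemma fun_alg_torus: "fun_alg \<rat> (Tpts n) (regfun (torus n))"
  by (simp add: torus_def fun_alg_funs_on)

lemma fun_alg_prod:
  assumes "fun_alg k S R" "1 \<in> k" "\<And>j. j \<in> J \<Longrightarrow> f j \<in> R" shows "(\<lambda>x. \<Prod>j\<in>J. f j x) \<in> R"
  using assms(3)
  by (induction J rule: infinite_finite_induct)
     (auto intro: fun_alg_const[OF assms(1,2)] fun_alg_mult[OF assms(1)])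

abbreviation torus_gens :: "nat \<Rightarrow> ((nat \<Rightarrow> complex) \<Rightarrow> complex) set" where
  "torus_gens n \<equiv> {\<lambda>z. z i | i. i < n} \<union> {\<lambda>z. inverse (z i) | i. i < n}"

lemma regfun_torus: "regfun (torus n) = funs_on \<rat> (Tpts n) (torus_gens n)"
  by (simp add: torus_def)

lemma coord_reg:
  "i < n \<Longrightarrow> (\<lambda>z. z i) \<in> regfun (torus n)" "i < n \<Longrightarrow> (\<lambda>z. inverse (z i)) \<in> regfun (torus n)"
  unfolding regfun_torus by (auto intro!: gen_in_funs_on)

lemma leval_reg:
  assumes "p \<in> laurents n" shows "leval p \<in> regfun (torus n)"
proof -
  have "(\<lambda>z. z i powi k) \<in> regfun (torus n)" if "i < n" for i k
  proof (cases "k \<ge> 0")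
    case True
    have "(\<lambda>z. z i) \<in> regfun (torus n)" using that by (rule coord_reg)
    then show ?thesis using True fun_alg_power[OF fun_alg_torus, of "\<lambda>z. z i" n "nat k"] by (simp add: power_int_def)
  next
    case False
    have "(\<lambda>z. inverse (z i)) \<in> regfun (torus n)" using that by (rule coord_reg)
    then show ?thesis using False fun_alg_power[OF fun_alg_torus, of "\<lambda>z. inverse (z i)" n "nat (-k)"]
      by (simp add: power_int_def)
  qed
  then have "monomial m \<in> regfun (torus n)" if "m \<in> expo n" for m
    unfolding monomial_def using that by (intro fun_alg_prod[OF fun_alg_torus]) (auto simp: expo_def)
  then have "(\<lambda>z. \<Sum>m\<in>keys p. of_rat (lookup p m) * monomial m z) \<in> regfun (torus n)"
    using assms by (intro fun_alg_sum[OF fun_alg_torus] fun_alg_cmult[OF fun_alg_torus]) (auto simp: laurents_def)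
  then show ?thesis by (simp add: leval_def[abs_def])
qed

lemma reg_torus_leval:
  assumes "r \<in> regfun (torus n)" shows "\<exists>p\<in>laurents n. \<forall>z\<in>Tpts n. r z = leval p z"
proof -
  have "r \<in> funs_on \<rat> (Tpts n) ({\<lambda>z. z i | i. i < n} \<union> {\<lambda>z. inverse (z i) | i. i < n})"
    using assms by (simp add: torus_def)
  then have "\<exists>h. (\<exists>p\<in>laurents n. \<forall>z\<in>Tpts n. h z = leval p z) \<and> (\<forall>z\<in>Tpts n. r z = h z)"
  proof (rule funs_on_induct)
    fix c :: complex assume "c \<in> \<rat>"
    then obtain q where "c = of_rat q" by (auto elim: Rats_cases)
    then show "\<exists>p\<in>laurents n. \<forall>z\<in>Tpts n. c = leval p z"
      by (intro bexI[of _ "single 0 q"]) (auto simp: leval_single laurents_closed expo_closed)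
  next
    fix f :: "(nat \<Rightarrow> complex) \<Rightarrow> complex"
    assume "f \<in> {\<lambda>z. z i | i. i < n} \<union> {\<lambda>z. inverse (z i) | i. i < n}"
    then obtain i k where i: "i < n" and "f = (\<lambda>z. z i powi k)"
      by (auto intro: that[of _ 1] that[of _ "-1"] simp: power_int_minus)
    then show "\<exists>p\<in>laurents n. \<forall>z\<in>Tpts n. f z = leval p z"
      by (intro bexI[of _ "single (single i k) 1"]) (auto simp: leval_single monomial_single laurents_closed expo_closed)
  next
    fix f g
    assume "\<exists>p\<in>laurents n. \<forall>z\<in>Tpts n. f z = leval p z" "\<exists>p\<in>laurents n. \<forall>z\<in>Tpts n. g z = leval p z"
    then obtain p q where pq: "p \<in> laurents n" "\<forall>z\<in>Tpts n. f z = leval p z" "q \<in> laurents n" "\<forall>z\<in>Tpts n. g z = leval q z"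
      by blast
    show "\<exists>p\<in>laurents n. \<forall>z\<in>Tpts n. f z + g z = leval p z"
      by (intro bexI[of _ "p + q"]) (use pq in \<open>auto simp: leval_add laurents_closed\<close>)
    show "\<exists>p\<in>laurents n. \<forall>z\<in>Tpts n. f z * g z = leval p z"
      by (intro bexI[of _ "p * q"]) (use pq in \<open>auto simp: leval_mult Tpts_nz laurents_closed\<close>)
  qed
  then show ?thesis by fastforce
qed

text \<open>Dedekind's linear independence of characters, for the monomials.\<close>

lemma power_int_two_inj: "(2::complex) powi a = 2 powi b \<Longrightarrow> a = b"
proof (rule ccontr)
  assume e: "(2::complex) powi a = 2 powi b" and "a \<noteq> b"
  have "norm ((2::complex) powi a) = norm ((2::complex) powi b)" using e by simp
  then have "(2::real) powi a = 2 powi b" by (simp add: norm_power_int)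
  then show False using \<open>a \<noteq> b\<close> power_int_strict_increasing[of a b "2::real"] power_int_strict_increasing[of b a "2::real"]
    by (cases a b rule: linorder_cases) auto
qed

lemma monomials_separate:
  assumes "m \<in> expo n" "m' \<in> expo n" "m \<noteq> m'"
  shows "\<exists>y\<in>Tpts n. monomial m y \<noteq> monomial m' y"
proof -
  obtain i where i: "lookup m i \<noteq> lookup m' i" using assms(3) by (metis poly_mapping_eqI)
  then have "i \<in> keys m \<or> i \<in> keys m'" by (auto simp: in_keys_iff)
  then have n: "i < n" using assms by (auto simp: expo_def)
  let ?y = "\<lambda>j. if j = i then 2 else (1::complex)"
  have "monomial k ?y = 2 powi lookup k i" for k
    by (subst monomial_superset[of "insert i (keys k)"])
       (auto simp: prod.insert_remove intro!: prod.neutral)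
  then have "monomial m ?y \<noteq> monomial m' ?y" using i power_int_two_inj by fastforce
  moreover have "?y \<in> Tpts n" using n by (auto simp: Tpts_def)
  ultimately show ?thesis by blast
qed

lemma monomials_independent:
  assumes "finite S" "S \<subseteq> expo n" "\<And>z. z \<in> Tpts n \<Longrightarrow> (\<Sum>m\<in>S. a m * monomial m z) = 0"
  shows "\<forall>m\<in>S. a m = (0::complex)"
  using assms
proof (induction S arbitrary: a rule: finite_induct)
  case (insert m1 S)
  \<comment> \<open>Subtracting \<open>monomial m1 y\<close> times the relation at \<open>z\<close>
    from the relation at \<open>y z\<close> cancels the term of \<open>m1\<close> and leaves a
    relation over \<open>S\<close>.\<close>
  have zero: "a m * (monomial m y - monomial m1 y) = 0" if y: "y \<in> Tpts n" and m: "m \<in> S" for m y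
  proof -
    have "(\<Sum>m\<in>S. (a m * (monomial m y - monomial m1 y)) * monomial m z) = 0" if z: "z \<in> Tpts n" for z
    proof -
      have "(\<Sum>m\<in>insert m1 S. a m * monomial m (\<lambda>i. y i * z i)) = 0"
        using insert.prems(2)[OF Tpts_mult[OF y z]] .
      moreover have "monomial m1 y * (\<Sum>m\<in>insert m1 S. a m * monomial m z) = 0"
        using insert.prems(2)[OF z] by simp
      ultimately show ?thesis using insert.hyps
        by (simp add: monomial_mult algebra_simps sum_distrib_left sum_subtractf) (metis add_left_imp_eq)
    qed
    then show ?thesis using insert.IH[of "\<lambda>m. a m * (monomial m y - monomial m1 y)"] insert.prems(1) m by blast
  qed
  have aS: "a m = 0" if "m \<in> S" for m
  proof -
    have "m \<noteq> m1" using that insert.hyps by blast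
    moreover have "m \<in> expo n" "m1 \<in> expo n" using insert.prems(1) that by auto
    ultimately obtain y where y: "y \<in> Tpts n" "monomial m y \<noteq> monomial m1 y"
      using monomials_separate[of m n m1] by metis
    then show ?thesis using zero[OF y(1) that] by simp
  qed
  have one: "(\<lambda>_. 1) \<in> Tpts n" by (simp add: Tpts_def)
  have "monomial m (\<lambda>_. 1) = 1" for m by (simp add: monomial_def)
  then have "a m1 = 0" using insert.prems(2)[OF one] insert.hyps aS by simp
  then show ?case using aS by blast
qed simp

lemma leval_zero_imp:
  assumes "p \<in> laurents n" "\<And>z. z \<in> Tpts n \<Longrightarrow> leval p z = 0" shows "p = 0"
proof -
  have "\<forall>m\<in>keys p. of_rat (lookup p m) = (0::complex)"
    using assms by (intro monomials_independent[of _ n]) (auto simp: laurents_def leval_def)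
  then show ?thesis by (intro poly_mapping_eqI) (auto simp: in_keys_iff)
qed

section \<open>Generic points\<close>

text \<open>Generic points in the sense of Weil: the coordinate ring lives over the rationals while
  the points are complex, which leaves room for such points to exist.\<close>

definition gpt :: "'a variety \<Rightarrow> 'a set" where
  "gpt V = {x\<in>pts V. \<forall>r\<in>reg V. r x = 0 \<longrightarrow> (\<forall>y\<in>pts V. r y = 0)}"

abbreviation "GP n \<equiv> gpt (var (torus n))"

lemma gptD: "x \<in> gpt V \<Longrightarrow> r \<in> reg V \<Longrightarrow> r x = 0 \<Longrightarrow> y \<in> pts V \<Longrightarrow> r y = 0"
  by (auto simp: gpt_def)

lemma GP_Tpts: "z \<in> GP n \<Longrightarrow> z \<in> Tpts n"
  by (simp add: gpt_def torus_simps)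

lemma GP_leval: "z \<in> GP n \<Longrightarrow> p \<in> laurents n \<Longrightarrow> leval p z = 0 \<Longrightarrow> p = 0"
  using leval_reg[of p n] by (intro leval_zero_imp[of p n]) (auto simp: gpt_def torus_simps)

lemma GP_I:
  assumes "z \<in> Tpts n" "\<And>p. p \<in> laurents n \<Longrightarrow> leval p z = 0 \<Longrightarrow> p = 0" shows "z \<in> GP n"
  unfolding gpt_def torus_simps using assms reg_torus_leval leval_0 by fastforce

text \<open>Laurent polynomials in a nonzero parameter \<open>c\<close> with coefficients in the
  coordinate ring of \<open>V\<close>; the power of \<open>c\<close> clears the denominator. They
  allow a regular function on the product of the multiplicative group with \<open>V\<close> to be
  treated coefficient by coefficient.\<close>

definition laurent_over :: "'a variety \<Rightarrow> (complex \<times> 'a \<Rightarrow> complex) \<Rightarrow> bool" where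
  "laurent_over V g \<longleftrightarrow> (\<exists>N P. (\<forall>j. (\<lambda>x. poly.coeff (P x) j) \<in> reg V) \<and>
     (\<forall>c x. c \<noteq> 0 \<longrightarrow> x \<in> pts V \<longrightarrow> c ^ N * g (c, x) = poly (P x) c))"

lemma laurent_overI:
  assumes "\<And>j. (\<lambda>x. poly.coeff (P x) j) \<in> reg V"
    "\<And>c x. c \<noteq> 0 \<Longrightarrow> x \<in> pts V \<Longrightarrow> c ^ N * g (c, x) = poly (P x) c"
  shows "laurent_over V g"
  using assms unfolding laurent_over_def by blast

lemma laurent_over_ops:
  assumes R: "fun_alg k (pts V) (reg V)" "0 \<in> k" "1 \<in> k"
  shows laurent_over_reg: "r \<in> reg V \<Longrightarrow> laurent_over V (\<lambda>z. r (snd z))"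
    and laurent_over_id: "laurent_over V fst"
    and laurent_over_inv: "laurent_over V (\<lambda>z. inverse (fst z))"
    and laurent_over_add: "laurent_over V f \<Longrightarrow> laurent_over V g \<Longrightarrow> laurent_over V (\<lambda>z. f z + g z)"
    and laurent_over_mult: "laurent_over V f \<Longrightarrow> laurent_over V g \<Longrightarrow> laurent_over V (\<lambda>z. f z * g z)"
proof -
  note c0 = fun_alg_const[OF R(1,2)] and c1 = fun_alg_const[OF R(1,3)]
  have mon: "(\<lambda>x. poly.coeff (monom 1 i) j) \<in> reg V" for i j :: nat
    using c0 c1 by (cases "i = j") auto
  have prd: "(\<lambda>x. poly.coeff (P x * Q x) j) \<in> reg V"
    if "\<And>j. (\<lambda>x. poly.coeff (P x) j) \<in> reg V" "\<And>j. (\<lambda>x. poly.coeff (Q x) j) \<in> reg V" for P Q :: "'a \<Rightarrow> complex poly" and j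
    unfolding coeff_mult by (intro fun_alg_sum[OF R(1,2)] fun_alg_mult[OF R(1)] that)
  show "laurent_over V (\<lambda>z. r (snd z))" if "r \<in> reg V"
  proof (rule laurent_overI[of "\<lambda>x. [:r x:]" _ 0])
    show "(\<lambda>x. poly.coeff [:r x:] j) \<in> reg V" for j
      using that c0 by (cases j) (auto simp: coeff_pCons)
  qed auto
  show "laurent_over V fst"
    by (rule laurent_overI[of "\<lambda>x. monom 1 1" _ 0, OF mon]) (simp add: poly_monom)
  show "laurent_over V (\<lambda>z. inverse (fst z))"
    by (rule laurent_overI[of "\<lambda>x. monom 1 0" _ 1, OF mon]) (simp add: poly_monom)
  assume "laurent_over V f" "laurent_over V g"
  then obtain N P M Q where P: "\<And>j. (\<lambda>x. poly.coeff (P x) j) \<in> reg V"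
    "\<And>c x. c \<noteq> 0 \<Longrightarrow> x \<in> pts V \<Longrightarrow> c ^ N * f (c, x) = poly (P x) c"
    and Q: "\<And>j. (\<lambda>x. poly.coeff (Q x) j) \<in> reg V"
    "\<And>c x. c \<noteq> 0 \<Longrightarrow> x \<in> pts V \<Longrightarrow> c ^ M * g (c, x) = poly (Q x) c"
    unfolding laurent_over_def by metis
  show "laurent_over V (\<lambda>z. f z + g z)"
  proof (rule laurent_overI[of "\<lambda>x. monom 1 M * P x + monom 1 N * Q x" _ "N + M"])
    show "(\<lambda>x. poly.coeff (monom 1 M * P x + monom 1 N * Q x) j) \<in> reg V" for j
      unfolding coeff_add by (intro fun_alg_add[OF R(1)] prd mon P Q)
    show "c ^ (N + M) * (f (c, x) + g (c, x)) = poly (monom 1 M * P x + monom 1 N * Q x) c"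
      if "c \<noteq> 0" "x \<in> pts V" for c x
      using P(2)[OF that, symmetric] Q(2)[OF that, symmetric] by (simp add: poly_monom power_add algebra_simps)
  qed
  show "laurent_over V (\<lambda>z. f z * g z)"
  proof (rule laurent_overI[of "\<lambda>x. P x * Q x" _ "N + M"])
    show "c ^ (N + M) * (f (c, x) * g (c, x)) = poly (P x * Q x) c" if "c \<noteq> 0" "x \<in> pts V" for c x
      using P(2)[OF that, symmetric] Q(2)[OF that, symmetric] by (simp add: power_add algebra_simps)
  qed (intro prd P Q)
qed

lemma poly_zero_cofinite:
  fixes p :: "complex poly"
  assumes "\<And>c. c \<noteq> 0 \<Longrightarrow> poly p c = 0" shows "p = 0"
proof (rule ccontr)
  assume "p \<noteq> 0"
  then have "finite {c. poly p c = 0}" by (rule poly_roots_finite)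
  moreover have "UNIV - {0} \<subseteq> {c. poly p c = 0}" using assms by auto
  ultimately have "finite (UNIV - {0::complex})" using finite_subset by blast
  then show False using infinite_UNIV_char_0[where 'a = complex] by simp
qed

text \<open>The hypothesis \<open>q\<close> says that \<open>A\<close> is Zariski dense. Vanishing
  for all nonzero \<open>c\<close> kills the coefficients on \<open>A\<close>, and these are regular
  on \<open>V\<close>. Both a single generic point and the domain of an inverse chart occur as
  \<open>A\<close>.\<close>

lemma laurent_over_zero:
  assumes g: "laurent_over V g" and q: "\<And>r y. r \<in> reg V \<Longrightarrow> (\<And>x. x \<in> A \<Longrightarrow> r x = 0) \<Longrightarrow> y \<in> pts V \<Longrightarrow> r y = 0"
    and A: "A \<subseteq> pts V" and z: "\<And>c x. c \<noteq> 0 \<Longrightarrow> x \<in> A \<Longrightarrow> g (c, x) = 0" and cy: "c \<noteq> 0" "y \<in> pts V"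
  shows "g (c, y) = 0"
proof -
  obtain N P where P: "\<And>j. (\<lambda>x. poly.coeff (P x) j) \<in> reg V"
    "\<And>c x. c \<noteq> 0 \<Longrightarrow> x \<in> pts V \<Longrightarrow> c ^ N * g (c, x) = poly (P x) c"
    using g unfolding laurent_over_def by metis
  have "P x = 0" if "x \<in> A" for x
    by (rule poly_zero_cofinite) (use P(2) z A that in force)
  then have "poly.coeff (P y) j = 0" for j using q[OF P(1), of j y] cy by simp
  then have "P y = 0" by (simp add: poly_eq_iff)
  then show ?thesis using P(2)[OF cy] cy by simp
qed

lemma Tpts_Suc: "w \<in> Tpts (Suc d) \<longleftrightarrow> w 0 \<noteq> 0 \<and> (\<lambda>i. w (Suc i)) \<in> Tpts d"
proof -
  have "(\<forall>i<Suc d. w i \<noteq> 0) \<longleftrightarrow> w 0 \<noteq> 0 \<and> (\<forall>i<d. w (Suc i) \<noteq> 0)" by (simp add: All_less_Suc2)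
  moreover have "(\<forall>i\<ge>Suc d. w i = 1) \<longleftrightarrow> (\<forall>i\<ge>d. w (Suc i) = 1)"
    by (metis Suc_le_D Suc_le_mono)
  ultimately show ?thesis by (auto simp: Tpts_def)
qed

lemma case_nat_eta: "case_nat (w 0) (\<lambda>i. w (Suc i)) = w"
  by (rule ext) (simp split: nat.split)

lemma case_nat_Tpts [simp]: "case_nat c z \<in> Tpts (Suc d) \<longleftrightarrow> c \<noteq> 0 \<and> z \<in> Tpts d"
  by (simp add: Tpts_Suc)

lemma torus_Suc_laurent_over:
  assumes "r \<in> regfun (torus (Suc d))"
  shows "laurent_over (var (torus d)) (\<lambda>(c, z). r (case_nat c z))"
proof -
  let ?V = "var (torus d)"
  have R: "fun_alg \<rat> (pts ?V) (reg ?V)" "0 \<in> (\<rat>::complex set)" "1 \<in> (\<rat>::complex set)"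
    by (simp_all add: torus_simps fun_alg_torus)
  have "r \<in> funs_on \<rat> (Tpts (Suc d)) ({\<lambda>z. z i | i. i < Suc d} \<union> {\<lambda>z. inverse (z i) | i. i < Suc d})"
    using assms by (simp add: torus_def)
  then have "\<exists>h. laurent_over ?V (\<lambda>(c, z). h (case_nat c z)) \<and> (\<forall>w\<in>Tpts (Suc d). r w = h w)"
  proof (rule funs_on_induct)
    fix c :: complex assume "c \<in> \<rat>"
    then show "laurent_over ?V (\<lambda>(_, z). c)"
      using laurent_over_reg[OF R fun_alg_const[OF R(1)]] by (simp add: case_prod_unfold)
  next
    fix f :: "(nat \<Rightarrow> complex) \<Rightarrow> complex"
    assume "f \<in> {\<lambda>z. z i | i. i < Suc d} \<union> {\<lambda>z. inverse (z i) | i. i < Suc d}"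
    then consider i where "i < Suc d" "f = (\<lambda>z. z i)" | i where "i < Suc d" "f = (\<lambda>z. inverse (z i))" by blast
    then show "laurent_over ?V (\<lambda>(c, z). f (case_nat c z))"
    proof cases
      case 1
      show ?thesis
      proof (cases i)
        case 0 then show ?thesis using 1 laurent_over_id[OF R] by (simp add: case_prod_unfold)
      next
        case (Suc j)
        then have "(\<lambda>z. z j) \<in> reg ?V" using 1 coord_reg by (simp add: torus_simps)
        then show ?thesis using 1 Suc laurent_over_reg[OF R, of "\<lambda>z. z j"] by (simp add: case_prod_unfold)
      qed
    next
      case 2
      show ?thesis
      proof (cases i)
        case 0 then show ?thesis using 2 laurent_over_inv[OF R] by (simp add: case_prod_unfold)
      next
        case (Suc j)
        then have "(\<lambda>z. inverse (z j)) \<in> reg ?V" using 2 coord_reg by (simp add: torus_simps)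
        then show ?thesis using 2 Suc laurent_over_reg[OF R, of "\<lambda>z. inverse (z j)"] by (simp add: case_prod_unfold)
      qed
    qed
  next
    fix f g assume fg: "laurent_over ?V (\<lambda>(c, z). f (case_nat c z))" "laurent_over ?V (\<lambda>(c, z). g (case_nat c z))"
    show "laurent_over ?V (\<lambda>(c, z). f (case_nat c z) + g (case_nat c z))"
      using laurent_over_add[OF R fg] by (simp add: case_prod_unfold)
    show "laurent_over ?V (\<lambda>(c, z). f (case_nat c z) * g (case_nat c z))"
      using laurent_over_mult[OF R fg] by (simp add: case_prod_unfold)
  qed
  then obtain h where h: "laurent_over ?V (\<lambda>(c, z). h (case_nat c z))" "\<forall>w\<in>Tpts (Suc d). r w = h w" by blast
  have "r (case_nat c x) = h (case_nat c x)" if "c \<noteq> 0" "x \<in> Tpts d" for c x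
    using h(2) that by simp
  then show ?thesis using h(1) unfolding laurent_over_def prod.case torus_simps by simp
qed

section \<open>Existence of generic points by counting\<close>

lemma countable_poly_mapping:
  assumes "countable (UNIV :: 'k set)" "countable (UNIV :: 'v set)"
  shows "countable (UNIV :: ('k \<Rightarrow>\<^sub>0 'v::comm_monoid_add) set)"
proof -
  let ?f = "\<lambda>xs :: ('k \<times> 'v) list. \<Sum>(m, a)\<leftarrow>xs. single m a"
  have "\<exists>xs. p = ?f xs" for p
  proof (induction p rule: pm_induct)
    case zero then show ?case by (intro exI[of _ "[]"]) simp
  next
    case (add m a p)
    then obtain xs where "p = ?f xs" by blast
    then show ?case by (intro exI[of _ "(m, a) # xs"]) simp
  qed
  then have "UNIV = ?f ` lists UNIV" by (auto simp: image_iff)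
  moreover have "countable (lists (UNIV :: ('k \<times> 'v) set))"
    using assms by (intro countable_lists) (simp flip: UNIV_Times_UNIV)
  ultimately show ?thesis by (metis countable_image)
qed

text \<open>At a generic \<open>z\<close> a nonzero Laurent polynomial in one more variable stays
  nonzero as a function of \<open>c\<close>, so it excludes finitely many \<open>c\<close>; with
  rational coefficients there are only countably many such polynomials.\<close>

lemma GP_slice:
  assumes z: "z \<in> GP d" shows "countable {c. c \<noteq> 0 \<and> case_nat c z \<notin> GP (Suc d)}"
proof -
  let ?V = "var (torus d)"
  have "countable (UNIV :: (nat \<Rightarrow>\<^sub>0 int) set)" by (rule countable_poly_mapping) simp_all
  then have cnt: "countable (UNIV :: laurent set)" by (rule countable_poly_mapping) simp
  have zT: "z \<in> Tpts d" using z by (rule GP_Tpts)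
  have fin: "finite {c. c \<noteq> 0 \<and> leval p (case_nat c z) = 0}" if p: "p \<in> laurents (Suc d)" "p \<noteq> 0" for p
  proof -
    have lo: "laurent_over ?V (\<lambda>(c, z). leval p (case_nat c z))"
      by (rule torus_Suc_laurent_over[OF leval_reg[OF p(1)]])
    then obtain N P where P: "\<And>j. (\<lambda>x. poly.coeff (P x) j) \<in> reg ?V"
      "\<And>c x. c \<noteq> 0 \<Longrightarrow> x \<in> pts ?V \<Longrightarrow> c ^ N * leval p (case_nat c x) = poly (P x) c"
      unfolding laurent_over_def prod.case by metis
    have "P z \<noteq> 0"
    proof
      assume 0: "P z = 0"
      have "leval p w = 0" if "w \<in> Tpts (Suc d)" for w
      proof -
        have w: "w 0 \<noteq> 0" "(\<lambda>i. w (Suc i)) \<in> Tpts d" using that by (auto simp: Tpts_Suc)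
        have "(\<lambda>(c, z). leval p (case_nat c z)) (w 0, \<lambda>i. w (Suc i)) = 0"
        proof (rule laurent_over_zero[OF lo, of "{z}"])
          show "r y = 0" if "r \<in> reg ?V" "\<And>x. x \<in> {z} \<Longrightarrow> r x = 0" "y \<in> pts ?V" for r y
            using gptD[OF z that(1) _ that(3)] that(2) by simp
          show "(\<lambda>(c, z). leval p (case_nat c z)) (c, x) = 0" if "c \<noteq> 0" "x \<in> {z}" for c x
            using P(2)[of c z] that 0 zT by (simp add: torus_simps)
        qed (use w zT in \<open>auto simp: torus_simps\<close>)
        then show ?thesis by (simp add: case_nat_eta)
      qed
      then show False using leval_zero_imp[OF p(1)] p(2) by blast
    qed
    then have "finite {c. poly (P z) c = 0}" by (rule poly_roots_finite)
    moreover have "{c. c \<noteq> 0 \<and> leval p (case_nat c z) = 0} \<subseteq> {c. poly (P z) c = 0}"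
      using P(2)[of _ z] zT by (auto simp: torus_simps simp flip: P(2))
    ultimately show ?thesis by (rule rev_finite_subset)
  qed
  have "{c. c \<noteq> 0 \<and> case_nat c z \<notin> GP (Suc d)} \<subseteq>
      (\<Union>p\<in>{p\<in>laurents (Suc d). p \<noteq> 0}. {c. c \<noteq> 0 \<and> leval p (case_nat c z) = 0})"
    using GP_I[of "case_nat _ z" "Suc d"] zT by auto
  moreover have "countable (\<Union>p\<in>{p\<in>laurents (Suc d). p \<noteq> 0}. {c. c \<noteq> 0 \<and> leval p (case_nat c z) = 0})"
    using fin by (intro countable_UN countable_subset[OF _ cnt] countable_finite) auto
  ultimately show ?thesis by (rule countable_subset)
qed

lemma drop_reg:
  assumes "r \<in> regfun (torus d)" shows "(\<lambda>w. r (\<lambda>i. w (Suc i))) \<in> regfun (torus (Suc d))"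
proof (rule funs_on_comp[OF fun_alg_torus, where S' = "Tpts d" and F = "torus_gens d"
      and g = r and \<psi> = "\<lambda>w i. w (Suc i)"])
  show "r \<in> funs_on \<rat> (Tpts d) (torus_gens d)" using assms by (simp add: regfun_torus)
  show "(\<lambda>w. f (\<lambda>i. w (Suc i))) \<in> regfun (torus (Suc d))" if "f \<in> torus_gens d" for f
    using that coord_reg[of "Suc _" "Suc d"] by auto
qed (simp add: Tpts_Suc)

lemma GP_drop:
  assumes "case_nat c z \<in> GP (Suc d)" shows "z \<in> GP d" "c \<noteq> 0"
proof -
  have T: "c \<noteq> 0" "z \<in> Tpts d" using GP_Tpts[OF assms] by auto
  then show "c \<noteq> 0" by blast
  have "r y = 0" if "r \<in> regfun (torus d)" "r z = 0" "y \<in> Tpts d" for r y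
    using gptD[OF assms, of "\<lambda>w. r (\<lambda>i. w (Suc i))" "case_nat 1 y"] drop_reg[OF that(1)] that(2,3)
    by (simp add: torus_simps)
  then show "z \<in> GP d" using T by (simp add: gpt_def torus_simps)
qed

definition rpos :: "complex \<Rightarrow> bool" where "rpos x \<longleftrightarrow> (\<exists>r>0. x = complex_of_real r)"

text \<open>Each new coordinate avoids countably many values, so it can be chosen real between 0 and
  1. Positive coordinates give positive leading coefficients along the degenerating
  sequences.\<close>

lemma GP_exists: "\<exists>z\<in>GP n. \<forall>i. rpos (z i)"
proof (induction n)
  case 0
  have "Tpts 0 = {\<lambda>_. 1}" by (auto simp: Tpts_def)
  then have "(\<lambda>_. 1) \<in> GP 0" by (auto simp: gpt_def torus_simps)
  then show ?case by (intro bexI[of _ "\<lambda>_. 1"]) (auto simp: rpos_def intro: exI[of _ 1])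
next
  case (Suc n)
  then obtain z where z: "z \<in> GP n" "\<And>i. rpos (z i)" by blast
  have "uncountable (complex_of_real ` {0<..<1})"
    by (subst countable_image_inj_eq) (auto simp: uncountable_open_interval inj_on_def)
  then obtain c where "c \<in> complex_of_real ` {0<..<1}" "c \<notin> {c. c \<noteq> 0 \<and> case_nat c z \<notin> GP (Suc n)}"
    using countable_subset[OF _ GP_slice[OF z(1)]] by (meson subsetI)
  then have "rpos c" "case_nat c z \<in> GP (Suc n)" by (auto simp: rpos_def)
  then show ?case using z by (intro bexI[of _ "case_nat c z"]) (auto split: nat.split)
qed

section \<open>Generic properties on a torus, and degeneration of generic points\<close>

lemma generic_torus_iff:
  "generic (var (torus n)) A \<longleftrightarrow> (\<exists>q\<in>laurents n. q \<noteq> 0 \<and> (\<forall>z\<in>Tpts n. leval q z \<noteq> 0 \<longrightarrow> A z))"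
proof
  obtain \<zeta> where \<zeta>: "\<zeta> \<in> GP n" using GP_exists by blast
  assume "generic (var (torus n)) A"
  then obtain q where q: "q \<in> regfun (torus n)" "zdense (var (torus n)) {x\<in>Tpts n. q x \<noteq> 0} (Tpts n)"
    "\<forall>z\<in>Tpts n. q z \<noteq> 0 \<longrightarrow> A z" by (auto simp: generic_def torus_simps)
  obtain p where p: "p \<in> laurents n" "\<forall>z\<in>Tpts n. q z = leval p z" using reg_torus_leval[OF q(1)] by blast
  have "p \<noteq> 0"
  proof
    assume "p = 0"
    then have "{x\<in>Tpts n. q x \<noteq> 0} = {}" using p by auto
    moreover have "zclosed (var (torus n)) {}" unfolding zclosed_def torus_simps
      using fun_alg_const[OF fun_alg_torus, of 1 n] by (intro exI[of _ "{\<lambda>_. 1}"]) auto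
    ultimately have "Tpts n \<subseteq> {}" using q(2) unfolding zdense_def by blast
    then show False using GP_Tpts[OF \<zeta>] by blast
  qed
  then show "\<exists>q\<in>laurents n. q \<noteq> 0 \<and> (\<forall>z\<in>Tpts n. leval q z \<noteq> 0 \<longrightarrow> A z)" using p q by auto
next
  obtain \<zeta> where \<zeta>: "\<zeta> \<in> GP n" using GP_exists by blast
  assume "\<exists>q\<in>laurents n. q \<noteq> 0 \<and> (\<forall>z\<in>Tpts n. leval q z \<noteq> 0 \<longrightarrow> A z)"
  then obtain q where q: "q \<in> laurents n" "q \<noteq> 0" "\<forall>z\<in>Tpts n. leval q z \<noteq> 0 \<longrightarrow> A z" by blast
  have nz: "leval q \<zeta> \<noteq> 0" using GP_leval[OF \<zeta> q(1)] q(2) by blast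
  have "Tpts n \<subseteq> Z" if Z: "zclosed (var (torus n)) Z" "{x\<in>Tpts n. leval q x \<noteq> 0} \<subseteq> Z" for Z
  proof -
    obtain E where E: "E \<subseteq> regfun (torus n)" "Z = {x\<in>Tpts n. \<forall>g\<in>E. g x = 0}"
      using Z(1) by (auto simp: zclosed_def torus_simps)
    have "\<zeta> \<in> Z" using Z(2) nz GP_Tpts[OF \<zeta>] by blast
    then show ?thesis using E gptD[OF \<zeta>] by (auto simp: torus_simps subset_iff)
  qed
  then show "generic (var (torus n)) A"
    unfolding generic_def torus_simps zdense_def using leval_reg[OF q(1)] q(3) by blast
qed

lemma generic_conj:
  assumes "generic (var (torus n)) A" "generic (var (torus n)) B"
  shows "generic (var (torus n)) (\<lambda>z. A z \<and> B z)"
proof -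
  obtain \<zeta> where \<zeta>: "\<zeta> \<in> GP n" using GP_exists by blast
  obtain p where p: "p \<in> laurents n" "p \<noteq> 0" "\<forall>z\<in>Tpts n. leval p z \<noteq> 0 \<longrightarrow> A z"
    using assms(1) unfolding generic_torus_iff by blast
  obtain q where q: "q \<in> laurents n" "q \<noteq> 0" "\<forall>z\<in>Tpts n. leval q z \<noteq> 0 \<longrightarrow> B z"
    using assms(2) unfolding generic_torus_iff by blast
  have "leval (p * q) \<zeta> \<noteq> 0"
    using GP_leval[OF \<zeta> p(1)] GP_leval[OF \<zeta> q(1)] p(2) q(2) by (auto simp: leval_mult Tpts_nz[OF GP_Tpts[OF \<zeta>]])
  then have "p * q \<noteq> 0" by auto
  then show ?thesis unfolding generic_torus_iff using p q
    by (intro bexI[of _ "p * q"]) (auto simp: leval_mult Tpts_nz laurents_closed)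
qed

lemma generic_mono: "generic V A \<Longrightarrow> (\<And>z. z \<in> pts V \<Longrightarrow> A z \<Longrightarrow> B z) \<Longrightarrow> generic V B"
  unfolding generic_def by blast

text \<open>A property that holds on a dense open subset, whichever it is, holds at every generic
  point; from here on rational functions are treated pointwise.\<close>

lemma generic_GP: "generic (var (torus n)) A \<Longrightarrow> z \<in> GP n \<Longrightarrow> A z"
  unfolding generic_torus_iff using GP_leval GP_Tpts by blast

lemma generic_leval_nz: "p \<in> laurents n \<Longrightarrow> p \<noteq> 0 \<Longrightarrow> generic (var (torus n)) (\<lambda>z. leval p z \<noteq> 0)"
  unfolding generic_torus_iff by blast

lemma generic_Tpts: "generic (var (torus n)) (\<lambda>z. z \<in> Tpts n)"
  unfolding generic_torus_iff
  by (intro bexI[of _ 1]) (auto simp: one_laurents)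

text \<open>Translation by the cocharacter \<open>l\<close> evaluated at
  \<open>2 powi (- k)\<close>, so that the monomial \<open>m\<close> is multiplied by
  \<open>2 powi (- k * epair m l)\<close>. The base 2 is rational, which keeps the translates of a
  generic point generic.\<close>

definition scal :: "(nat \<Rightarrow> int) \<Rightarrow> nat \<Rightarrow> (nat \<Rightarrow> complex) \<Rightarrow> nat \<Rightarrow> complex" where
  "scal l k z = (\<lambda>i. z i * 2 powi (- int k * l i))"

lemma scal_GP:
  assumes z: "z \<in> GP n" and l: "l \<in> cochar_lattice n" shows "scal l k z \<in> GP n"
proof -
  have T: "(\<lambda>i. y i * 2 powi (e * l i)) \<in> Tpts n" if "y \<in> Tpts n" for y e
    using that l by (auto simp: Tpts_def cochar_lattice_def)
  have rat: "(2::complex) powi e \<in> \<rat>" for e by (auto simp: power_int_def)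
  have sr: "(\<lambda>z. r (scal l k z)) \<in> regfun (torus n)" if "r \<in> regfun (torus n)" for r
  proof (rule funs_on_comp[OF fun_alg_torus, where S' = "Tpts n" and F = "torus_gens n"
      and g = r and \<psi> = "scal l k"])
    show "r \<in> funs_on \<rat> (Tpts n) (torus_gens n)" using that by (simp add: regfun_torus)
    fix f :: "(nat \<Rightarrow> complex) \<Rightarrow> complex"
    assume "f \<in> {\<lambda>z. z i | i. i < n} \<union> {\<lambda>z. inverse (z i) | i. i < n}"
    then consider i where "i < n" "f = (\<lambda>z. z i)" | i where "i < n" "f = (\<lambda>z. inverse (z i))" by blast
    then show "(\<lambda>z. f (scal l k z)) \<in> regfun (torus n)"
    proof cases
      case 1
      then have "f \<in> regfun (torus n)" using coord_reg by simp
      from fun_alg_cmult[OF fun_alg_torus rat this, of "- int k * l i"] show ?thesis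
        using 1 by (simp add: scal_def mult.commute)
    next
      case 2
      then have "f \<in> regfun (torus n)" using coord_reg by simp
      from fun_alg_cmult[OF fun_alg_torus rat this, of "int k * l i"] show ?thesis
        using 2 by (simp add: scal_def mult.commute power_int_minus)
    qed
  qed (use T[of _ "- int k"] in \<open>simp add: scal_def\<close>)
  have "r y = 0" if r: "r \<in> regfun (torus n)" "r (scal l k z) = 0" and y: "y \<in> Tpts n" for r y
  proof -
    \<comment> \<open>The pullback of \<open>r\<close> under the translation vanishes at the generic
      point, hence everywhere, in particular at \<open>y\<close> moved back.\<close>
    let ?y = "\<lambda>i. y i * 2 powi (int k * l i)"
    have "r (scal l k ?y) = 0"
      using gptD[OF z, of "\<lambda>z. r (scal l k z)" ?y] sr[OF r(1)] r(2) T[OF y, of "int k"] by (simp add: torus_simps)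
    moreover have "scal l k ?y = y" by (auto simp: scal_def power_int_minus fun_eq_iff)
    ultimately show ?thesis by simp
  qed
  then show ?thesis using T[OF GP_Tpts[OF z], of "- int k"] by (simp add: gpt_def torus_simps scal_def)
qed

section \<open>Orders of growth along one-parameter sequences\<close>

lemma rpos_ops:
  shows rpos_add: "rpos x \<Longrightarrow> rpos y \<Longrightarrow> rpos (x + y)"
    and rpos_mult: "rpos x \<Longrightarrow> rpos y \<Longrightarrow> rpos (x * y)"
    and rpos_inverse: "rpos x \<Longrightarrow> rpos (inverse x)"
    and rpos_nz: "rpos x \<Longrightarrow> x \<noteq> 0"
    and rpos_1: "rpos 1"
proof -
  show "rpos x \<Longrightarrow> rpos y \<Longrightarrow> rpos (x + y)"
    unfolding rpos_def by (metis add_pos_pos of_real_add)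
  show "rpos x \<Longrightarrow> rpos y \<Longrightarrow> rpos (x * y)"
    unfolding rpos_def by (metis mult_pos_pos of_real_mult)
  show "rpos x \<Longrightarrow> rpos (inverse x)"
    unfolding rpos_def by (metis inverse_positive_iff_positive of_real_inverse)
qed (auto simp: rpos_def intro: exI[of _ 1])

lemma rpos_power_int: "rpos x \<Longrightarrow> rpos (x powi k)"
  unfolding rpos_def by (metis of_real_power_int zero_less_power_int)

lemma rpos_prod: "(\<And>j. j \<in> J \<Longrightarrow> rpos (f j)) \<Longrightarrow> rpos (\<Prod>j\<in>J. f j)"
  by (induction J rule: infinite_finite_induct) (auto intro: rpos_mult rpos_1)

lemma rpos_sum: "finite J \<Longrightarrow> J \<noteq> {} \<Longrightarrow> (\<And>j. j \<in> J \<Longrightarrow> rpos (f j)) \<Longrightarrow> rpos (\<Sum>j\<in>J. f j)"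
  by (induction J rule: finite_ne_induct) (auto intro: rpos_add)

lemma rpos_monomial: "(\<And>i. rpos (z i)) \<Longrightarrow> rpos (monomial m z)"
  unfolding monomial_def by (intro rpos_prod rpos_power_int)

lemma rpos_of_rat: "a \<in> \<nat> \<Longrightarrow> a \<noteq> 0 \<Longrightarrow> rpos (of_rat a)"
  by (elim Nats_cases) (auto simp: rpos_def intro!: exI[of _ "real _"])

lemma nonneg_coeff_rpos: "nonneg_coeffs p \<Longrightarrow> m \<in> keys p \<Longrightarrow> rpos (of_rat (lookup p m))"
  by (intro rpos_of_rat) (auto simp: nonneg_coeffs_def in_keys_iff)

lemma leval_rpos:
  assumes "nonneg_coeffs p" "p \<noteq> 0" "\<And>i. rpos (z i)" shows "rpos (leval p z)"
  unfolding leval_def using assms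
  by (intro rpos_sum rpos_mult nonneg_coeff_rpos rpos_monomial) (auto simp: keys_eq_empty)

lemma two_powi_tendsto_0: "d > 0 \<Longrightarrow> (\<lambda>k. (2::complex) powi (- int k * d)) \<longlonglongrightarrow> 0"
proof -
  assume d: "d > 0"
  have "(2::complex) powi (- int k * d) = (inverse (2 ^ nat d)) ^ k" for k
  proof -
    have "(2::complex) powi (- int k * d) = 2 powi (d * (- int k))" by (simp add: mult.commute)
    also have "\<dots> = (2 powi d) powi (- int k)" by (rule power_int_mult)
    finally show ?thesis using d by (simp add: power_int_def power_inverse)
  qed
  moreover have "(1::real) < 2 ^ nat d" using d by (intro one_less_power) auto
  then have "norm (inverse ((2::complex) ^ nat d)) < 1"
    by (simp add: norm_divide norm_power inverse_eq_divide)
  ultimately show ?thesis using LIMSEQ_power_zero by simp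
qed

lemma two_powi_add: "(2::complex) powi (a + b) = 2 powi a * 2 powi b"
  by (rule power_int_add) simp

text \<open>The sequence behaves like \<open>C * 2 powi (- k * m)\<close>. The sign makes
  \<open>m\<close> a valuation, in accordance with the minimum in \<open>trop\<close>.\<close>

definition tord :: "(nat \<Rightarrow> complex) \<Rightarrow> int \<Rightarrow> bool" where
  "tord g m \<longleftrightarrow> (\<exists>C. C \<noteq> 0 \<and> (\<lambda>k. g k * 2 powi (int k * m)) \<longlonglongrightarrow> C)"

definition pord :: "(nat \<Rightarrow> complex) \<Rightarrow> int \<Rightarrow> bool" where
  "pord g m \<longleftrightarrow> (\<exists>C. rpos C \<and> (\<lambda>k. g k * 2 powi (int k * m)) \<longlonglongrightarrow> C)"

lemma pord_tord: "pord g m \<Longrightarrow> tord g m"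
  by (auto simp: pord_def tord_def dest: rpos_nz)

lemma tord_less_False:
  assumes "tord g m" "tord g m'" "m < m'" shows False
proof -
  obtain C C' where C: "C \<noteq> 0" "(\<lambda>k. g k * 2 powi (int k * m)) \<longlonglongrightarrow> C"
    "C' \<noteq> 0" "(\<lambda>k. g k * 2 powi (int k * m')) \<longlonglongrightarrow> C'"
    using assms by (auto simp: tord_def)
  have "(\<lambda>k. g k * 2 powi (int k * m') * 2 powi (- int k * (m' - m))) \<longlonglongrightarrow> C' * 0"
    using assms(3) by (intro tendsto_mult C two_powi_tendsto_0) simp
  moreover have "g k * 2 powi (int k * m') * 2 powi (- int k * (m' - m)) = g k * 2 powi (int k * m)" for k
    by (simp add: mult.assoc two_powi_add[symmetric] algebra_simps)
  ultimately have "(\<lambda>k. g k * 2 powi (int k * m)) \<longlonglongrightarrow> C' * 0" by (simp only:)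
  then show False using LIMSEQ_unique[OF C(2)] C(1) by auto
qed

lemma tord_unique: "tord g m \<Longrightarrow> tord g m' \<Longrightarrow> m = m'"
  using tord_less_False by (metis linorder_neqE)

lemma pord_unique: "pord g m \<Longrightarrow> pord g m' \<Longrightarrow> m = m'"
  using tord_unique pord_tord by blast

lemma tord_mult:
  assumes "tord g m" "tord h m'" shows "tord (\<lambda>k. g k * h k) (m + m')"
proof -
  obtain C C' where C: "C \<noteq> 0" "(\<lambda>k. g k * 2 powi (int k * m)) \<longlonglongrightarrow> C"
    "C' \<noteq> 0" "(\<lambda>k. h k * 2 powi (int k * m')) \<longlonglongrightarrow> C'"
    using assms by (auto simp: tord_def)
  have "(\<lambda>k. (g k * 2 powi (int k * m)) * (h k * 2 powi (int k * m'))) \<longlonglongrightarrow> C * C'"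
    by (intro tendsto_mult C)
  then show ?thesis unfolding tord_def using C
    by (intro exI[of _ "C * C'"]) (simp add: two_powi_add distrib_left mult_ac)
qed

lemma tord_inverse:
  assumes "tord g m" shows "tord (\<lambda>k. inverse (g k)) (- m)"
proof -
  obtain C where C: "C \<noteq> 0" "(\<lambda>k. g k * 2 powi (int k * m)) \<longlonglongrightarrow> C"
    using assms by (auto simp: tord_def)
  have "(\<lambda>k. inverse (g k * 2 powi (int k * m))) \<longlonglongrightarrow> inverse C" by (intro tendsto_inverse C)
  then show ?thesis unfolding tord_def using C
    by (intro exI[of _ "inverse C"]) (simp add: power_int_minus)
qed

lemma tord_divide: "tord g m \<Longrightarrow> tord h m' \<Longrightarrow> tord (\<lambda>k. g k / h k) (m - m')"
  using tord_mult[OF _ tord_inverse] by (simp add: divide_inverse)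

lemma pord_mult:
  assumes "pord g m" "pord h m'" shows "pord (\<lambda>k. g k * h k) (m + m')"
proof -
  obtain C C' where C: "rpos C" "(\<lambda>k. g k * 2 powi (int k * m)) \<longlonglongrightarrow> C"
    "rpos C'" "(\<lambda>k. h k * 2 powi (int k * m')) \<longlonglongrightarrow> C'"
    using assms by (auto simp: pord_def)
  have "(\<lambda>k. (g k * 2 powi (int k * m)) * (h k * 2 powi (int k * m'))) \<longlonglongrightarrow> C * C'"
    by (intro tendsto_mult C)
  then show ?thesis unfolding pord_def using C rpos_mult
    by (intro exI[of _ "C * C'"]) (simp add: two_powi_add distrib_left mult_ac)
qed

lemma pord_inverse:
  assumes "pord g m" shows "pord (\<lambda>k. inverse (g k)) (- m)"
proof -
  obtain C where C: "rpos C" "(\<lambda>k. g k * 2 powi (int k * m)) \<longlonglongrightarrow> C"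
    using assms by (auto simp: pord_def)
  have "(\<lambda>k. inverse (g k * 2 powi (int k * m))) \<longlonglongrightarrow> inverse C" by (intro tendsto_inverse C rpos_nz)
  then show ?thesis unfolding pord_def using C rpos_inverse
    by (intro exI[of _ "inverse C"]) (simp add: power_int_minus)
qed

lemma pord_divide: "pord g m \<Longrightarrow> pord h m' \<Longrightarrow> pord (\<lambda>k. g k / h k) (m - m')"
  using pord_mult[OF _ pord_inverse] by (simp add: divide_inverse)

lemma pord_const: "rpos C \<Longrightarrow> pord (\<lambda>_. C) 0"
  by (auto simp: pord_def)

lemma pord_add_less:
  assumes "pord g m" "pord h m'" "m < m'" shows "pord (\<lambda>k. g k + h k) m"
proof -
  obtain C C' where C: "rpos C" "(\<lambda>k. g k * 2 powi (int k * m)) \<longlonglongrightarrow> C"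
    "rpos C'" "(\<lambda>k. h k * 2 powi (int k * m')) \<longlonglongrightarrow> C'"
    using assms by (auto simp: pord_def)
  have "(\<lambda>k. h k * 2 powi (int k * m') * 2 powi (- int k * (m' - m))) \<longlonglongrightarrow> C' * 0"
    using assms(3) by (intro tendsto_mult C two_powi_tendsto_0) simp
  moreover have "h k * 2 powi (int k * m') * 2 powi (- int k * (m' - m)) = h k * 2 powi (int k * m)" for k
    by (simp add: mult.assoc two_powi_add[symmetric] algebra_simps)
  ultimately have "(\<lambda>k. h k * 2 powi (int k * m)) \<longlonglongrightarrow> C' * 0" by (simp only:)
  then have "(\<lambda>k. g k * 2 powi (int k * m) + h k * 2 powi (int k * m)) \<longlonglongrightarrow> C + 0"
    using C(2) by (intro tendsto_add) auto
  then show ?thesis using C(1) by (auto simp: pord_def algebra_simps)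
qed

text \<open>Positive leading coefficients cannot cancel, so the smaller order survives. This is the
  step at which addition becomes a minimum, and the reason for distinguishing \<open>pord\<close>
  from \<open>tord\<close>.\<close>

lemma pord_add:
  assumes "pord g m" "pord h m'" shows "pord (\<lambda>k. g k + h k) (min m m')"
proof (cases m m' rule: linorder_cases)
  case less then show ?thesis using pord_add_less[OF assms] by simp
next
  case greater then show ?thesis using pord_add_less[OF assms(2,1)] by (simp add: add.commute)
next
  case equal
  obtain C C' where C: "rpos C" "(\<lambda>k. g k * 2 powi (int k * m)) \<longlonglongrightarrow> C"
    "rpos C'" "(\<lambda>k. h k * 2 powi (int k * m')) \<longlonglongrightarrow> C'"
    using assms by (auto simp: pord_def)
  have "(\<lambda>k. g k * 2 powi (int k * m) + h k * 2 powi (int k * m')) \<longlonglongrightarrow> C + C'" by (intro tendsto_add C)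
  then show ?thesis using C equal rpos_add
    unfolding pord_def by (intro exI[of _ "C + C'"]) (simp add: algebra_simps)
qed

lemma two_powi_sum: "(2::complex) powi (\<Sum>i\<in>A. f i) = (\<Prod>i\<in>A. 2 powi f i)"
  by (induction A rule: infinite_finite_induct) (auto simp: two_powi_add)

lemma monomial_tendsto:
  assumes v: "\<And>i. i < n \<Longrightarrow> (\<lambda>k. v k i * 2 powi (int k * l i)) \<longlonglongrightarrow> C i" "\<And>i. C i \<noteq> 0" and m: "m \<in> expo n"
  shows "(\<lambda>k. monomial m (v k) * 2 powi (int k * epair m l)) \<longlonglongrightarrow> monomial m C"
proof -
  have "monomial m (v k) * 2 powi (int k * epair m l) = (\<Prod>i\<in>keys m. (v k i * 2 powi (int k * l i)) powi lookup m i)" for k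
  proof -
    have "int k * epair m l = (\<Sum>i\<in>keys m. (int k * l i) * lookup m i)"
      by (simp add: epair_def sum_distrib_left mult_ac)
    then show ?thesis
      by (simp add: monomial_def two_powi_sum prod.distrib[symmetric] power_int_mult power_int_mult_distrib)
  qed
  moreover have "(\<lambda>k. \<Prod>i\<in>keys m. (v k i * 2 powi (int k * l i)) powi lookup m i) \<longlonglongrightarrow> (\<Prod>i\<in>keys m. C i powi lookup m i)"
    using m v by (intro tendsto_prod tendsto_power_int) (auto simp: expo_def)
  ultimately show ?thesis by (simp add: monomial_def)
qed

text \<open>After rescaling, the terms off the face of the Newton polytope that minimizes
  \<open>l\<close> decay, and the limit is the initial form of \<open>p\<close> at
  \<open>C\<close>.\<close>

lemma leval_tendsto:
  assumes v: "\<And>i. i < n \<Longrightarrow> (\<lambda>k. v k i * 2 powi (int k * l i)) \<longlonglongrightarrow> C i" "\<And>i. C i \<noteq> 0" and p: "p \<in> laurents n"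
  shows "(\<lambda>k. leval p (v k) * 2 powi (int k * newton_min p l)) \<longlonglongrightarrow>
    (\<Sum>m\<in>{m\<in>keys p. epair m l = newton_min p l}. of_rat (lookup p m) * monomial m C)"
proof -
  let ?M = "newton_min p l" and ?K = "keys p"
  let ?t = "\<lambda>m k. of_rat (lookup p m) * (monomial m (v k) * 2 powi (int k * epair m l)) * 2 powi (- int k * (epair m l - ?M))"
  have "(\<lambda>k. \<Sum>m\<in>?K. ?t m k) \<longlonglongrightarrow>
      (\<Sum>m\<in>?K. if epair m l = ?M then of_rat (lookup p m) * monomial m C else 0)"
  proof (rule tendsto_sum)
    fix m assume m: "m \<in> ?K"
    then have me: "m \<in> expo n" using p by (auto simp: laurents_def)
    have ge: "?M \<le> epair m l" unfolding newton_min_def using m by (intro Min_le) auto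
    note mt = monomial_tendsto[where v = v and l = l and C = C, OF v me]
    show "?t m \<longlonglongrightarrow> (if epair m l = ?M then of_rat (lookup p m) * monomial m C else 0)"
    proof (cases "epair m l = ?M")
      case True
      then show ?thesis using tendsto_mult_left[OF mt] by simp
    next
      case False
      have lt: "?M < epair m l" using False ge by (metis order_le_imp_less_or_eq)
      then have "0 < epair m l - ?M" by (subst diff_gt_0_iff_gt)
      from tendsto_mult[OF tendsto_mult[OF tendsto_const mt] two_powi_tendsto_0[OF this]]
      have "?t m \<longlonglongrightarrow> of_rat (lookup p m) * monomial m C * 0" .
      then show ?thesis using False by simp
    qed
  qed
  moreover have "(\<Sum>m\<in>?K. ?t m k) = leval p (v k) * 2 powi (int k * ?M)" for k
    unfolding leval_def sum_distrib_right
    by (intro sum.cong refl) (simp add: mult.assoc two_powi_add[symmetric] algebra_simps)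
  ultimately show ?thesis by (simp add: sum.inter_filter)
qed

lemma newton_min_attained: "p \<noteq> 0 \<Longrightarrow> \<exists>m\<in>keys p. epair m l = newton_min p l"
proof -
  assume "p \<noteq> 0"
  then have "newton_min p l \<in> (\<lambda>m. epair m l) ` keys p"
    unfolding newton_min_def by (intro Min_in) auto
  then show ?thesis by force
qed

lemma single_nz: "a \<noteq> 0 \<Longrightarrow> single m a \<noteq> 0"
  by (metis lookup_single_eq lookup_zero)

lemma leval_pord:
  assumes v: "\<And>i. i < n \<Longrightarrow> pord (\<lambda>k. v k i) (l i)" and p: "p \<in> laurents n" "nonneg_coeffs p" "p \<noteq> 0"
  shows "pord (\<lambda>k. leval p (v k)) (newton_min p l)"
proof -
  \<comment> \<open>Coordinates from \<open>n\<close> on get the default limit 1, because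
    \<open>leval_tendsto\<close> asks for a nonzero \<open>C i\<close> at every index.\<close>
  have "\<exists>C. rpos C \<and> (i < n \<longrightarrow> (\<lambda>k. v k i * 2 powi (int k * l i)) \<longlonglongrightarrow> C)" for i
    using v[of i] rpos_1 by (cases "i < n") (auto simp: pord_def)
  then obtain C where C: "\<And>i. rpos (C i)" "\<And>i. i < n \<Longrightarrow> (\<lambda>k. v k i * 2 powi (int k * l i)) \<longlonglongrightarrow> C i" by metis
  have "rpos (\<Sum>m\<in>{m\<in>keys p. epair m l = newton_min p l}. of_rat (lookup p m) * monomial m C)"
    using newton_min_attained[OF p(3), of l]
    by (intro rpos_sum rpos_mult rpos_monomial nonneg_coeff_rpos p C) auto
  then show ?thesis unfolding pord_def using leval_tendsto[where v = v and l = l and C = C, OF C(2) rpos_nz[OF C(1)] p(1)] by blast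
qed

lemma monomial_pord:
  assumes "\<And>i. i < n \<Longrightarrow> pord (\<lambda>k. v k i) (l i)" "m \<in> expo n"
  shows "pord (\<lambda>k. monomial m (v k)) (epair m l)"
proof -
  have k: "keys (single m (1::rat)) = {m}" by simp
  have "pord (\<lambda>k. leval (single m 1) (v k)) (newton_min (single m 1) l)"
    using assms by (intro leval_pord[of n]) (auto simp: laurents_closed nonneg_coeffs_def lookup_single when_def single_nz)
  then show ?thesis by (simp add: leval_single newton_min_def)
qed

lemma scal_tendsto: "(\<lambda>k. scal l k z i * 2 powi (int k * l i)) \<longlonglongrightarrow> z i"
  by (simp add: scal_def mult.assoc two_powi_add[symmetric])

text \<open>With coefficients of arbitrary sign the initial form might vanish in the limit. It is
  itself a nonzero Laurent polynomial with rational coefficients, so genericity of \<open>z\<close>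
  forbids this.\<close>

lemma leval_tord:
  assumes z: "z \<in> GP n" and p: "p \<in> laurents n" "p \<noteq> 0"
  shows "tord (\<lambda>k. leval p (scal l k z)) (newton_min p l)"
proof -
  let ?S = "{m\<in>keys p. epair m l = newton_min p l}"
  let ?q = "\<Sum>m\<in>?S. single m (lookup p m)"
  have lk: "lookup ?q m = (if m \<in> ?S then lookup p m else 0)" for m
  proof -
    have "lookup ?q m = (\<Sum>m'\<in>?S. lookup p m' when m' = m)" by (simp add: lookup_sum lookup_single)
    also have "\<dots> = (\<Sum>m'\<in>?S. if m' = m then lookup p m' else 0)" by (simp add: when_def)
    finally show ?thesis by (simp add: sum.delta)
  qed
  obtain m where m: "m \<in> ?S" using newton_min_attained[OF p(2), of l] by blast
  then have "lookup ?q m \<noteq> 0" using lk[of m] by (simp add: in_keys_iff)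
  then have "?q \<noteq> 0" by (metis lookup_zero)
  moreover have "?q \<in> laurents n" using p(1) by (intro laurents_sum laurents_closed) (auto simp: laurents_def)
  ultimately have "leval ?q z \<noteq> 0" using GP_leval[OF z] by blast
  then have "(\<Sum>m\<in>?S. of_rat (lookup p m) * monomial m z) \<noteq> 0" by (simp add: leval_sum leval_single)
  then show ?thesis unfolding tord_def
    using leval_tendsto[where v = "\<lambda>k. scal l k z" and l = l and C = z, OF scal_tendsto Tpts_nz[OF GP_Tpts[OF z]] p(1)] by blast
qed

section \<open>Tropicalization of positive functions and maps\<close>

lemma quotient_tord:
  assumes z: "z \<in> GP n" and l: "l \<in> cochar_lattice n" and h: "is_quotient n p q h" "p \<noteq> 0"
  shows "tord (\<lambda>k. h (scal l k z)) (newton_min p l - newton_min q l)"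
proof -
  have "h (scal l k z) = leval p (scal l k z) / leval q (scal l k z)" for k
    using generic_GP[OF _ scal_GP[OF z l]] h(1) by (auto simp: is_quotient_def)
  then show ?thesis using tord_divide[OF leval_tord[OF z] leval_tord[OF z], of p q l] h by (simp add: is_quotient_def)
qed

text \<open>All quotients that represent \<open>h\<close> have the same order along the same
  sequence, so the description in \<open>trop\<close> has a unique solution.\<close>

lemma trop_eq:
  assumes l: "l \<in> cochar_lattice n" and h: "is_quotient n p q h" "p \<noteq> 0"
  shows "trop n h l = Fin (newton_min p l - newton_min q l)"
proof -
  obtain z where z: "z \<in> GP n" using GP_exists by blast
  have "h z = leval p z / leval q z" using generic_GP[OF _ z] h(1) by (auto simp: is_quotient_def)
  then have "h z \<noteq> 0" using GP_leval[OF z] h by (auto simp: is_quotient_def)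
  then have "\<not> generic (var (torus n)) (\<lambda>z. h z = 0)" using generic_GP[OF _ z] by blast
  moreover have "(THE k. \<exists>p q. p \<noteq> 0 \<and> is_quotient n p q h \<and> k = newton_min p l - newton_min q l) = newton_min p l - newton_min q l"
    using h quotient_tord[OF z l] tord_unique by (intro the_equality) blast+
  ultimately show ?thesis by (simp add: trop_def)
qed

lemma trop_zero: "generic (var (torus n)) (\<lambda>z. h z = 0) \<Longrightarrow> trop n h l = Pinf"
  by (simp add: trop_def)

text \<open>Admissible sequences of generic points approximate the cocharacter \<open>l\<close>.\<close>

definition adm :: "nat \<Rightarrow> (nat \<Rightarrow> int) \<Rightarrow> (nat \<Rightarrow> nat \<Rightarrow> complex) \<Rightarrow> bool" where
  "adm n l v \<longleftrightarrow> (\<forall>k. v k \<in> GP n) \<and> (\<forall>i<n. pord (\<lambda>k. v k i) (l i))"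

lemma adm_scal:
  assumes "z \<in> GP n" "\<And>i. rpos (z i)" "l \<in> cochar_lattice n" shows "adm n l (\<lambda>k. scal l k z)"
  unfolding adm_def pord_def using scal_GP[OF assms(1,3)] scal_tendsto assms(2) by blast

lemma adm_exists: "l \<in> cochar_lattice n \<Longrightarrow> \<exists>v. adm n l v"
  using adm_scal GP_exists by metis

text \<open>One order serves all admissible sequences, not just those of the form
  \<open>scal\<close>: the image of such a sequence under a positive map is usually not of that
  form.\<close>

lemma positive_pord:
  assumes h: "positive n h" and l: "l \<in> cochar_lattice n"
  shows "\<exists>m. trop n h l = Fin m \<and> (\<forall>v. adm n l v \<longrightarrow> pord (\<lambda>k. h (v k)) m)"
proof -
  obtain p q where pq: "p \<noteq> 0" "nonneg_coeffs p" "nonneg_coeffs q" "is_quotient n p q h"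
    using h by (auto simp: positive_def)
  have q: "q \<noteq> 0" "p \<in> laurents n" "q \<in> laurents n" using pq by (auto simp: is_quotient_def)
  have "pord (\<lambda>k. h (v k)) (newton_min p l - newton_min q l)" if v: "adm n l v" for v
  proof -
    have "h (v k) = leval p (v k) / leval q (v k)" for k
      using generic_GP[of n _ "v k"] v pq(4) by (auto simp: is_quotient_def adm_def)
    then show ?thesis
      using pord_divide[OF leval_pord[of n v l p] leval_pord[of n v l q]] v pq q by (simp add: adm_def)
  qed
  then show ?thesis using trop_eq[OF l pq(4,1)] by blast
qed

lemma trop_from_pord:
  assumes "positive n h" "l \<in> cochar_lattice n" "adm n l v" "pord (\<lambda>k. h (v k)) m"
  shows "trop n h l = Fin m"
  using positive_pord[OF assms(1,2)] assms(3,4) pord_unique by blast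

text \<open>The orders of the coordinates of \<open>h\<close> form the tropical image of
  \<open>l\<close>; multiplicativity of orders makes this one vector fit all characters.\<close>

lemma positive_map_pord:
  assumes h: "positive_map n n' h" and l: "l \<in> cochar_lattice n"
  shows "trop_map n n' h l \<in> cochar_lattice n'"
    and "adm n l v \<Longrightarrow> i < n' \<Longrightarrow> pord (\<lambda>k. h (v k) i) (trop_map n n' h l i)"
proof -
  have pos: "positive n (\<lambda>z. monomial m (h z))" if "m \<in> expo n'" for m
    using h that by (simp add: positive_map_def)
  have "\<exists>m. trop n (\<lambda>z. h z i) l = Fin m \<and> (\<forall>v. adm n l v \<longrightarrow> pord (\<lambda>k. h (v k) i) m)" if "i < n'" for i
    using positive_pord[OF pos[OF expo_closed(2)[OF that]] l, of 1] by (simp add: monomial_single)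
  then obtain a where a: "\<And>i. i < n' \<Longrightarrow> trop n (\<lambda>z. h z i) l = Fin (a i)"
    "\<And>i v. i < n' \<Longrightarrow> adm n l v \<Longrightarrow> pord (\<lambda>k. h (v k) i) (a i)" by metis
  define l' where "l' = (\<lambda>i. if i < n' then a i else 0)"
  have l': "l' \<in> cochar_lattice n'" by (simp add: l'_def cochar_lattice_def)
  obtain u where u: "adm n l u" using adm_exists[OF l] by blast
  have t: "trop n (\<lambda>z. monomial m (h z)) l = Fin (epair m l')" if m: "m \<in> expo n'" for m
    by (rule trop_from_pord[OF pos[OF m] l u monomial_pord[OF _ m]]) (use a u in \<open>simp add: l'_def\<close>)
  have "trop_map n n' h l = l'" unfolding trop_map_def
  proof (rule the_equality)
    show "l' \<in> cochar_lattice n' \<and> (\<forall>m\<in>expo n'. trop n (\<lambda>z. monomial m (h z)) l = Fin (epair m l'))"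
      using l' t by blast
    fix l'' assume l'': "l'' \<in> cochar_lattice n' \<and> (\<forall>m\<in>expo n'. trop n (\<lambda>z. monomial m (h z)) l = Fin (epair m l''))"
    show "l'' = l'"
    proof
      fix i show "l'' i = l' i"
      proof (cases "i < n'")
        case True
        then show ?thesis using l'' t expo_closed(2)[OF True, of 1] by (metis epair_single extended.inject(1))
      next
        case False then show ?thesis using l'' l' by (simp add: cochar_lattice_def)
      qed
    qed
  qed
  then show "trop_map n n' h l \<in> cochar_lattice n'"
    and "adm n l v \<Longrightarrow> i < n' \<Longrightarrow> pord (\<lambda>k. h (v k) i) (trop_map n n' h l i)"
    using l' a by (simp_all add: l'_def)
qed

section \<open>Closure properties of positivity\<close>

lemma nonneg_add: "nonneg_coeffs p \<Longrightarrow> nonneg_coeffs q \<Longrightarrow> nonneg_coeffs (p + q)"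
  by (simp add: nonneg_coeffs_def lookup_add)

lemma nonneg_sum_mult:
  assumes "nonneg_coeffs p" "nonneg_coeffs q" shows "nonneg_coeffs (p * q)"
proof -
  have S: "Sum_any f \<in> \<nat>" if "\<And>x. f x \<in> (\<nat>::rat set)" for f :: "'b \<Rightarrow> rat"
  proof -
    have "sum f A \<in> \<nat>" for A
      by (induction A rule: infinite_finite_induct) (auto intro: that Nats_add)
    then show ?thesis by (simp add: Sum_any.expand_set)
  qed
  show ?thesis unfolding nonneg_coeffs_def lookup_mult using assms
    by (intro allI S Nats_mult) (auto simp: nonneg_coeffs_def when_def)
qed

text \<open>At the unit of the torus a nonzero polynomial with nonnegative coefficients takes a
  positive value, so nothing can cancel.\<close>

lemma nonneg_mult_nz:
  assumes "nonneg_coeffs p" "nonneg_coeffs q" "p \<noteq> 0" "q \<noteq> 0" shows "p * q \<noteq> 0"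
proof -
  have "leval (p * q) (\<lambda>_. 1) \<noteq> 0"
    using leval_rpos[of p "\<lambda>_. 1"] leval_rpos[of q "\<lambda>_. 1"] assms rpos_1 rpos_nz
    by (subst leval_mult) auto
  then show ?thesis by auto
qed

lemma nonneg_add_nz:
  assumes "nonneg_coeffs p" "nonneg_coeffs q" "p \<noteq> 0" "q \<noteq> 0" shows "p + q \<noteq> 0"
proof -
  have "rpos (leval p (\<lambda>_. 1) + leval q (\<lambda>_. 1))" using assms rpos_1 by (intro rpos_add leval_rpos) auto
  then have "leval (p + q) (\<lambda>_. 1) \<noteq> 0" by (auto simp: leval_add dest: rpos_nz)
  then show ?thesis by auto
qed

lemma positive_cong:
  assumes "positive n h" "generic (var (torus n)) (\<lambda>z. h' z = h z)" shows "positive n h'"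
proof -
  obtain p q where pq: "p \<noteq> 0" "nonneg_coeffs p" "nonneg_coeffs q" "is_quotient n p q h"
    using assms(1) by (auto simp: positive_def)
  have "generic (var (torus n)) (\<lambda>z. h' z = leval p z / leval q z)"
    using generic_conj[OF assms(2), of "\<lambda>z. h z = leval p z / leval q z"] pq(4)
    by (auto simp: is_quotient_def elim!: generic_mono)
  then have "is_quotient n p q h'" using pq(4) by (simp add: is_quotient_def)
  then show ?thesis unfolding positive_def using pq by blast
qed

lemma positive_generic_nz:
  assumes "positive n h" shows "generic (var (torus n)) (\<lambda>z. h z \<noteq> 0)"
proof -
  obtain p q where pq: "p \<noteq> 0" "is_quotient n p q h" using assms by (auto simp: positive_def)
  then have q: "p \<in> laurents n" "q \<in> laurents n" "q \<noteq> 0" "generic (var (torus n)) (\<lambda>z. h z = leval p z / leval q z)"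
    by (auto simp: is_quotient_def)
  show ?thesis
    using generic_conj[OF q(4) generic_conj[OF generic_leval_nz[OF q(1) pq(1)] generic_leval_nz[OF q(2,3)]]]
    by (rule generic_mono) auto
qed

lemma positive_leval: "p \<in> laurents n \<Longrightarrow> nonneg_coeffs p \<Longrightarrow> p \<noteq> 0 \<Longrightarrow> positive n (leval p)"
proof -
  assume p: "p \<in> laurents n" "nonneg_coeffs p" "p \<noteq> 0"
  have "is_quotient n p 1 (leval p)" unfolding is_quotient_def using p one_laurents
    by (auto intro!: generic_mono[OF generic_Tpts])
  moreover have "nonneg_coeffs 1" by (auto simp: nonneg_coeffs_def lookup_one when_def)
  ultimately show ?thesis unfolding positive_def using p by blast
qed

lemma positive_ops:
  assumes "positive n f" "positive n g"
  shows positive_add: "positive n (\<lambda>z. f z + g z)"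
    and positive_mult: "positive n (\<lambda>z. f z * g z)"
    and positive_divide: "positive n (\<lambda>z. f z / g z)"
proof -
  obtain p q where pq: "p \<noteq> 0" "nonneg_coeffs p" "nonneg_coeffs q" "is_quotient n p q f"
    using assms(1) by (auto simp: positive_def)
  obtain r s where rs: "r \<noteq> 0" "nonneg_coeffs r" "nonneg_coeffs s" "is_quotient n r s g"
    using assms(2) by (auto simp: positive_def)
  have l: "p \<in> laurents n" "q \<in> laurents n" "q \<noteq> 0" "r \<in> laurents n" "s \<in> laurents n" "s \<noteq> 0"
    "generic (var (torus n)) (\<lambda>z. f z = leval p z / leval q z)" "generic (var (torus n)) (\<lambda>z. g z = leval r z / leval s z)"
    using pq(4) rs(4) by (auto simp: is_quotient_def)
  have gen: "generic (var (torus n)) (\<lambda>z. (f z = leval p z / leval q z \<and> g z = leval r z / leval s z) \<and> leval q z \<noteq> 0 \<and> leval s z \<noteq> 0)"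
    by (intro generic_conj l generic_leval_nz)
  have "is_quotient n (p * s + r * q) (q * s) (\<lambda>z. f z + g z)" unfolding is_quotient_def
    using l nonneg_mult_nz[OF pq(3) rs(3)]
    by (auto intro!: laurents_closed generic_mono[OF gen] simp: leval_add leval_mult Tpts_nz torus_simps field_simps)
  moreover have "p * s + r * q \<noteq> 0" using l pq rs by (intro nonneg_add_nz nonneg_mult_nz nonneg_sum_mult)
  ultimately show "positive n (\<lambda>z. f z + g z)" unfolding positive_def using pq rs
    by (meson nonneg_add nonneg_sum_mult)
  have "is_quotient n (p * r) (q * s) (\<lambda>z. f z * g z)" unfolding is_quotient_def
    using l nonneg_mult_nz[OF pq(3) rs(3)]
    by (auto intro!: laurents_closed generic_mono[OF gen] simp: leval_mult Tpts_nz torus_simps field_simps)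
  then show "positive n (\<lambda>z. f z * g z)" unfolding positive_def using pq rs
    by (meson nonneg_sum_mult nonneg_mult_nz)
  have "is_quotient n (p * s) (q * r) (\<lambda>z. f z / g z)" unfolding is_quotient_def
    using l nonneg_mult_nz[OF pq(3) rs(2)] rs
    by (auto intro!: laurents_closed generic_mono[OF gen] simp: leval_mult Tpts_nz torus_simps)
  then show "positive n (\<lambda>z. f z / g z)" unfolding positive_def using pq rs l
    by (meson nonneg_sum_mult nonneg_mult_nz)
qed

lemma positive_const: "a \<in> \<nat> \<Longrightarrow> a \<noteq> 0 \<Longrightarrow> positive n (\<lambda>_. of_rat a)"
proof -
  assume a: "a \<in> \<nat>" "a \<noteq> 0"
  have "positive n (leval (single 0 a))"
    using a by (intro positive_leval laurents_closed expo_closed) (auto simp: nonneg_coeffs_def lookup_single when_def single_nz)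
  then show ?thesis by (rule positive_cong) (auto intro!: generic_mono[OF generic_Tpts] simp: leval_single)
qed

lemma positive_sum:
  "finite J \<Longrightarrow> J \<noteq> {} \<Longrightarrow> (\<And>j. j \<in> J \<Longrightarrow> positive n (f j)) \<Longrightarrow> positive n (\<lambda>z. \<Sum>j\<in>J. f j z)"
proof (induction J rule: finite_ne_induct)
  case (insert j J)
  then have "positive n (\<lambda>z. f j z + (\<Sum>j\<in>J. f j z))" by (intro positive_add) auto
  then show ?case using insert by simp
qed simp

lemma positive_leval_comp:
  assumes "positive_map n n' k" "p \<in> laurents n'" "nonneg_coeffs p" "p \<noteq> 0"
  shows "positive n (\<lambda>z. leval p (k z))"
  unfolding leval_def using assms
  by (intro positive_sum positive_mult positive_const)
     (auto simp: keys_eq_empty nonneg_coeffs_def in_keys_iff laurents_def positive_map_def)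

section \<open>Principal open subsets and toric charts\<close>

lemma princ_open_simps: "pts (princ_open V q) = {x\<in>pts V. q x \<noteq> 0}"
  "g \<in> reg (princ_open V q) \<longleftrightarrow> (\<exists>a\<in>reg V. \<exists>k::nat. \<forall>x\<in>pts V. q x \<noteq> 0 \<longrightarrow> g x = a x / q x ^ k)"
  by (simp_all add: princ_open_def)

lemma princ_open_incl: "r \<in> reg V \<Longrightarrow> r \<in> reg (princ_open V q)"
  unfolding princ_open_simps by (rule bexI[of _ r], rule exI[of _ 0]) auto

lemma fun_alg_princ_open:
  assumes R: "fun_alg \<rat> (pts V) (reg V)" and q: "q \<in> reg V"
  shows "fun_alg \<rat> (pts (princ_open V q)) (reg (princ_open V q))"
proof -
  let ?R = "reg (princ_open V q)"
  note qp = fun_alg_power[OF R _ q]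
  have "(\<lambda>x. f x + g x) \<in> ?R \<and> (\<lambda>x. f x * g x) \<in> ?R" if fg: "f \<in> ?R" "g \<in> ?R" for f g
  proof -
    obtain a k where a: "a \<in> reg V" "\<forall>x\<in>pts V. q x \<noteq> 0 \<longrightarrow> f x = a x / q x ^ k"
      using fg unfolding princ_open_simps by blast
    obtain b l where b: "b \<in> reg V" "\<forall>x\<in>pts V. q x \<noteq> 0 \<longrightarrow> g x = b x / q x ^ l"
      using fg unfolding princ_open_simps by blast
    have "(\<lambda>x. a x * q x ^ l + b x * q x ^ k) \<in> reg V"
      by (intro fun_alg_add[OF R] fun_alg_mult[OF R] a b qp) auto
    moreover have "(\<lambda>x. a x * b x) \<in> reg V" by (intro fun_alg_mult[OF R] a b)
    ultimately show ?thesis unfolding princ_open_simps using a(2) b(2)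
      by (intro conjI bexI[of _ "\<lambda>x. a x * q x ^ l + b x * q x ^ k"] bexI[of _ "\<lambda>x. a x * b x"] exI[of _ "k + l"])
         (auto simp: field_simps power_add)
  qed
  moreover have "(\<lambda>_. c) \<in> ?R" if "c \<in> \<rat>" for c
    using princ_open_incl[OF fun_alg_const[OF R that]] .
  moreover have "g \<in> ?R" if "f \<in> ?R" "\<forall>x\<in>pts (princ_open V q). g x = f x" for f g
    using that unfolding princ_open_simps by auto
  ultimately show ?thesis unfolding fun_alg_def by blast
qed

text \<open>Every factor of \<open>q\<close> becomes invertible where \<open>q\<close> does not
  vanish.\<close>

lemma princ_open_inverse:
  assumes R: "fun_alg \<rat> (pts V) (reg V)" and v: "v \<in> reg V" and uv: "\<And>x. x \<in> pts V \<Longrightarrow> q x = u x * v x"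
  shows "(\<lambda>x. inverse (u x)) \<in> reg (princ_open V q)"
  unfolding princ_open_simps using v uv by (intro bexI[of _ v] exI[of _ 1]) (auto simp: field_simps)

definition chart_pair :: "'z variety \<Rightarrow> 'z chart \<Rightarrow> ((nat \<Rightarrow> complex) \<Rightarrow> complex) \<Rightarrow> ('z \<Rightarrow> complex) \<Rightarrow> bool" where
  "chart_pair Z c q r \<longleftrightarrow> q \<in> regfun (torus (cdim c)) \<and> r \<in> reg Z \<and> cdom c = {z\<in>Tpts (cdim c). q z \<noteq> 0} \<and>
     cdom c \<noteq> {} \<and> zdense Z {x\<in>pts Z. r x \<noteq> 0} (pts Z) \<and>
     isomorphism (princ_open (var (torus (cdim c))) q) (princ_open Z r) (cmap c)"

lemma chartE: "toric_chart Z c \<Longrightarrow> \<exists>q r. chart_pair Z c q r"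
  unfolding toric_chart_def chart_pair_def by blast

lemma chart_pairD:
  assumes "chart_pair Z c q r"
  shows chart_q: "q \<in> regfun (torus (cdim c))"
    and chart_r: "r \<in> reg Z"
    and chart_dom: "cdom c = {z\<in>Tpts (cdim c). q z \<noteq> 0}"
    and chart_ne: "cdom c \<noteq> {}"
    and chart_bij: "bij_betw (cmap c) (cdom c) {x\<in>pts Z. r x \<noteq> 0}"
    and chart_dense: "g \<in> reg Z \<Longrightarrow> (\<And>x. x \<in> pts Z \<Longrightarrow> r x \<noteq> 0 \<Longrightarrow> g x = 0) \<Longrightarrow> x \<in> pts Z \<Longrightarrow> g x = 0"
    and chart_fwd: "h \<in> reg (princ_open Z r) \<Longrightarrow> (\<lambda>z. h (cmap c z)) \<in> reg (princ_open (var (torus (cdim c))) q)"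
    and chart_bwd: "a \<in> reg (princ_open (var (torus (cdim c))) q) \<Longrightarrow>
      (\<lambda>x. a (inv_into (cdom c) (cmap c) x)) \<in> reg (princ_open Z r)"
proof -
  have qr: "q \<in> regfun (torus (cdim c))" "r \<in> reg Z" "cdom c = {z\<in>Tpts (cdim c). q z \<noteq> 0}"
    "cdom c \<noteq> {}" and dense: "zdense Z {x\<in>pts Z. r x \<noteq> 0} (pts Z)"
    and iso: "isomorphism (princ_open (var (torus (cdim c))) q) (princ_open Z r) (cmap c)"
    using assms unfolding chart_pair_def by blast+
  show "q \<in> regfun (torus (cdim c))" "r \<in> reg Z" "cdom c = {z\<in>Tpts (cdim c). q z \<noteq> 0}" "cdom c \<noteq> {}"
    by fact+
  have p: "pts (princ_open (var (torus (cdim c))) q) = cdom c" by (simp add: princ_open_simps torus_simps qr(3))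
  have p2: "pts (princ_open Z r) = {x\<in>pts Z. r x \<noteq> 0}" by (simp add: princ_open_simps)
  show "bij_betw (cmap c) (cdom c) {x\<in>pts Z. r x \<noteq> 0}"
    using iso unfolding isomorphism_def p p2 by simp
  show "(\<lambda>z. h (cmap c z)) \<in> reg (princ_open (var (torus (cdim c))) q)" if "h \<in> reg (princ_open Z r)"
    using iso that unfolding isomorphism_def morphism_def o_def by simp
  show "(\<lambda>x. a (inv_into (cdom c) (cmap c) x)) \<in> reg (princ_open Z r)"
    if "a \<in> reg (princ_open (var (torus (cdim c))) q)"
    using iso that unfolding isomorphism_def morphism_def p o_def by simp
  assume g: "g \<in> reg Z" "\<And>x. x \<in> pts Z \<Longrightarrow> r x \<noteq> 0 \<Longrightarrow> g x = 0" "x \<in> pts Z"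
  have "zclosed Z {x\<in>pts Z. \<forall>h\<in>{g}. h x = 0}" unfolding zclosed_def using g(1) by blast
  moreover have "{x\<in>pts Z. r x \<noteq> 0} \<subseteq> {x\<in>pts Z. \<forall>h\<in>{g}. h x = 0}" using g(2) by auto
  ultimately have "pts Z \<subseteq> {x\<in>pts Z. \<forall>h\<in>{g}. h x = 0}" using dense unfolding zdense_def by simp
  then show "g x = 0" using g(3) by auto
qed

lemma GP_regD: "z \<in> GP n \<Longrightarrow> r \<in> regfun (torus n) \<Longrightarrow> r z = 0 \<Longrightarrow> y \<in> Tpts n \<Longrightarrow> r y = 0"
  using gptD[of z "var (torus n)" r y] by (simp add: torus_simps)

text \<open>If a regular function vanishes at the image of a generic point, its numerator in the
  chart vanishes there, hence on the whole torus; so the function vanishes on a dense open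
  subset.\<close>

lemma chart_GP:
  assumes c: "toric_chart Z c" and z: "z \<in> GP (cdim c)" shows "z \<in> cdom c" "cmap c z \<in> gpt Z"
proof -
  obtain q r where cp: "chart_pair Z c q r" using chartE[OF c] by blast
  note q = chart_pairD(1-5)[OF cp] and dense = chart_dense[OF cp] and fwd = chart_fwd[OF cp]
  have "q z \<noteq> 0" using GP_regD[OF z q(1)] q(3,4) by blast
  then show zd: "z \<in> cdom c" using GP_Tpts[OF z] q(3) by simp
  have "g x = 0" if g: "g \<in> reg Z" "g (cmap c z) = 0" and x: "x \<in> pts Z" for g x
  proof (rule dense[OF g(1) _ x])
    fix y assume y: "y \<in> pts Z" "r y \<noteq> 0"
    then obtain z' where z': "z' \<in> cdom c" "y = cmap c z'" using q(5) unfolding bij_betw_def by blast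
    obtain a k where a: "a \<in> regfun (torus (cdim c))"
      "\<forall>z\<in>Tpts (cdim c). q z \<noteq> 0 \<longrightarrow> g (cmap c z) = a z / q z ^ k"
      using fwd[OF princ_open_incl[OF g(1)]] unfolding princ_open_simps torus_simps by blast
    have "a z = 0" using a(2) zd q(3) g(2) by auto
    then show "g y = 0" using GP_regD[OF z a(1)] a(2) z' q(3) by auto
  qed
  moreover have "cmap c z \<in> pts Z" using bij_betwE[OF q(5)] zd by blast
  ultimately show "cmap c z \<in> gpt Z" unfolding gpt_def by blast
qed

text \<open>The converse of \<open>chart_GP\<close> runs through the inverse chart: a function on
  the torus vanishing at the preimage of \<open>x\<close> has a numerator on \<open>Z\<close> that
  vanishes identically. Hence it vanishes at a generic point \<open>\<zeta>\<close> of the torus,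
  and so everywhere.\<close>

lemma chart_gpt:
  assumes c: "toric_chart Z c" and x: "x \<in> gpt Z"
  shows "\<exists>z\<in>GP (cdim c). z \<in> cdom c \<and> cmap c z = x"
proof -
  obtain q r where cp: "chart_pair Z c q r" using chartE[OF c] by blast
  note q = chart_pairD(1-5)[OF cp] and bwd = chart_bwd[OF cp]
  let ?inv = "inv_into (cdom c) (cmap c)"
  obtain y0 where "y0 \<in> cdom c" using q(4) by blast
  then have "cmap c y0 \<in> pts Z" "r (cmap c y0) \<noteq> 0" using bij_betwE[OF q(5)] by blast+
  then have rx: "r x \<noteq> 0" using gptD[OF x q(2)] by blast
  have xZ: "x \<in> pts Z" using x by (simp add: gpt_def)
  have img: "cmap c ` cdom c = {x\<in>pts Z. r x \<noteq> 0}" using q(5) by (simp add: bij_betw_def)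
  then have xi: "x \<in> cmap c ` cdom c" using rx xZ by blast
  have z: "?inv x \<in> cdom c" "cmap c (?inv x) = x" using inv_into_into[OF xi] f_inv_into_f[OF xi] by auto
  obtain \<zeta> where \<zeta>: "\<zeta> \<in> GP (cdim c)" using GP_exists by blast
  have q\<zeta>: "q \<zeta> \<noteq> 0" using GP_regD[OF \<zeta> q(1)] q(3,4) by blast
  have "a y = 0" if a: "a \<in> regfun (torus (cdim c))" "a (?inv x) = 0" and y: "y \<in> Tpts (cdim c)" for a y
  proof -
    have "a \<in> reg (princ_open (var (torus (cdim c))) q)" using a by (intro princ_open_incl) (simp add: torus_simps)
    from bwd[OF this] obtain b k where b: "b \<in> reg Z" "\<forall>x\<in>pts Z. r x \<noteq> 0 \<longrightarrow> a (?inv x) = b x / r x ^ k"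
      unfolding princ_open_simps by blast
    have "b x = 0" using b(2) xZ rx a(2) by auto
    then have bz: "b x = 0" if "x \<in> pts Z" for x using gptD[OF x b(1) _ that] by blast
    have \<zeta>d: "\<zeta> \<in> cdom c" using q\<zeta> q(3) GP_Tpts[OF \<zeta>] by blast
    then have "?inv (cmap c \<zeta>) = \<zeta>" using q(5) by (simp add: bij_betw_def)
    moreover have "cmap c \<zeta> \<in> pts Z" "r (cmap c \<zeta>) \<noteq> 0" using bij_betwE[OF q(5)] \<zeta>d by blast+
    ultimately have "a \<zeta> = 0" using b(2) bz by force
    then show ?thesis using GP_regD[OF \<zeta> a(1) _ y] by blast
  qed
  then have "?inv x \<in> GP (cdim c)" using z(1) q(3) by (auto simp: gpt_def torus_simps)
  then show ?thesis using z by blast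
qed

lemma generic_gpt:
  assumes "generic Z A" "x \<in> gpt Z" and R: "fun_alg k (pts Z) (reg Z)" "1 \<in> k" shows "A x"
proof -
  obtain q where q: "q \<in> reg Z" "zdense Z {x\<in>pts Z. q x \<noteq> 0} (pts Z)" "\<forall>x\<in>pts Z. q x \<noteq> 0 \<longrightarrow> A x"
    using assms(1) by (auto simp: generic_def)
  have xZ: "x \<in> pts Z" using assms(2) by (simp add: gpt_def)
  have "q x \<noteq> 0"
  proof
    assume 0: "q x = 0"
    have cl: "zclosed Z {}"
      unfolding zclosed_def by (rule exI[of _ "{\<lambda>_. 1}"]) (simp add: fun_alg_const[OF R])
    have "{y\<in>pts Z. q y \<noteq> 0} \<subseteq> {}" using gptD[OF assms(2) q(1) 0] by simp
    moreover have "zclosed Z {} \<longrightarrow> {y\<in>pts Z. q y \<noteq> 0} \<subseteq> {} \<longrightarrow> pts Z \<subseteq> {}"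
      using q(2) unfolding zdense_def by (elim conjE allE)
    ultimately have "pts Z \<subseteq> {}" using cl by simp
    then show False using xZ by simp
  qed
  then show ?thesis using q(3) xZ by blast
qed

text \<open>The quotient has to represent \<open>K\<close> at every point of the chart domain, not
  just generically. This is the regularity that makes composites well defined.\<close>

definition regdom :: "'z chart \<Rightarrow> ('z \<Rightarrow> complex) \<Rightarrow> bool" where
  "regdom c K \<longleftrightarrow> (\<exists>a\<in>regfun (torus (cdim c)). \<exists>q\<in>regfun (torus (cdim c)).
     \<forall>z\<in>cdom c. z \<in> Tpts (cdim c) \<and> q z \<noteq> 0 \<and> K (cmap c z) = a z / q z)"

lemma chart_regdom:
  assumes c: "toric_chart Z c" and K: "K \<in> reg Z" shows "regdom c K"
proof -
  obtain q r where cp: "chart_pair Z c q r" using chartE[OF c] by blast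
  note q = chart_q[OF cp] chart_dom[OF cp] and fwd = chart_fwd[OF cp]
  obtain a k where a: "a \<in> regfun (torus (cdim c))"
    "\<forall>z\<in>Tpts (cdim c). q z \<noteq> 0 \<longrightarrow> K (cmap c z) = a z / q z ^ k"
    using fwd[OF princ_open_incl[OF K]] unfolding princ_open_simps torus_simps by blast
  have "(\<lambda>z. q z ^ k) \<in> regfun (torus (cdim c))" using fun_alg_power[OF fun_alg_torus _ q(1)] by simp
  then show ?thesis unfolding regdom_def using a q(2)
    by (intro bexI[of _ a] bexI[of _ "\<lambda>z. q z ^ k"]) auto
qed

text \<open>
  A composite of positive rational maps need not be defined, unless the outer one is regular at the
  image: the denominator of its positive expression cannot vanish there identically.
\<close>

lemma regdom_positive_comp:
  assumes K: "regdom c K" "positive (cdim c) (\<lambda>z. K (cmap c z))" and GP: "\<And>z. z \<in> GP (cdim c) \<Longrightarrow> z \<in> cdom c"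
    and k: "positive_map n (cdim c) k" "generic (var (torus n)) (\<lambda>z. k z \<in> cdom c)"
  shows "positive n (\<lambda>z. K (cmap c (k z)))"
proof -
  let ?d = "cdim c"
  obtain \<zeta> where \<zeta>: "\<zeta> \<in> GP ?d" using GP_exists by blast
  obtain a q where aq: "a \<in> regfun (torus ?d)" "q \<in> regfun (torus ?d)"
    "\<And>z. z \<in> cdom c \<Longrightarrow> z \<in> Tpts ?d \<and> q z \<noteq> 0 \<and> K (cmap c z) = a z / q z" using K(1) by (auto simp: regdom_def)
  obtain p r where pr: "p \<noteq> 0" "nonneg_coeffs p" "nonneg_coeffs r" "is_quotient ?d p r (\<lambda>z. K (cmap c z))"
    using K(2) by (auto simp: positive_def)
  then have l: "p \<in> laurents ?d" "r \<in> laurents ?d" "r \<noteq> 0"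
    "generic (var (torus ?d)) (\<lambda>z. K (cmap c z) = leval p z / leval r z)" by (auto simp: is_quotient_def)
  \<comment> \<open>The two quotients for \<open>K\<close> agree at a generic point; after
    cross-multiplication they agree on the whole torus, in particular at values of
    \<open>k\<close>.\<close>
  have "(\<lambda>z. a z * leval r z - leval p z * q z) \<in> regfun (torus ?d)"
    by (intro fun_alg_diff[OF fun_alg_torus] fun_alg_mult[OF fun_alg_torus] aq leval_reg l) auto
  moreover have "a \<zeta> * leval r \<zeta> - leval p \<zeta> * q \<zeta> = 0"
  proof -
    have "leval r \<zeta> \<noteq> 0" using GP_leval[OF \<zeta> l(2)] l(3) by blast
    moreover have q\<zeta>: "q \<zeta> \<noteq> 0" and "K (cmap c \<zeta>) = a \<zeta> / q \<zeta>" using aq(3)[OF GP[OF \<zeta>]] by auto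
    moreover have "K (cmap c \<zeta>) = leval p \<zeta> / leval r \<zeta>" using generic_GP[OF l(4) \<zeta>] .
    ultimately have "leval p \<zeta> * q \<zeta> = a \<zeta> * leval r \<zeta>" using frac_eq_eq by metis
    then show ?thesis by simp
  qed
  ultimately have "a y * leval r y - leval p y * q y = 0" if "y \<in> Tpts ?d" for y
    using GP_regD[OF \<zeta> _ _ that, of "\<lambda>z. a z * leval r z - leval p z * q z"] by blast
  then have eq: "K (cmap c y) = leval p y / leval r y" if "y \<in> cdom c" "leval r y \<noteq> 0" for y
    using aq(3)[OF that(1)] that(2) by (simp add: field_simps)
  have pos: "positive n (\<lambda>z. leval p (k z))" "positive n (\<lambda>z. leval r (k z))"
    using positive_leval_comp[OF k(1)] l pr by auto
  show ?thesis
    by (rule positive_cong[OF positive_divide[OF pos]],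
        rule generic_mono[OF generic_conj[OF k(2) positive_generic_nz[OF pos(2)]]]) (use eq in auto)
qed

lemma positive_in_chartsD:
  assumes "positive_in_charts c c' g"
  shows "positive_map (cdim c) (cdim c') (chart_expr c c' g)"
    and "generic (var (torus (cdim c))) (\<lambda>z. z \<in> cdom c \<and> g (cmap c z) = cmap c' (chart_expr c c' g z) \<and> chart_expr c c' g z \<in> cdom c')"
proof -
  show "positive_map (cdim c) (cdim c') (chart_expr c c' g)" using assms by (simp add: positive_in_charts_def)
  have "generic (var (torus (cdim c))) (\<lambda>z. z \<in> cdom c \<and> g (cmap c z) \<in> cmap c' ` cdom c')"
    using assms by (simp add: positive_in_charts_def meets_def)
  then show "generic (var (torus (cdim c))) (\<lambda>z. z \<in> cdom c \<and> g (cmap c z) = cmap c' (chart_expr c c' g z) \<and> chart_expr c c' g z \<in> cdom c')"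
    by (rule generic_mono) (auto simp: chart_expr_def f_inv_into_f inv_into_into)
qed

lemma pos_transfer:
  assumes "regdom c' K" "positive (cdim c') (\<lambda>z. K (cmap c' z))" "\<And>z. z \<in> GP (cdim c') \<Longrightarrow> z \<in> cdom c'"
    and g: "positive_in_charts c c' g"
  shows "positive (cdim c) (\<lambda>z. K (g (cmap c z)))"
proof -
  note gD = positive_in_chartsD[OF g]
  have "positive (cdim c) (\<lambda>z. K (cmap c' (chart_expr c c' g z)))"
    by (rule regdom_positive_comp[OF assms(1-3) gD(1)]) (auto intro: generic_mono[OF gD(2)])
  then show ?thesis by (rule positive_cong) (auto intro: generic_mono[OF gD(2)])
qed

lemma chart_class_refl:
  assumes "toric_chart Z c" shows "c \<in> chart_class Z c"
proof -
  obtain q r where cp: "chart_pair Z c q r" using chartE[OF assms] by blast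
  note q = chart_q[OF cp] chart_dom[OF cp] chart_ne[OF cp] and bij = chart_bij[OF cp]
  obtain p where p: "p \<in> laurents (cdim c)" "\<forall>z\<in>Tpts (cdim c). q z = leval p z" using reg_torus_leval[OF q(1)] by blast
  have "p \<noteq> 0" using q(2,3) p by auto
  then have g: "generic (var (torus (cdim c))) (\<lambda>z. z \<in> cdom c)"
    unfolding generic_torus_iff using p q(2) by (intro bexI[of _ p]) auto
  have inv: "chart_expr c c (\<lambda>x. x) z = z" if "z \<in> cdom c" for z
    using bij that by (simp add: chart_expr_def bij_betw_def)
  have "positive (cdim c) (\<lambda>z. monomial m (chart_expr c c (\<lambda>x. x) z))" if m: "m \<in> expo (cdim c)" for m
  proof -
    have "positive (cdim c) (leval (single m 1))"
      using m by (intro positive_leval laurents_closed) (auto simp: nonneg_coeffs_def lookup_single when_def single_nz)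
    then show ?thesis by (rule positive_cong) (auto intro!: generic_mono[OF g] simp: inv leval_single)
  qed
  moreover have "generic (var (torus (cdim c))) (\<lambda>z. chart_expr c c (\<lambda>x. x) z \<in> Tpts (cdim c))"
    by (rule generic_mono[OF g]) (use inv q(2) in auto)
  moreover have "meets c c (\<lambda>x. x)" unfolding meets_def by (rule generic_mono[OF g]) auto
  ultimately show ?thesis using assms by (simp add: chart_class_def chart_equiv_def positive_in_charts_def positive_map_def)
qed

section \<open>Product charts and split tori\<close>

lemma Gm_simps: "pts (var Gm) = {z. z \<noteq> 0}" "reg (var Gm) = funs_on \<rat> {z. z \<noteq> 0} {\<lambda>z. z, inverse}"
  by (simp_all add: var_def Gm_def)

lemma prod_gens:
  "g \<in> reg V \<Longrightarrow> (\<lambda>z. g (fst z)) \<in> reg (prod_var V W)" "h \<in> reg W \<Longrightarrow> (\<lambda>z. h (snd z)) \<in> reg (prod_var V W)"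
proof -
  assume "g \<in> reg V"
  then have "g \<circ> fst \<in> reg (prod_var V W)" unfolding prod_var_def by (auto intro!: gen_in_funs_on)
  then show "(\<lambda>z. g (fst z)) \<in> reg (prod_var V W)" by (simp add: o_def)
next
  assume "h \<in> reg W"
  then have "h \<circ> snd \<in> reg (prod_var V W)" unfolding prod_var_def by (auto intro!: gen_in_funs_on)
  then show "(\<lambda>z. h (snd z)) \<in> reg (prod_var V W)" by (simp add: o_def)
qed

lemma prod_var_pts: "pts (prod_var V W) = pts V \<times> pts W"
  by (simp add: prod_var_def)

lemma fun_alg_prod_var: "fun_alg \<rat> (pts (prod_var V W)) (reg (prod_var V W))"
  by (simp add: prod_var_def fun_alg_funs_on)

lemma prod_var_comp:
  assumes R: "fun_alg \<rat> S R" and \<psi>: "\<And>x. x \<in> S \<Longrightarrow> \<psi> x \<in> pts V" "\<And>x. x \<in> S \<Longrightarrow> \<theta> x \<in> pts W"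
    and gens: "\<And>g. g \<in> reg V \<Longrightarrow> (\<lambda>x. g (\<psi> x)) \<in> R" "\<And>h. h \<in> reg W \<Longrightarrow> (\<lambda>x. h (\<theta> x)) \<in> R"
    and f: "f \<in> reg (prod_var V W)"
  shows "(\<lambda>x. f (\<psi> x, \<theta> x)) \<in> R"
proof (rule funs_on_comp[OF R, where \<psi> = "\<lambda>x. (\<psi> x, \<theta> x)" and g = f and S' = "pts V \<times> pts W"
      and F = "{g \<circ> fst | g. g \<in> reg V} \<union> {g \<circ> snd | g. g \<in> reg W}"])
  show "f \<in> funs_on \<rat> (pts V \<times> pts W) ({g \<circ> fst | g. g \<in> reg V} \<union> {g \<circ> snd | g. g \<in> reg W})"
    using f by (simp add: prod_var_def)
  show "(\<psi> x, \<theta> x) \<in> pts V \<times> pts W" if "x \<in> S" for x using \<psi> that by simp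
  fix f' assume "f' \<in> {g \<circ> fst | g. g \<in> reg V} \<union> {g \<circ> snd | g. g \<in> reg W}"
  then consider g where "g \<in> reg V" "f' = g \<circ> fst" | g where "g \<in> reg W" "f' = g \<circ> snd" by blast
  then show "(\<lambda>x. f' (\<psi> x, \<theta> x)) \<in> R" by cases (simp_all add: gens)
qed

lemma Gm_comp:
  assumes R: "fun_alg \<rat> S R" and \<psi>: "\<And>x. x \<in> S \<Longrightarrow> \<psi> x \<noteq> 0" "\<psi> \<in> R" "(\<lambda>x. inverse (\<psi> x)) \<in> R"
    and f: "f \<in> reg (var Gm)"
  shows "(\<lambda>x. f (\<psi> x)) \<in> R"
proof (rule funs_on_comp[OF R, where \<psi> = \<psi> and g = f and S' = "{z. z \<noteq> 0}" and F = "{\<lambda>z. z, inverse}"])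
  show "f \<in> funs_on \<rat> {z. z \<noteq> 0} {\<lambda>z. z, inverse}" using f by (simp add: Gm_simps)
  show "(\<lambda>x. h (\<psi> x)) \<in> R" if h: "h \<in> {\<lambda>z. z, inverse}" for h
  proof -
    consider "h = (\<lambda>z. z)" | "h = inverse" using h by blast
    then show ?thesis by cases (simp_all only: \<psi>(2,3))
  qed
  show "\<psi> x \<in> {z. z \<noteq> 0}" if "x \<in> S" for x using \<psi>(1)[OF that] by simp
qed

text \<open>The functions of Laurent type form an algebra that contains the pullbacks of generators
  from both factors, so \<open>prod_var_comp\<close> applies with this algebra in place of a
  coordinate ring.\<close>

lemma prod_Gm_laurent_over:
  assumes R: "fun_alg \<rat> (pts Z) (reg Z)" and g: "g \<in> reg (prod_var (var Gm) Z)"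
  shows "laurent_over Z g"
proof -
  let ?S = "{z. z \<noteq> 0} \<times> pts Z"
  note A = R Rats_0 Rats_1
  have alg: "fun_alg \<rat> ?S {h. laurent_over Z h}"
  proof -
    have "laurent_over Z h'" if h: "laurent_over Z h" "\<forall>x\<in>?S. h' x = h x" for h h'
    proof -
      obtain N P where P: "\<And>j. (\<lambda>x. poly.coeff (P x) j) \<in> reg Z"
        "\<And>c x. c \<noteq> 0 \<Longrightarrow> x \<in> pts Z \<Longrightarrow> c ^ N * h (c, x) = poly (P x) c"
        using h(1) unfolding laurent_over_def by metis
      show ?thesis by (rule laurent_overI[of P, OF P(1)]) (use P(2) h(2) in auto)
    qed
    moreover have "laurent_over Z (\<lambda>_. a)" if "a \<in> \<rat>" for a
      using laurent_over_reg[OF A fun_alg_const[OF R that]] .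
    ultimately show ?thesis unfolding fun_alg_def mem_Collect_eq Ball_Collect
      using laurent_over_add[OF A] laurent_over_mult[OF A] by (intro conjI ballI allI impI) auto
  qed
  have "(\<lambda>x. g (fst x, snd x)) \<in> {h. laurent_over Z h}"
  proof (rule prod_var_comp[OF alg _ _ _ _ g])
    have "fst \<in> {h. laurent_over Z h}" "(\<lambda>x. inverse (fst x)) \<in> {h. laurent_over Z h}"
      using laurent_over_id[OF A] laurent_over_inv[OF A] by simp_all
    then show "(\<lambda>x. h (fst x)) \<in> {h. laurent_over Z h}" if "h \<in> reg (var Gm)" for h
      by (rule Gm_comp[OF alg, rotated]) (use that in auto)
    show "(\<lambda>x. h (snd x)) \<in> {h. laurent_over Z h}" if "h \<in> reg Z" for h
      using laurent_over_reg[OF A that] by simp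
  qed (auto simp: Gm_simps)
  then show ?thesis by simp
qed

lemma drop_princ_open:
  assumes "s \<in> reg (princ_open (var (torus d)) q)"
  shows "(\<lambda>w. s (\<lambda>i. w (Suc i))) \<in> reg (princ_open (var (torus (Suc d))) (\<lambda>w. q (\<lambda>i. w (Suc i))))"
proof -
  obtain a k where a: "a \<in> regfun (torus d)" "\<forall>x\<in>Tpts d. q x \<noteq> 0 \<longrightarrow> s x = a x / q x ^ k"
    using assms unfolding princ_open_simps torus_simps by blast
  show ?thesis unfolding princ_open_simps torus_simps
    by (rule bexI[OF _ drop_reg[OF a(1)]], rule exI[of _ k]) (use a(2) in \<open>auto simp: Tpts_Suc\<close>)
qed

lemma snd_princ_open:
  assumes "s \<in> reg (princ_open Z r)"
  shows "(\<lambda>z. s (snd z)) \<in> reg (princ_open (prod_var V Z) (\<lambda>z. r (snd z)))"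
proof -
  obtain a k where a: "a \<in> reg Z" "\<forall>x\<in>pts Z. r x \<noteq> 0 \<longrightarrow> s x = a x / r x ^ k"
    using assms unfolding princ_open_simps by blast
  show ?thesis unfolding princ_open_simps
    by (rule bexI[OF _ prod_gens(2)[OF a(1)]], rule exI[of _ k]) (use a(2) in \<open>auto simp: prod_var_pts\<close>)
qed

lemma pc_simps:
  "cdim (prod_chart gm_chart c) = Suc (cdim c)"
  "cmap (prod_chart gm_chart c) = (\<lambda>w. (w 0, cmap c (\<lambda>i. w (Suc i))))"
  "cdom (prod_chart gm_chart c) = {w. w 0 \<noteq> 0 \<and> (\<lambda>i. w (Suc i)) \<in> cdom c \<and> w \<in> Tpts (Suc (cdim c))}"
  by (auto simp: prod_chart_def gm_chart_def take_coords_def drop_coords_def Tpts_Suc fun_eq_iff)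
     (auto simp: Tpts_def)

lemma princ_open_one: "fun_alg \<rat> (pts V) (reg V) \<Longrightarrow> g \<in> reg (princ_open V (\<lambda>_. 1)) \<Longrightarrow> g \<in> reg V"
  unfolding princ_open_simps by (auto intro: fun_alg_cong)

lemma princ_open_comp:
  assumes R: "fun_alg \<rat> S R" and \<psi>: "\<And>x. x \<in> S \<Longrightarrow> \<psi> x \<in> pts V \<and> q (\<psi> x) \<noteq> 0"
    and gens: "\<And>a. a \<in> reg V \<Longrightarrow> (\<lambda>x. a (\<psi> x)) \<in> R" "(\<lambda>x. inverse (q (\<psi> x))) \<in> R"
    and g: "g \<in> reg (princ_open V q)"
  shows "(\<lambda>x. g (\<psi> x)) \<in> R"
proof -
  obtain a k where a: "a \<in> reg V" "\<forall>x\<in>pts V. q x \<noteq> 0 \<longrightarrow> g x = a x / q x ^ k"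
    using g unfolding princ_open_simps by blast
  have "(\<lambda>x. a (\<psi> x) * inverse (q (\<psi> x)) ^ k) \<in> R"
    by (intro fun_alg_mult[OF R] fun_alg_power[OF R] gens a) simp
  then show ?thesis by (rule fun_alg_cong[OF R]) (use a(2) \<psi> in \<open>simp add: divide_inverse power_inverse\<close>)
qed

lemma torus_comp:
  assumes R: "fun_alg \<rat> S R" and \<psi>: "\<And>x. x \<in> S \<Longrightarrow> \<psi> x \<in> Tpts n"
    and gens: "\<And>i. i < n \<Longrightarrow> (\<lambda>x. \<psi> x i) \<in> R" "\<And>i. i < n \<Longrightarrow> (\<lambda>x. inverse (\<psi> x i)) \<in> R"
    and f: "f \<in> regfun (torus n)"
  shows "(\<lambda>x. f (\<psi> x)) \<in> R"
proof (rule funs_on_comp[OF R, where \<psi> = \<psi> and g = f and S' = "Tpts n" and F = "torus_gens n"])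
  show "f \<in> funs_on \<rat> (Tpts n) (torus_gens n)" using f by (simp add: regfun_torus)
  fix h :: "(nat \<Rightarrow> complex) \<Rightarrow> complex" assume "h \<in> torus_gens n"
  then consider i where "i < n" "h = (\<lambda>z. z i)" | i where "i < n" "h = (\<lambda>z. inverse (z i))" by blast
  then show "(\<lambda>x. h (\<psi> x)) \<in> R" by cases (simp_all add: gens)
qed (rule \<psi>)

text \<open>Positivity of the operators is formulated for charts of the product structure, so the
  product of the standard chart with \<open>c\<close> must be known to be one. The delicate point is
  the density of its image, which \<open>laurent_over_zero\<close> reduces, one coefficient at a
  time, to the density for \<open>c\<close>.\<close>

lemma prod_chart_toric:
  assumes c: "toric_chart Z c" and Z: "fun_alg \<rat> (pts Z) (reg Z)"
  shows "toric_chart (prod_var (var Gm) Z) (prod_chart gm_chart c)"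
proof -
  let ?d = "cdim c" and ?pc = "prod_chart gm_chart c" and ?W = "prod_var (var Gm) Z"
  obtain q r where cp: "chart_pair Z c q r" using chartE[OF c] by blast
  note bij = chart_bij[OF cp]
  define q' where "q' = (\<lambda>w :: nat \<Rightarrow> complex. q (\<lambda>i. w (Suc i)))"
  define r' where "r' = (\<lambda>z :: complex \<times> 'a. r (snd z))"
  let ?inv = "inv_into (cdom c) (cmap c)"
  have q': "q' \<in> regfun (torus (Suc ?d))" unfolding q'_def by (rule drop_reg[OF chart_q[OF cp]])
  have r': "r' \<in> reg ?W" unfolding r'_def by (rule prod_gens(2)[OF chart_r[OF cp]])
  have dom: "cdom ?pc = {z\<in>Tpts (Suc ?d). q' z \<noteq> 0}"
    by (auto simp: pc_simps q'_def chart_dom[OF cp] Tpts_Suc)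
  have pts': "pts ?W = {z. z \<noteq> 0} \<times> pts Z" by (simp add: prod_var_pts Gm_simps)
  let ?V1 = "princ_open (var (torus (Suc ?d))) q'" and ?V2 = "princ_open ?W r'"
  have p1: "pts ?V1 = cdom ?pc" by (simp add: princ_open_simps torus_simps dom)
  have p2: "pts ?V2 = {z\<in>pts ?W. r' z \<noteq> 0}" by (simp add: princ_open_simps)
  have cm: "cmap c z \<in> pts Z \<and> r (cmap c z) \<noteq> 0" if "z \<in> cdom c" for z using bij_betwE[OF bij] that by blast
  have img: "cmap c ` cdom c = {x\<in>pts Z. r x \<noteq> 0}" using bij by (simp add: bij_betw_def)
  have iv: "?inv x \<in> cdom c \<and> cmap c (?inv x) = x" if "x \<in> pts Z" "r x \<noteq> 0" for x
  proof -
    have "x \<in> cmap c ` cdom c" using img that by blast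
    then show ?thesis using inv_into_into f_inv_into_f by metis
  qed
  have ivc: "?inv (cmap c z) = z" if "z \<in> cdom c" for z using bij that by (simp add: bij_betw_def)
  have bij': "bij_betw (cmap ?pc) (pts ?V1) (pts ?V2)"
    unfolding p1 p2
  proof (rule bij_betw_byWitness[where f' = "\<lambda>(a, x). case_nat a (?inv x)"])
    show "\<forall>w\<in>cdom ?pc. (case cmap ?pc w of (a, x) \<Rightarrow> case_nat a (?inv x)) = w"
      using ivc by (auto simp: pc_simps case_nat_eta)
    show "\<forall>z\<in>{z\<in>pts ?W. r' z \<noteq> 0}. cmap ?pc (case z of (a, x) \<Rightarrow> case_nat a (?inv x)) = z"
      using iv by (auto simp: pc_simps pts' r'_def)
    show "cmap ?pc ` cdom ?pc \<subseteq> {z\<in>pts ?W. r' z \<noteq> 0}" using cm by (auto simp: pc_simps pts' r'_def)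
    show "(\<lambda>(a, x). case_nat a (?inv x)) ` {z\<in>pts ?W. r' z \<noteq> 0} \<subseteq> cdom ?pc"
      using iv by (auto simp: pc_simps pts' r'_def chart_dom[OF cp])
  qed
  have inv': "inv_into (pts ?V1) (cmap ?pc) z = case_nat (fst z) (?inv (snd z))" if "z \<in> pts ?V2" for z
  proof (rule inv_into_f_eq)
    show "inj_on (cmap ?pc) (pts ?V1)" using bij' by (simp add: bij_betw_def)
    have z: "fst z \<noteq> 0" "snd z \<in> pts Z" "r (snd z) \<noteq> 0" using that unfolding p2 by (auto simp: pts' r'_def)
    show "case_nat (fst z) (?inv (snd z)) \<in> pts ?V1"
      using iv[OF z(2,3)] z by (auto simp: p1 pc_simps chart_dom[OF cp])
    show "cmap ?pc (case_nat (fst z) (?inv (snd z))) = z" using iv[OF z(2,3)] by (simp add: pc_simps)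
  qed
  have R1: "fun_alg \<rat> (pts ?V1) (reg ?V1)"
    by (rule fun_alg_princ_open) (use q' fun_alg_torus in \<open>simp_all add: torus_simps\<close>)
  have R2: "fun_alg \<rat> (pts ?V2) (reg ?V2)" by (rule fun_alg_princ_open[OF fun_alg_prod_var r'])
  have fwd: "(\<lambda>w. h (cmap c (\<lambda>i. w (Suc i)))) \<in> reg ?V1" if "h \<in> reg (princ_open Z r)" for h
    using drop_princ_open[OF chart_fwd[OF cp that]] unfolding q'_def .
  have bwd: "(\<lambda>z. a (?inv (snd z))) \<in> reg ?V2" if "a \<in> reg (princ_open (var (torus ?d)) q)" for a
    using snd_princ_open[OF chart_bwd[OF cp that]] unfolding r'_def .
  have w0: "(\<lambda>w. w 0) \<in> reg ?V1" "(\<lambda>w. inverse (w 0)) \<in> reg ?V1"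
    using coord_reg[of 0 "Suc ?d"] by (auto intro!: princ_open_incl simp: torus_simps)
  have f1: "g \<circ> cmap ?pc \<in> reg ?V1" if "g \<in> reg ?V2" for g
  proof -
    have "(\<lambda>w. g (w 0, cmap c (\<lambda>i. w (Suc i)))) \<in> reg ?V1"
    proof (rule princ_open_comp[OF R1 _ _ _ that, where \<psi> = "\<lambda>w. (w 0, cmap c (\<lambda>i. w (Suc i)))"])
      show "(w 0, cmap c (\<lambda>i. w (Suc i))) \<in> pts ?W \<and> r' (w 0, cmap c (\<lambda>i. w (Suc i))) \<noteq> 0" if "w \<in> pts ?V1" for w
        using that cm by (simp add: p1 pc_simps pts' r'_def)
      show "(\<lambda>w. a (w 0, cmap c (\<lambda>i. w (Suc i)))) \<in> reg ?V1" if a: "a \<in> reg ?W" for a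
      proof (rule prod_var_comp[OF R1 _ _ _ _ a])
        show "w 0 \<in> pts (var Gm)" "cmap c (\<lambda>i. w (Suc i)) \<in> pts Z" if "w \<in> pts ?V1" for w
          using that cm by (simp_all add: p1 pc_simps Gm_simps)
        show "(\<lambda>w. g (w 0)) \<in> reg ?V1" if "g \<in> reg (var Gm)" for g
          by (rule Gm_comp[OF R1 _ w0 that]) (simp add: p1 pc_simps)
        show "(\<lambda>w. h (cmap c (\<lambda>i. w (Suc i)))) \<in> reg ?V1" if "h \<in> reg Z" for h
          by (rule fwd[OF princ_open_incl[OF that]])
      qed
      have "(\<lambda>x. inverse (r x)) \<in> reg (princ_open Z r)"
        by (rule princ_open_inverse[OF Z fun_alg_const[OF Z Rats_1]]) simp
      from fwd[OF this] show "(\<lambda>w. inverse (r' (w 0, cmap c (\<lambda>i. w (Suc i))))) \<in> reg ?V1" by (simp add: r'_def)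
    qed
    then show ?thesis by (simp add: pc_simps o_def)
  qed
  have f2: "g \<circ> inv_into (pts ?V1) (cmap ?pc) \<in> reg ?V2" if "g \<in> reg ?V1" for g
  proof -
    have "(\<lambda>z. g (case_nat (fst z) (?inv (snd z)))) \<in> reg ?V2"
    proof (rule princ_open_comp[OF R2 _ _ _ that, where \<psi> = "\<lambda>z. case_nat (fst z) (?inv (snd z))"])
      show "case_nat (fst z) (?inv (snd z)) \<in> pts (var (torus (Suc ?d))) \<and> q' (case_nat (fst z) (?inv (snd z))) \<noteq> 0"
        if "z \<in> pts ?V2" for z
      proof -
        have z: "fst z \<noteq> 0" "snd z \<in> pts Z" "r (snd z) \<noteq> 0" using that unfolding p2 by (auto simp: pts' r'_def)
        then show ?thesis using iv[OF z(2,3)] by (simp add: torus_simps q'_def chart_dom[OF cp])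
      qed
      show "(\<lambda>z. a (case_nat (fst z) (?inv (snd z)))) \<in> reg ?V2" if "a \<in> reg (var (torus (Suc ?d)))" for a
      proof (rule torus_comp[OF R2, where \<psi> = "\<lambda>z. case_nat (fst z) (?inv (snd z))" and n = "Suc ?d"])
        show "a \<in> regfun (torus (Suc ?d))" using that by (simp add: torus_simps)
        show "case_nat (fst z) (?inv (snd z)) \<in> Tpts (Suc ?d)" if "z \<in> pts ?V2" for z
        proof -
          have z: "fst z \<noteq> 0" "snd z \<in> pts Z" "r (snd z) \<noteq> 0" using that unfolding p2 by (auto simp: pts' r'_def)
          then show ?thesis using iv[OF z(2,3)] by (simp add: chart_dom[OF cp])
        qed
        have 1: "(\<lambda>z. g (fst z)) \<in> reg ?V2" if "g \<in> {\<lambda>z. z, inverse}" for g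
          by (rule princ_open_incl[OF prod_gens(1)]) (use that in \<open>auto simp: Gm_simps intro: gen_in_funs_on\<close>)
        have 2: "(\<lambda>z. ?inv (snd z) j) \<in> reg ?V2" "(\<lambda>z. inverse (?inv (snd z) j)) \<in> reg ?V2" if "j < ?d" for j
          by (rule bwd[OF princ_open_incl], unfold torus_simps, rule coord_reg[OF that])+
        fix i assume "i < Suc ?d"
        then show "(\<lambda>z. (case_nat (fst z) (?inv (snd z)) i)) \<in> reg ?V2"
          "(\<lambda>z. inverse (case_nat (fst z) (?inv (snd z)) i)) \<in> reg ?V2"
          using 1[of "\<lambda>z. z"] 1[of inverse] 2 by (cases i; simp)+
      qed
      have "(\<lambda>z. inverse (q z)) \<in> reg (princ_open (var (torus ?d)) q)"
        by (rule princ_open_inverse[where v = "\<lambda>_. 1"])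
           (use fun_alg_torus fun_alg_const[OF fun_alg_torus Rats_1] in \<open>simp_all add: torus_simps\<close>)
      from bwd[OF this] show "(\<lambda>z. inverse (q' (case_nat (fst z) (?inv (snd z))))) \<in> reg ?V2" by (simp add: q'_def)
    qed
    then show ?thesis by (rule fun_alg_cong[OF R2]) (simp add: inv')
  qed
  have m1: "morphism ?V1 ?V2 (cmap ?pc)" unfolding morphism_def using bij' f1 by (simp add: bij_betw_def)
  have "bij_betw (inv_into (pts ?V1) (cmap ?pc)) (pts ?V2) (pts ?V1)" by (rule bij_betw_inv_into[OF bij'])
  then have m2: "morphism ?V2 ?V1 (inv_into (pts ?V1) (cmap ?pc))" unfolding morphism_def using f2 by (simp add: bij_betw_def)
  have "zdense ?W {z\<in>pts ?W. r' z \<noteq> 0} (pts ?W)"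
    unfolding zdense_def
  proof (intro conjI allI impI)
    fix Z' assume Z': "zclosed ?W Z'" "{z\<in>pts ?W. r' z \<noteq> 0} \<subseteq> Z'"
    obtain E where E: "E \<subseteq> reg ?W" "Z' = {x\<in>pts ?W. \<forall>g\<in>E. g x = 0}" using Z'(1) by (auto simp: zclosed_def)
    have "g (a, x) = 0" if g: "g \<in> E" and ax: "a \<noteq> 0" "x \<in> pts Z" for g a x
    proof (rule laurent_over_zero[OF prod_Gm_laurent_over[OF Z], of g "{x\<in>pts Z. r x \<noteq> 0}"])
      show "g \<in> reg ?W" using g E by blast
      show "s y = 0" if "s \<in> reg Z" "\<And>x. x \<in> {x\<in>pts Z. r x \<noteq> 0} \<Longrightarrow> s x = 0" "y \<in> pts Z" for s y
        by (rule chart_dense[OF cp that(1) _ that(3)]) (use that(2) in simp)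
      show "g (b, x) = 0" if bx: "b \<noteq> 0" "x \<in> {x\<in>pts Z. r x \<noteq> 0}" for b x
      proof -
        have "(b, x) \<in> Z'" using Z'(2) bx by (auto simp: pts' r'_def)
        then show ?thesis using E g by blast
      qed
    qed (use ax in auto)
    then show "pts ?W \<subseteq> Z'" using E by (auto simp: pts')
  qed auto
  moreover have "cdom ?pc \<noteq> {}"
  proof -
    obtain z where "z \<in> cdom c" using chart_ne[OF cp] by blast
    then have "case_nat 1 z \<in> cdom ?pc" by (simp add: pc_simps chart_dom[OF cp])
    then show ?thesis by blast
  qed
  ultimately show ?thesis unfolding toric_chart_def pc_simps(1) isomorphism_def
    using q' r' dom bij' m1 m2 by blast
qed

text \<open>Isomorphisms from a standard torus are charts with the constant function 1 as defining
  function on both sides.\<close>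

lemma princ_open_one_eq: "fun_alg \<rat> (pts V) (reg V) \<Longrightarrow> princ_open V (\<lambda>_. 1) = V"
proof -
  assume "fun_alg \<rat> (pts V) (reg V)"
  then have "reg (princ_open V (\<lambda>_. 1)) = reg V"
    using princ_open_one princ_open_incl by blast
  moreover have "pts (princ_open V (\<lambda>_. 1)) = pts V" by (simp add: princ_open_simps)
  ultimately show ?thesis by (intro variety.equality) simp_all
qed

lemma std_chart_toric:
  assumes "alg_iso (torus n) S \<tau>" and R: "fun_alg \<rat> (pts (var S)) (reg (var S))"
  shows "toric_chart (var S) \<lparr>cdim = n, cdom = Tpts n, cmap = \<tau>\<rparr>"
proof -
  have T: "fun_alg \<rat> (pts (var (torus n))) (reg (var (torus n)))" by (simp add: torus_simps fun_alg_torus)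
  have "Tpts n \<noteq> {}" using GP_exists[of n] GP_Tpts by blast
  then show ?thesis unfolding toric_chart_def
    using assms(1) fun_alg_const[OF R Rats_1] fun_alg_const[OF T Rats_1]
    by (intro bexI[of _ "\<lambda>_. 1"])
       (auto simp: princ_open_one_eq[OF R] princ_open_one_eq[OF T] alg_iso_def zdense_def torus_simps)
qed

lemma fun_alg_Gm: "fun_alg \<rat> (pts (var Gm)) (reg (var Gm))"
  by (simp add: Gm_simps fun_alg_funs_on)

lemma gm_alg_iso: "alg_iso (torus 1) Gm (\<lambda>z. z 0)"
proof -
  let ?g = "\<lambda>a i. if i = 0 then a else (1::complex)"
  have bij: "bij_betw (\<lambda>z. z 0) (Tpts 1) {z::complex. z \<noteq> 0}"
    by (rule bij_betw_byWitness[where f' = ?g]) (auto simp: Tpts_def fun_eq_iff)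
  have inv: "inv_into (Tpts 1) (\<lambda>z. z 0) a = ?g a" if "a \<noteq> 0" for a
    by (rule inv_into_f_eq) (use bij that in \<open>auto simp: bij_betw_def Tpts_def\<close>)
  have m1: "morphism (var (torus 1)) (var Gm) (\<lambda>z. z 0)"
    unfolding morphism_def
  proof (intro conjI ballI)
    fix g assume "g \<in> reg (var Gm)"
    then have "(\<lambda>z. g (z 0)) \<in> regfun (torus 1)"
      by (rule Gm_comp[OF fun_alg_torus, rotated 3]) (auto simp: Tpts_nz intro: coord_reg)
    then show "g \<circ> (\<lambda>z. z 0) \<in> reg (var (torus 1))" by (simp add: torus_simps o_def)
  qed (auto simp: torus_simps Gm_simps Tpts_nz)
  have m2: "morphism (var Gm) (var (torus 1)) (inv_into (Tpts 1) (\<lambda>z. z 0))"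
    unfolding morphism_def
  proof (intro conjI ballI)
    show "inv_into (Tpts 1) (\<lambda>z. z 0) ` pts (var Gm) \<subseteq> pts (var (torus 1))"
      using inv by (auto simp: torus_simps Gm_simps Tpts_def)
    fix f assume "f \<in> reg (var (torus 1))"
    then have f: "f \<in> regfun (torus 1)" by (simp add: torus_simps)
    have 1: "(\<lambda>a. a) \<in> reg (var Gm)" "inverse \<in> reg (var Gm)" unfolding Gm_simps by (auto intro: gen_in_funs_on)
    have "(\<lambda>a. f (?g a)) \<in> reg (var Gm)"
      by (rule torus_comp[OF fun_alg_Gm _ _ _ f]) (use 1 in \<open>auto simp: Gm_simps Tpts_def eta_contract_eq\<close>)
    then show "f \<circ> inv_into (Tpts 1) (\<lambda>z. z 0) \<in> reg (var Gm)"
      by (rule fun_alg_cong[OF fun_alg_Gm]) (simp add: inv[simplified] Gm_simps)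
  qed
  have "(\<lambda>z. z 0) \<in> hom (torus 1) Gm"
    by (auto simp: hom_def torus_def Gm_def Tpts_nz)
  then show ?thesis unfolding alg_iso_def isomorphism_def using bij m1 m2 by (simp add: torus_simps Gm_simps)
qed

lemma gm_chart_in: "gm_chart \<in> torus_structure Gm"
proof -
  let ?s = "\<lparr>cdim = 1, cdom = Tpts 1, cmap = \<lambda>z. z 0\<rparr>"
  have "?s \<in> chart_class (var Gm) ?s" by (rule chart_class_refl[OF std_chart_toric[OF gm_alg_iso fun_alg_Gm]])
  moreover have "chart_class (var Gm) ?s \<in> {chart_class (var Gm) \<lparr>cdim = n, cdom = Tpts n, cmap = \<tau>\<rparr> | n \<tau>. alg_iso (torus n) Gm \<tau>}"
    using gm_alg_iso by blast
  ultimately show ?thesis unfolding torus_structure_def gm_chart_def by (rule UnionI[rotated])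
qed

lemma prod_chart_in:
  assumes "c \<in> \<Theta>" "toric_chart Z c" "fun_alg \<rat> (pts Z) (reg Z)"
  shows "prod_chart gm_chart c \<in> prod_structure (var Gm) Z (torus_structure Gm) \<Theta>"
  unfolding prod_structure_def
  using gm_chart_in assms(1) chart_class_refl[OF prod_chart_toric[OF assms(2,3)]] by blast

text \<open>
  By linear independence of the monomials, a multiplicative Laurent polynomial is a monomial.
\<close>

lemma char_torus_positive:
  assumes \<tau>: "alg_iso (torus n) S \<tau>" and \<mu>: "\<mu> \<in> chars S"
  shows "(\<lambda>z. \<mu> (\<tau> z)) \<in> regfun (torus n)" "positive n (\<lambda>z. \<mu> (\<tau> z))"
proof -
  have h\<mu>: "\<mu> \<in> hom S Gm" "morphism (var S) (var Gm) \<mu>" using \<mu> by (auto simp: chars_def alg_hom_def)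
  have h\<tau>: "\<tau> \<in> hom (torus n) S" "morphism (var (torus n)) (var S) \<tau>" using \<tau> by (auto simp: alg_iso_def isomorphism_def)
  have "(\<lambda>a. a) \<in> reg (var Gm)" unfolding Gm_simps by (auto intro: gen_in_funs_on)
  then have "(\<lambda>a. a) \<circ> \<mu> \<in> reg (var S)" using h\<mu>(2) unfolding morphism_def by blast
  then have "((\<lambda>a. a) \<circ> \<mu>) \<circ> \<tau> \<in> reg (var (torus n))" using h\<tau>(2) unfolding morphism_def by blast
  then show r: "(\<lambda>z. \<mu> (\<tau> z)) \<in> regfun (torus n)" by (simp add: torus_simps o_def)
  then obtain p where p: "p \<in> laurents n" "\<And>z. z \<in> Tpts n \<Longrightarrow> \<mu> (\<tau> z) = leval p z" using reg_torus_leval by blast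
  have mult: "leval p (\<lambda>i. x i * y i) = leval p x * leval p y" if xy: "x \<in> Tpts n" "y \<in> Tpts n" for x y
  proof -
    have "\<tau> (\<lambda>i. x i * y i) = \<tau> x \<otimes>\<^bsub>S\<^esub> \<tau> y" using hom_mult[OF h\<tau>(1), of x y] xy by (simp add: torus_def)
    moreover have "\<tau> x \<in> carrier S" "\<tau> y \<in> carrier S" using hom_in_carrier[OF h\<tau>(1)] xy by (auto simp: torus_simps)
    ultimately have "\<mu> (\<tau> (\<lambda>i. x i * y i)) = \<mu> (\<tau> x) * \<mu> (\<tau> y)" using hom_mult[OF h\<mu>(1)] by (simp add: Gm_def)
    then show ?thesis using p(2) Tpts_mult xy by simp
  qed
  have one: "(\<lambda>_. 1) \<in> Tpts n" by (simp add: Tpts_def)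
  have "\<mu> (\<tau> (\<lambda>_. 1)) \<noteq> 0"
    using hom_in_carrier[OF h\<mu>(1) hom_in_carrier[OF h\<tau>(1)], of "\<lambda>_. 1"] one by (simp add: torus_simps Gm_def)
  then have "p \<noteq> 0" using p(2)[OF one] by auto
  then obtain m where m: "m \<in> keys p" by (metis all_not_in_conv keys_eq_empty)
  have me: "m \<in> expo n" using m p(1) by (auto simp: laurents_def)
  \<comment> \<open>Multiplicativity says that translation by \<open>y\<close> multiplies
    \<open>p\<close> by the scalar \<open>leval p y\<close>, whereas it multiplies each of its
    monomials by its own value at \<open>y\<close>; independence identifies the two for every
    \<open>m\<close> in \<open>keys p\<close>.\<close>
  have "leval p y = monomial m y" if y: "y \<in> Tpts n" for y
  proof -
    have "(\<Sum>m\<in>keys p. (of_rat (lookup p m) * (monomial m y - leval p y)) * monomial m x) = 0" if x: "x \<in> Tpts n" for x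
    proof -
      have "(\<Sum>m\<in>keys p. (of_rat (lookup p m) * (monomial m y - leval p y)) * monomial m x) =
          (\<Sum>m\<in>keys p. of_rat (lookup p m) * monomial m (\<lambda>i. x i * y i)) - leval p y * (\<Sum>m\<in>keys p. of_rat (lookup p m) * monomial m x)"
        by (simp add: monomial_mult algebra_simps sum_distrib_left sum_subtractf)
      also have "\<dots> = 0" using mult[OF x y] unfolding leval_def by (simp add: mult.commute)
      finally show ?thesis .
    qed
    then have "\<forall>m\<in>keys p. of_rat (lookup p m) * (monomial m y - leval p y) = (0::complex)"
      using p(1) by (intro monomials_independent[of _ n]) (auto simp: laurents_def)
    then show ?thesis using m by (auto simp: in_keys_iff)
  qed
  then have eq: "\<mu> (\<tau> z) = leval (single m 1) z" if "z \<in> Tpts n" for z using p(2)[OF that] that by (simp add: leval_single)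
  have "positive n (leval (single m 1))"
    using me by (intro positive_leval laurents_closed) (auto simp: nonneg_coeffs_def lookup_single when_def single_nz)
  then show "positive n (\<lambda>z. \<mu> (\<tau> z))"
    by (rule positive_cong) (rule generic_mono[OF generic_Tpts eq])
qed

lemma chars_reg: "\<mu> \<in> chars S \<Longrightarrow> \<mu> \<in> reg (var S)"
proof -
  assume "\<mu> \<in> chars S"
  then have "morphism (var S) (var Gm) \<mu>" by (auto simp: chars_def alg_hom_def)
  moreover have "(\<lambda>a. a) \<in> reg (var Gm)" unfolding Gm_simps by (auto intro: gen_in_funs_on)
  ultimately have "(\<lambda>a. a) \<circ> \<mu> \<in> reg (var S)" unfolding morphism_def by blast
  then show ?thesis by (simp add: o_def)
qed

lemma torus_structure_char:
  assumes ct: "ct \<in> torus_structure S" and \<mu>: "\<mu> \<in> chars S"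
  shows "toric_chart (var S) ct" "positive (cdim ct) (\<lambda>z. \<mu> (cmap ct z))"
proof -
  obtain n \<tau> where \<tau>: "alg_iso (torus n) S \<tau>"
    and cc: "ct \<in> chart_class (var S) \<lparr>cdim = n, cdom = Tpts n, cmap = \<tau>\<rparr>" (is "_ \<in> chart_class _ ?s")
    using ct unfolding torus_structure_def by blast
  show "toric_chart (var S) ct" using cc by (simp add: chart_class_def)
  have pic: "positive_in_charts ct ?s (\<lambda>x. x)" using cc by (simp add: chart_class_def chart_equiv_def)
  have "regdom ?s \<mu>" unfolding regdom_def
    using char_torus_positive(1)[OF \<tau> \<mu>] fun_alg_const[OF fun_alg_torus Rats_1, of n]
    by (intro bexI[of _ "\<lambda>z. \<mu> (\<tau> z)"] bexI[of _ "\<lambda>_. 1"]) auto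
  then show "positive (cdim ct) (\<lambda>z. \<mu> (cmap ct z))"
    using pos_transfer[of ?s \<mu> ct "\<lambda>x. x"] char_torus_positive(2)[OF \<tau> \<mu>] GP_Tpts pic by simp
qed

section \<open>Projection of a product chart to its factors\<close>

lemma take_coords_Tpts: "z \<in> Tpts (n + n') \<Longrightarrow> take_coords n z \<in> Tpts n"
  by (auto simp: Tpts_def take_coords_def)

lemma drop_coords_Tpts: "z \<in> Tpts (n + n') \<Longrightarrow> drop_coords n z \<in> Tpts n'"
  by (auto simp: Tpts_def drop_coords_def)

lemma take_coords_reg: "r \<in> regfun (torus n) \<Longrightarrow> (\<lambda>z. r (take_coords n z)) \<in> regfun (torus (n + n'))"
  by (rule torus_comp[OF fun_alg_torus, where n = n])
     (auto simp: take_coords_Tpts, auto simp: take_coords_def intro: coord_reg)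

lemma drop_coords_reg: "r \<in> regfun (torus n') \<Longrightarrow> (\<lambda>z. r (drop_coords n z)) \<in> regfun (torus (n + n'))"
  by (rule torus_comp[OF fun_alg_torus, where n = n'])
     (auto simp: drop_coords_Tpts, auto simp: drop_coords_def intro: coord_reg)

lemma GP_take_coords:
  assumes z: "z \<in> GP (n + n')" shows "take_coords n z \<in> GP n" "drop_coords n z \<in> GP n'"
proof -
  have "r y = 0" if r: "r \<in> regfun (torus n)" "r (take_coords n z) = 0" and y: "y \<in> Tpts n" for r y
  proof -
    have "y \<in> Tpts (n + n')" "take_coords n y = y" using y Tpts_nz[OF y] by (auto simp: Tpts_def take_coords_def fun_eq_iff not_less)
    then show ?thesis using GP_regD[OF z take_coords_reg[OF r(1)]] r(2) by metis
  qed
  then show "take_coords n z \<in> GP n" using take_coords_Tpts[OF GP_Tpts[OF z]] by (auto simp: gpt_def torus_simps)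
  have "r y = 0" if r: "r \<in> regfun (torus n')" "r (drop_coords n z) = 0" and y: "y \<in> Tpts n'" for r y
  proof -
    let ?y = "\<lambda>i. if i < n then 1 else y (i - n)"
    have "?y \<in> Tpts (n + n')" using y by (auto simp: Tpts_def)
    moreover have "drop_coords n ?y = y" by (auto simp: drop_coords_def)
    ultimately show ?thesis using GP_regD[OF z drop_coords_reg[OF r(1)]] r(2) by metis
  qed
  then show "drop_coords n z \<in> GP n'" using drop_coords_Tpts[OF GP_Tpts[OF z]] by (auto simp: gpt_def torus_simps)
qed

lemma positive_map_take_coords: "positive_map (n + n') n (take_coords n)"
  unfolding positive_map_def
proof (intro conjI ballI)
  show "generic (var (torus (n + n'))) (\<lambda>z. take_coords n z \<in> Tpts n)"
    by (rule generic_mono[OF generic_Tpts take_coords_Tpts])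
  fix m assume m: "m \<in> expo n"
  then have "m \<in> expo (n + n')" by (auto simp: expo_def)
  then have "positive (n + n') (leval (single m 1))"
    by (intro positive_leval laurents_closed) (auto simp: nonneg_coeffs_def lookup_single when_def single_nz)
  moreover have "leval (single m 1) = (\<lambda>z. monomial m (take_coords n z))"
    using m by (intro ext) (auto simp: leval_single monomial_def take_coords_def expo_def intro!: prod.cong)
  ultimately show "positive (n + n') (\<lambda>z. monomial m (take_coords n z))" by simp
qed

text \<open>Positivity passes from the chart of \<open>S\<close> to the product chart along the
  coordinate projection, then to any equivalent chart by \<open>pos_transfer\<close>. It is applied
  to the torus component of \<open>bp\<close>, which carries the highest weight.\<close>

lemma prod_structure_fst_char:
  assumes c': "c' \<in> prod_structure (var S) B (torus_structure S) \<Theta>'" and \<Theta>': "\<And>cb. cb \<in> \<Theta>' \<Longrightarrow> toric_chart B cb"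
    and \<mu>: "\<mu> \<in> chars S"
  shows "toric_chart (prod_var (var S) B) c'" "positive (cdim c') (\<lambda>z. \<mu> (fst (cmap c' z)))"
proof -
  obtain ct cb where ct: "ct \<in> torus_structure S" and cb: "toric_chart B cb"
    and cc: "c' \<in> chart_class (prod_var (var S) B) (prod_chart ct cb)" (is "_ \<in> chart_class _ ?p")
    using c' \<Theta>' unfolding prod_structure_def by blast
  show "toric_chart (prod_var (var S) B) c'" using cc by (simp add: chart_class_def)
  have pic: "positive_in_charts c' ?p (\<lambda>x. x)" using cc by (simp add: chart_class_def chart_equiv_def)
  note tc = torus_structure_char[OF ct \<mu>]
  have rd: "regdom ct \<mu>" by (rule chart_regdom[OF tc(1) chars_reg[OF \<mu>]])
  have p: "cdim ?p = cdim ct + cdim cb" "\<And>z. \<mu> (fst (cmap ?p z)) = \<mu> (cmap ct (take_coords (cdim ct) z))"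
    "cdom ?p = {z\<in>Tpts (cdim ct + cdim cb). take_coords (cdim ct) z \<in> cdom ct \<and> drop_coords (cdim ct) z \<in> cdom cb}"
    by (simp_all add: prod_chart_def)
  have GPp: "z \<in> cdom ?p" if "z \<in> GP (cdim ct + cdim cb)" for z
    using GP_take_coords[OF that] chart_GP(1)[OF tc(1)] chart_GP(1)[OF cb] GP_Tpts[OF that] by (simp add: p)
  obtain a q where aq: "a \<in> regfun (torus (cdim ct))" "q \<in> regfun (torus (cdim ct))"
    "\<forall>z\<in>cdom ct. z \<in> Tpts (cdim ct) \<and> q z \<noteq> 0 \<and> \<mu> (cmap ct z) = a z / q z" using rd unfolding regdom_def by blast
  have "regdom ?p (\<lambda>x. \<mu> (fst x))"
    unfolding regdom_def p
    by (rule bexI[OF _ take_coords_reg[OF aq(1)]], rule bexI[OF _ take_coords_reg[OF aq(2)]]) (use aq(3) in auto)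
  moreover have "positive (cdim ct + cdim cb) (\<lambda>z. \<mu> (cmap ct (take_coords (cdim ct) z)))"
  proof (rule regdom_positive_comp[OF rd tc(2) chart_GP(1)[OF tc(1)] positive_map_take_coords])
    obtain q r where cp: "chart_pair (var S) ct q r" using chartE[OF tc(1)] by blast
    obtain p where p: "p \<in> laurents (cdim ct + cdim cb)" "\<forall>z\<in>Tpts (cdim ct + cdim cb). q (take_coords (cdim ct) z) = leval p z"
      using reg_torus_leval[OF take_coords_reg[OF chart_q[OF cp]]] by blast
    obtain \<zeta> where \<zeta>: "\<zeta> \<in> GP (cdim ct + cdim cb)" using GP_exists by blast
    have "q (take_coords (cdim ct) \<zeta>) \<noteq> 0"
      using chart_GP(1)[OF tc(1) GP_take_coords(1)[OF \<zeta>]] by (simp add: chart_dom[OF cp])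
    then have "p \<noteq> 0" using p(2) GP_Tpts[OF \<zeta>] by auto
    then show "generic (var (torus (cdim ct + cdim cb))) (\<lambda>z. take_coords (cdim ct) z \<in> cdom ct)"
      unfolding generic_torus_iff using p take_coords_Tpts
      by (intro bexI[of _ p]) (auto simp: chart_dom[OF cp])
  qed
  ultimately show "positive (cdim c') (\<lambda>z. \<mu> (fst (cmap c' z)))"
    using pos_transfer[of ?p "\<lambda>x. \<mu> (fst x)" c' "\<lambda>x. x"] GPp pic by (simp add: p)
qed

section \<open>The geometric crystal operators in a chart\<close>

lemma leval_factor_nz:
  "z \<in> Tpts n \<Longrightarrow> leval (p * q) z \<noteq> 0 \<longleftrightarrow> leval p z \<noteq> 0 \<and> leval q z \<noteq> 0"
  by (simp add: leval_mult Tpts_nz)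

lemma laurents_mult_nz:
  assumes "p \<in> laurents n" "q \<in> laurents n" "p \<noteq> 0" "q \<noteq> 0" shows "p * q \<noteq> 0"
proof -
  obtain \<zeta> where \<zeta>: "\<zeta> \<in> GP n" using GP_exists by blast
  then have "leval (p * q) \<zeta> \<noteq> 0"
    using leval_factor_nz[OF GP_Tpts[OF \<zeta>]] GP_leval[OF \<zeta>] assms by blast
  then show ?thesis by auto
qed

section \<open>One geometric operator in one chart: regularity and the opposite Borel
  subgroup\<close>

locale crystal_chart =
  fixes D :: "('g, 'i) pinned_group" and X :: "('g, 'x) bicrystal" and c :: "'x chart" and i :: 'i
  assumes D: "pinned_split_reductive D" and lin: "linear_bicrystal D X" and chart: "toric_chart (Xm D X) c"
    and i: "i \<in> idx D"
    and pos_phi: "positive (cdim c) (\<lambda>z. phi D X i (cmap c z))"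
    and pos_eps: "positive (cdim c) (\<lambda>z. eps D X i (cmap c z))"
begin

abbreviation "G \<equiv> grp D"
abbreviation "d \<equiv> cdim c"
abbreviation "f \<equiv> cmap c"
abbreviation "Z \<equiv> Xm D X"
abbreviation "x \<equiv> xp D i"
abbreviation "ph \<equiv> phi D X i"
abbreviation "ep \<equiv> eps D X i"
abbreviation "E \<equiv> geom_e D X i"
abbreviation "drp \<equiv> (\<lambda>w :: nat \<Rightarrow> complex. \<lambda>j. w (Suc j))"

lemma algG: "algebraic_group G"
  using D by (simp add: pinned_split_reductive_def reductive_group_def)

lemma groupG: "Group.group G"
  using algG by (simp add: algebraic_group_def)

lemma pinning:
  "root_hom D (sroot D i) x" "range x \<subseteq> uni D" "\<And>a. chi D i (x a) = a"
  "\<And>j a. j \<in> idx D \<Longrightarrow> j \<noteq> i \<Longrightarrow> chi D j (x a) = 0" "finite (idx D)"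
  "sroot D i \<in> simple_roots D"
  using D i by (auto simp: pinned_split_reductive_def bij_betw_def)

lemma x_uni: "x a \<in> uni D"
  using pinning(2) by blast

lemma x_hom: "x \<in> hom Ga G" "morphism (var Ga) (var G) x"
  using pinning(1) by (auto simp: root_hom_def alg_hom_def)

lemma x_carrier: "x a \<in> carrier G"
  using hom_in_carrier[OF x_hom(1)] by (simp add: Ga_def)

lemma x_add: "x (a + b) = x a \<otimes>\<^bsub>G\<^esub> x b"
  using hom_mult[OF x_hom(1), of a b] by (simp add: Ga_def)

lemma x_zero: "x 0 = \<one>\<^bsub>G\<^esub>"
proof -
  interpret Group.group G by (rule groupG)
  show ?thesis using x_add[of 0 0] x_carrier[of 0] by (simp add: l_cancel_one)
qed

lemma x_reg: "h \<in> regfun G \<Longrightarrow> (\<lambda>a. h (x a)) \<in> funs_on \<rat> UNIV {\<lambda>z. z}"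
  using x_hom(2) by (auto simp: morphism_def var_def Ga_def o_def)

lemma chi_st_x: "chi_st D (x a) = a"
proof -
  have "chi_st D (x a) = (\<Sum>j\<in>idx D. if j = i then a else 0)"
    unfolding chi_st_def by (intro sum.cong refl) (use pinning in auto)
  then show ?thesis using i pinning(5) by simp
qed

lemma bicr: "unipotent_bicrystal D X" "UU_variety D X" "morphism (bvar X) (var G) (bp X)" "affine_variety (bvar X)"
  using lin by (auto simp: linear_bicrystal_def unipotent_bicrystal_def UU_variety_def)

lemma fun_alg_X: "fun_alg \<rat> (pts (bvar X)) (reg (bvar X))"
  using bicr(4) by (auto simp: affine_variety_def fun_alg_funs_on)

lemma Z_pts: "pts Z = {y\<in>pts (bvar X). bp X y \<in> opp D}"
  by (simp add: Xm_def subvar_def)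

lemma fun_alg_Z: "fun_alg \<rat> (pts Z) (reg Z)"
proof -
  have "pts (subvar V S) = S" for V :: "'x variety" and S by (simp add: subvar_def)
  then show ?thesis unfolding Xm_def using fun_alg_subvar[OF fun_alg_X] by simp
qed

lemma lact_pts: "u \<in> uni D \<Longrightarrow> y \<in> pts (bvar X) \<Longrightarrow> lact X u y \<in> pts (bvar X)"
  using bicr(2) unfolding UU_variety_def morphism_def prod_var_pts by (force simp: subvar_def)

lemma Z_reg_ex: "g \<in> reg Z \<Longrightarrow> \<exists>h\<in>reg (bvar X). \<forall>y\<in>pts Z. g y = h y"
  by (simp add: Xm_def subvar_def)

lemma GP_phi_eps:
  assumes "z \<in> GP d" shows "ph (f z) \<noteq> 0" "ep (f z) \<noteq> 0" "f z \<in> pts Z" "z \<in> cdom c"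
  using generic_GP[OF positive_generic_nz[OF pos_phi] assms] generic_GP[OF positive_generic_nz[OF pos_eps] assms]
    chart_GP[OF chart assms] by (auto simp: gpt_def)

text \<open>Being positive, \<open>phi\<close> is nonzero at a generic point, so the first branch of
  \<open>geom_e\<close> applies.\<close>

lemma E_eq: "E a y = ract X (lact X (x ((a - 1) / ph y)) y) (x ((inverse a - 1) / ep y))"
proof -
  obtain z where z: "z \<in> GP d" using GP_exists by blast
  then show ?thesis unfolding geom_e_def using GP_phi_eps[OF z] by auto
qed

lemma E_bp: "y \<in> pts (bvar X) \<Longrightarrow>
    bp X (E a y) = x ((a - 1) / ph y) \<otimes>\<^bsub>G\<^esub> bp X y \<otimes>\<^bsub>G\<^esub> x ((inverse a - 1) / ep y)"
  unfolding E_eq using bicr(1) x_uni by (simp add: unipotent_bicrystal_def)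

lemma E_bf: "y \<in> pts (bvar X) \<Longrightarrow> bf X (E a y) = bf X y + (a - 1) / ph y + (inverse a - 1) / ep y"
  unfolding E_eq using lin x_uni by (simp add: linear_bicrystal_def chi_st_x)

lemma E_one: "y \<in> pts (bvar X) \<Longrightarrow> E 1 y = y"
  unfolding E_eq using bicr(2) by (simp add: x_zero UU_variety_def)

text \<open>The denominator depends on \<open>z\<close> alone and not on the parameter
  \<open>a\<close>. Therefore \<open>a\<close> may be specialized to 1, which is not generic, while
  \<open>z\<close> stays generic.\<close>

lemma E_reg:
  "\<exists>den\<in>laurents d. den \<noteq> 0 \<and> (\<forall>z\<in>Tpts d. leval den z \<noteq> 0 \<longrightarrow> z \<in> cdom c) \<and>
     (\<forall>g\<in>reg (bvar X). \<exists>num\<in>laurents (Suc d). \<exists>k::nat. \<forall>a z. a \<noteq> 0 \<longrightarrow> z \<in> Tpts d \<longrightarrow> leval den z \<noteq> 0 \<longrightarrow>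
        g (E a (f z)) = leval num (case_nat a z) / leval den z ^ k)"
proof -
  obtain q r where cp: "chart_pair Z c q r" using chartE[OF chart] by blast
  obtain lq where lq: "lq \<in> laurents d" "\<And>z. z \<in> Tpts d \<Longrightarrow> q z = leval lq z" using reg_torus_leval[OF chart_q[OF cp]] by blast
  have "lq \<noteq> 0" using chart_ne[OF cp] lq(2) unfolding chart_dom[OF cp] by auto
  have quot: "\<exists>o' p s. {o', p, s} \<subseteq> laurents d \<and> o' \<noteq> 0 \<and> p \<noteq> 0 \<and> s \<noteq> 0 \<and>
      (\<forall>z\<in>Tpts d. leval o' z \<noteq> 0 \<longrightarrow> h z = leval p z / leval s z)" if h: "positive d h" for h
  proof -
    obtain p s where ps: "p \<noteq> 0" "is_quotient d p s h" using h by (auto simp: positive_def)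
    then obtain o' where "o' \<in> laurents d" "o' \<noteq> 0" "\<forall>z\<in>Tpts d. leval o' z \<noteq> 0 \<longrightarrow> h z = leval p z / leval s z"
      unfolding is_quotient_def generic_torus_iff by blast
    then show ?thesis using ps unfolding is_quotient_def by blast
  qed
  obtain o1 p1 s1 where 1: "{o1, p1, s1} \<subseteq> laurents d" "o1 \<noteq> 0" "p1 \<noteq> 0" "s1 \<noteq> 0"
    "\<forall>z\<in>Tpts d. leval o1 z \<noteq> 0 \<longrightarrow> ph (f z) = leval p1 z / leval s1 z" using quot[OF pos_phi] by blast
  obtain o2 p2 s2 where 2: "{o2, p2, s2} \<subseteq> laurents d" "o2 \<noteq> 0" "p2 \<noteq> 0" "s2 \<noteq> 0"
    "\<forall>z\<in>Tpts d. leval o2 z \<noteq> 0 \<longrightarrow> ep (f z) = leval p2 z / leval s2 z" using quot[OF pos_eps] by blast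
  note L = lq(1) 1(1) 2(1)
  \<comment> \<open>The factor \<open>lq\<close> keeps \<open>z\<close> in the chart domain,
    \<open>o1\<close> and \<open>o2\<close> make the quotients for \<open>phi\<close> and
    \<open>eps\<close> valid, and \<open>p1\<close> and \<open>p2\<close> make these two functions
    invertible.\<close>
  define den where "den = lq * (o1 * p1) * (o2 * p2)"
  have den: "den \<in> laurents d" "den \<noteq> 0"
    unfolding den_def using L \<open>lq \<noteq> 0\<close> 1(2,3) 2(2,3) by (auto intro!: laurents_closed laurents_mult_nz)
  have dnz: "leval lq z \<noteq> 0 \<and> leval o1 z \<noteq> 0 \<and> leval p1 z \<noteq> 0 \<and> leval o2 z \<noteq> 0 \<and> leval p2 z \<noteq> 0"
    if "z \<in> Tpts d" "leval den z \<noteq> 0" for z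
    using that unfolding den_def leval_factor_nz[OF that(1)] by blast
  have cd: "z \<in> cdom c" if "z \<in> Tpts d" "leval den z \<noteq> 0" for z
    using dnz[OF that] lq(2)[OF that(1)] that(1) by (simp add: chart_dom[OF cp])
  let ?dd = "\<lambda>w. leval den (drp w)"
  let ?V = "princ_open (var (torus (Suc d))) ?dd"
  let ?R = "reg ?V"
  have ddr: "?dd \<in> regfun (torus (Suc d))" by (rule drop_reg[OF leval_reg[OF den(1)]])
  have T: "fun_alg \<rat> (pts (var (torus (Suc d)))) (reg (var (torus (Suc d))))" by (simp add: torus_simps fun_alg_torus)
  have R: "fun_alg \<rat> (pts ?V) ?R"
    by (rule fun_alg_princ_open[OF T]) (simp add: torus_simps ddr)
  have ptsV: "w \<in> pts ?V \<longleftrightarrow> w 0 \<noteq> 0 \<and> drp w \<in> Tpts d \<and> ?dd w \<noteq> 0" for w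
    by (simp add: princ_open_simps torus_simps Tpts_Suc)
  have dropR: "(\<lambda>w. s (drp w)) \<in> ?R" if "s \<in> regfun (torus d)" for s
    by (rule princ_open_incl) (simp add: torus_simps drop_reg[OF that])
  have invR: "(\<lambda>w. inverse (leval u (drp w))) \<in> ?R" if uv: "v \<in> laurents d" "den = u * v" for u v
  proof (rule princ_open_inverse[OF T, where v = "\<lambda>w. leval v (drp w)"])
    show "(\<lambda>w. leval v (drp w)) \<in> reg (var (torus (Suc d)))" by (simp add: torus_simps drop_reg[OF leval_reg[OF uv(1)]])
    show "leval den (drp w) = leval u (drp w) * leval v (drp w)" if "w \<in> pts (var (torus (Suc d)))" for w
      unfolding uv(2) by (rule leval_mult) (use Tpts_nz[of "w" "Suc d"] that in \<open>simp add: torus_simps\<close>)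
  qed
  have w0: "(\<lambda>w. w 0) \<in> ?R" "(\<lambda>w. inverse (w 0)) \<in> ?R"
    using coord_reg[of 0 "Suc d"] by (auto intro!: princ_open_incl simp: torus_simps)
  have r1: "(\<lambda>_. 1) \<in> ?R" by (rule fun_alg_const[OF R Rats_1])
  let ?A = "\<lambda>w. (w 0 - 1) / ph (f (drp w))" and ?B = "\<lambda>w. (inverse (w 0) - 1) / ep (f (drp w))"
  have A: "?A \<in> ?R"
  proof -
    have "(\<lambda>w. (w 0 - 1) * leval s1 (drp w) * inverse (leval p1 (drp w))) \<in> ?R"
    proof (rule fun_alg_mult[OF R fun_alg_mult[OF R]])
      show "(\<lambda>w. inverse (leval p1 (drp w))) \<in> ?R"
        by (rule invR[where v = "lq * o1 * (o2 * p2)"]) (use L in \<open>auto simp: den_def mult_ac intro!: laurents_closed\<close>)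
      show "(\<lambda>w. w 0 - 1) \<in> ?R" by (rule fun_alg_diff[OF R _ w0(1) r1]) simp
      show "(\<lambda>w. leval s1 (drp w)) \<in> ?R" by (rule dropR[OF leval_reg]) (use L in simp)
    qed
    then show ?thesis
      by (rule fun_alg_cong[OF R]) (use 1(5) dnz in \<open>auto simp: ptsV divide_inverse\<close>)
  qed
  have B: "?B \<in> ?R"
  proof -
    have "(\<lambda>w. (inverse (w 0) - 1) * leval s2 (drp w) * inverse (leval p2 (drp w))) \<in> ?R"
    proof (rule fun_alg_mult[OF R fun_alg_mult[OF R]])
      show "(\<lambda>w. inverse (leval p2 (drp w))) \<in> ?R"
        by (rule invR[where v = "lq * (o1 * p1) * o2"]) (use L in \<open>auto simp: den_def mult_ac intro!: laurents_closed\<close>)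
      show "(\<lambda>w. inverse (w 0) - 1) \<in> ?R" by (rule fun_alg_diff[OF R _ w0(2) r1]) simp
      show "(\<lambda>w. leval s2 (drp w)) \<in> ?R" by (rule dropR[OF leval_reg]) (use L in simp)
    qed
    then show ?thesis
      by (rule fun_alg_cong[OF R]) (use 2(5) dnz in \<open>auto simp: ptsV divide_inverse\<close>)
  qed
  have fR: "(\<lambda>w. g (f (drp w))) \<in> ?R" if g: "g \<in> reg (bvar X)" for g
  proof -
    have "g \<in> reg Z" using g unfolding Xm_def by (rule reg_subvarI)
    from chart_fwd[OF cp princ_open_incl[OF this]]
    obtain a k where a: "a \<in> regfun (torus d)" "\<forall>z\<in>Tpts d. q z \<noteq> 0 \<longrightarrow> g (f z) = a z / q z ^ k"
      unfolding princ_open_simps torus_simps by blast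
    have "(\<lambda>w. inverse (leval lq (drp w))) \<in> ?R"
      by (rule invR[where v = "(o1 * p1) * (o2 * p2)"]) (use L in \<open>auto simp: den_def mult_ac intro!: laurents_closed\<close>)
    then have "(\<lambda>w. a (drp w) * inverse (leval lq (drp w)) ^ k) \<in> ?R"
      by (rule fun_alg_mult[OF R dropR[OF a(1)] fun_alg_power[OF R Rats_1]])
    then show ?thesis
      by (rule fun_alg_cong[OF R]) (use a(2) dnz lq(2) in \<open>auto simp: ptsV divide_inverse power_inverse\<close>)
  qed
  have xR: "(\<lambda>w. h (x (\<alpha> w))) \<in> ?R" if h: "h \<in> reg (subvar (var G) (uni D))" and \<alpha>: "\<alpha> \<in> ?R" for h \<alpha>
  proof -
    obtain h' where h': "h' \<in> regfun G" "\<forall>u\<in>uni D. h u = h' u" using h by (auto simp: subvar_def var_def)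
    have "(\<lambda>w. h' (x (\<alpha> w))) \<in> ?R"
      by (rule funs_on_comp[OF R, where \<psi> = \<alpha> and S' = UNIV and F = "{\<lambda>z. z}" and g = "\<lambda>a. h' (x a)"])
         (use x_reg[OF h'(1)] \<alpha> in auto)
    then show ?thesis by (rule fun_alg_cong[OF R]) (use h'(2) x_uni in auto)
  qed
  have fX: "f (drp w) \<in> pts (bvar X)" if "w \<in> pts ?V" for w
    using bij_betwE[OF chart_bij[OF cp]] cd that unfolding ptsV by (auto simp: Z_pts)
  have LR: "(\<lambda>w. g (lact X (x (?A w)) (f (drp w)))) \<in> ?R" if g: "g \<in> reg (bvar X)" for g
  proof -
    have m: "g \<circ> (\<lambda>(u, y). lact X u y) \<in> reg (prod_var (subvar (var G) (uni D)) (bvar X))"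
      using bicr(2) g by (simp add: UU_variety_def morphism_def)
    have "(\<lambda>w. (g \<circ> (\<lambda>(u, y). lact X u y)) (x (?A w), f (drp w))) \<in> ?R"
      by (rule prod_var_comp[OF R _ _ _ _ m]) (use x_uni fX xR[OF _ A] fR in \<open>auto simp: subvar_def\<close>)
    then show ?thesis by simp
  qed
  have ER: "(\<lambda>w. g (E (w 0) (f (drp w)))) \<in> ?R" if g: "g \<in> reg (bvar X)" for g
  proof -
    have m: "g \<circ> (\<lambda>(y, u). ract X y u) \<in> reg (prod_var (bvar X) (subvar (var G) (uni D)))"
      using bicr(2) g by (simp add: UU_variety_def morphism_def)
    have "(\<lambda>w. (g \<circ> (\<lambda>(y, u). ract X y u)) (lact X (x (?A w)) (f (drp w)), x (?B w))) \<in> ?R"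
      by (rule prod_var_comp[OF R _ _ _ _ m]) (use x_uni fX xR[OF _ B] LR lact_pts in \<open>auto simp: subvar_def\<close>)
    then show ?thesis by (simp add: E_eq)
  qed
  have "\<exists>num\<in>laurents (Suc d). \<exists>k::nat. \<forall>a z. a \<noteq> 0 \<longrightarrow> z \<in> Tpts d \<longrightarrow> leval den z \<noteq> 0 \<longrightarrow>
        g (E a (f z)) = leval num (case_nat a z) / leval den z ^ k" if g: "g \<in> reg (bvar X)" for g
  proof -
    obtain a k where a: "a \<in> regfun (torus (Suc d))"
      "\<forall>w\<in>Tpts (Suc d). ?dd w \<noteq> 0 \<longrightarrow> g (E (w 0) (f (drp w))) = a w / ?dd w ^ k"
      using ER[OF g] unfolding princ_open_simps torus_simps by blast
    obtain num where num: "num \<in> laurents (Suc d)" "\<forall>w\<in>Tpts (Suc d). a w = leval num w" using reg_torus_leval[OF a(1)] by blast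
    have "g (E b (f z)) = leval num (case_nat b z) / leval den z ^ k" if bz: "b \<noteq> 0" "z \<in> Tpts d" "leval den z \<noteq> 0" for b z
      using bspec[OF a(2), of "case_nat b z"] bspec[OF num(2), of "case_nat b z"] bz by simp
    then show ?thesis using num(1) by blast
  qed
  then show ?thesis using den cd by blast
qed

text \<open>At \<open>a = 1\<close> the operator is the identity, so the numerator of
  \<open>g\<close> after the operator is nonzero at \<open>case_nat 1 z\<close> for generic
  \<open>z\<close>, hence nonzero as a Laurent polynomial.\<close>

lemma E_generic_nz:
  assumes g: "g \<in> reg (bvar X)" "y \<in> pts Z" "g y \<noteq> 0"
  shows "generic (var (torus (Suc d))) (\<lambda>w. g (E (w 0) (f (drp w))) \<noteq> 0)"
proof -
  obtain den where den: "den \<in> laurents d" "den \<noteq> 0" "\<forall>z\<in>Tpts d. leval den z \<noteq> 0 \<longrightarrow> z \<in> cdom c"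
    and N: "\<forall>g\<in>reg (bvar X). \<exists>num\<in>laurents (Suc d). \<exists>k::nat. \<forall>a z. a \<noteq> 0 \<longrightarrow> z \<in> Tpts d \<longrightarrow> leval den z \<noteq> 0 \<longrightarrow>
        g (E a (f z)) = leval num (case_nat a z) / leval den z ^ k" using E_reg by blast
  obtain num k where num: "num \<in> laurents (Suc d)" "\<And>a z. a \<noteq> 0 \<Longrightarrow> z \<in> Tpts d \<Longrightarrow> leval den z \<noteq> 0 \<Longrightarrow>
        g (E a (f z)) = leval num (case_nat a z) / leval den z ^ k" using N g(1) by meson
  obtain z where z: "z \<in> GP d" using GP_exists by blast
  have dz: "leval den z \<noteq> 0" using GP_leval[OF z den(1)] den(2) by blast
  have gZ: "g \<in> reg Z" using g(1) unfolding Xm_def by (rule reg_subvarI)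
  have "g (f z) \<noteq> 0" using gptD[OF chart_GP(2)[OF chart z] gZ _ g(2)] g(3) by blast
  moreover have "f z \<in> pts (bvar X)" using GP_phi_eps(3)[OF z] by (simp add: Z_pts)
  ultimately have "leval num (case_nat 1 z) \<noteq> 0"
    using num(2)[of 1 z] GP_Tpts[OF z] dz E_one[of "f z"] by auto
  then have "num \<noteq> 0" by auto
  obtain dl where dl: "dl \<in> laurents (Suc d)" "\<And>w. w \<in> Tpts (Suc d) \<Longrightarrow> leval den (drp w) = leval dl w"
    using reg_torus_leval[OF drop_reg[OF leval_reg[OF den(1)]]] by blast
  have "leval dl (case_nat 1 z) \<noteq> 0" using dl(2)[of "case_nat 1 z"] dz GP_Tpts[OF z] by simp
  then have "dl \<noteq> 0" by auto
  have "g (E (w 0) (f (drp w))) \<noteq> 0" if w: "w \<in> Tpts (Suc d)" "leval (num * dl) w \<noteq> 0" for w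
    using num(2)[of "w 0" "drp w"] w dl(2)[OF w(1)] unfolding leval_factor_nz[OF w(1)]
    by (simp add: Tpts_Suc case_nat_eta)
  then show ?thesis unfolding generic_torus_iff
    using laurents_mult_nz[OF num(1) dl(1) \<open>num \<noteq> 0\<close> \<open>dl \<noteq> 0\<close>] laurents_closed(4)[OF num(1) dl(1)]
    by (intro bexI[of _ "num * dl"]) auto
qed

text \<open>An element of the root subgroup in the opposite Borel subgroup lies in the torus, hence
  commutes with it; but conjugation by a suitable \<open>t\<close> scales the parameter by a number
  other than 1.\<close>

lemma x_opp: "x a \<in> opp D \<Longrightarrow> a = 0"
proof -
  assume o: "x a \<in> opp D"
  interpret Group.group G by (rule groupG)
  have "x a \<in> bor D" by (rule uni_bor[OF D x_uni])
  then have xT: "x a \<in> tor D" using D o by (auto simp: pinned_split_reductive_def)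
  have smt: "split_maximal_torus G (tor D)" using D by (simp add: pinned_split_reductive_def)
  have TG: "t \<in> carrier G" if "t \<in> tor D" for t
    using smt that by (auto simp: split_maximal_torus_def closed_subgroup_def dest: subgroup.mem_carrier)
  obtain n \<tau> where \<tau>: "alg_iso (torus n) (subgrp G (tor D)) \<tau>" using smt by (auto simp: split_maximal_torus_def split_torus_def)
  have comm: "s \<otimes>\<^bsub>G\<^esub> t = t \<otimes>\<^bsub>G\<^esub> s" if st: "s \<in> tor D" "t \<in> tor D" for s t
  proof -
    have im: "\<tau> ` Tpts n = tor D" using \<tau> by (simp add: alg_iso_def isomorphism_def bij_betw_def torus_simps) (simp add: var_def subgrp_def)
    obtain s' t' where "s' \<in> Tpts n" "t' \<in> Tpts n" "s = \<tau> s'" "t = \<tau> t'" using st im by blast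
    moreover have "\<tau> (\<lambda>i. a i * b i) = \<tau> a \<otimes>\<^bsub>G\<^esub> \<tau> b" if "a \<in> Tpts n" "b \<in> Tpts n" for a b
      using \<tau> that hom_mult[of \<tau> "torus n" "subgrp G (tor D)" a b] by (simp add: alg_iso_def torus_def subgrp_def)
    ultimately show ?thesis by (metis (no_types, lifting) mult.commute ext)
  qed
  obtain t where t: "t \<in> tor D" "sroot D i t \<noteq> 1"
    using pinning(6) by (auto simp: simple_roots_def positive_roots_def)
  have "t \<otimes>\<^bsub>G\<^esub> x a \<otimes>\<^bsub>G\<^esub> inv\<^bsub>G\<^esub> t = x (sroot D i t * a)" using pinning(1) t(1) by (simp add: root_hom_def)
  moreover have "t \<otimes>\<^bsub>G\<^esub> x a \<otimes>\<^bsub>G\<^esub> inv\<^bsub>G\<^esub> t = x a"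
    using comm[OF t(1) xT] TG[OF t(1)] x_carrier[of a] by (simp add: m_assoc)
  ultimately have "x (sroot D i t * a) = x a" by simp
  moreover have "inj x" using pinning(1) by (simp add: root_hom_def)
  ultimately have "sroot D i t * a = a" by (metis injD)
  then show "a = 0" using t(2) by simp
qed

lemma opp_unique:
  assumes g: "g \<in> carrier G" and o: "x a \<otimes>\<^bsub>G\<^esub> g \<otimes>\<^bsub>G\<^esub> x b \<in> opp D" "x a \<otimes>\<^bsub>G\<^esub> g \<otimes>\<^bsub>G\<^esub> x b' \<in> opp D"
  shows "b = b'"
proof -
  interpret Group.group G by (rule groupG)
  have so: "subgroup (opp D) G" using D by (auto simp: pinned_split_reductive_def borel_subgroup_def closed_subgroup_def)
  let ?h = "x a \<otimes>\<^bsub>G\<^esub> g"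
  have h: "?h \<in> carrier G" using g x_carrier by simp
  have "x b' = x b \<otimes>\<^bsub>G\<^esub> x (b' - b)" using x_add[of b "b' - b"] by simp
  then have e: "?h \<otimes>\<^bsub>G\<^esub> x b' = (?h \<otimes>\<^bsub>G\<^esub> x b) \<otimes>\<^bsub>G\<^esub> x (b' - b)" using h x_carrier by (simp add: m_assoc)
  have "y = inv\<^bsub>G\<^esub> k \<otimes>\<^bsub>G\<^esub> (k \<otimes>\<^bsub>G\<^esub> y)" if "k \<in> carrier G" "y \<in> carrier G" for k y
    using that by (simp add: m_assoc[symmetric])
  from this[of "?h \<otimes>\<^bsub>G\<^esub> x b" "x (b' - b)"]
  have "x (b' - b) = inv\<^bsub>G\<^esub> (?h \<otimes>\<^bsub>G\<^esub> x b) \<otimes>\<^bsub>G\<^esub> (?h \<otimes>\<^bsub>G\<^esub> x b')"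
    using h x_carrier unfolding e by simp
  also have "\<dots> \<in> opp D"
    by (rule subgroup.m_closed[OF so subgroup.m_inv_closed[OF so o(1)] o(2)])
  finally show ?thesis using x_opp by fastforce
qed

end

lemma infinite_co_countable:
  assumes "countable T" shows "infinite (UNIV - T :: complex set)"
proof
  assume "finite (UNIV - T)"
  then have "countable ((UNIV - T) \<union> T)" using assms countable_finite by blast
  then show False using uncountable_UNIV_complex by simp
qed

section \<open>Consequences of the positivity of the operator\<close>

locale positive_crystal_chart = crystal_chart D X c i
  for D :: "('g, 'i) pinned_group" and X :: "('g, 'x) bicrystal" and c :: "'x chart" and i :: 'i +
  fixes \<Theta> :: "'x chart set"
  assumes c\<Theta>: "c \<in> \<Theta>" and \<Theta>: "\<And>c'. c' \<in> \<Theta> \<Longrightarrow> toric_chart (Xm D X) c'"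
    and pos_E: "positive_morphism (prod_structure (var Gm) (Xm D X) (torus_structure Gm) \<Theta>) \<Theta> (\<lambda>(a, y). geom_e D X i a y)"
begin

abbreviation "pc \<equiv> prod_chart gm_chart c"
abbreviation "h \<equiv> chart_expr pc c (\<lambda>(a, y). E a y)"

lemma E_cmap: "(case cmap pc w of (a, y) \<Rightarrow> E a y) = E (w 0) (f (drp w))"
  by (simp add: pc_simps)

text \<open>A positive morphism is only known to meet some chart \<open>c1\<close> of the structure.
  This shows that the operator generically returns to \<open>Xm\<close>; that it lands in the image
  of the given chart \<open>c\<close> follows from \<open>E_generic_nz\<close> for the function that
  defines this image.\<close>

lemma E_in_charts: "positive_in_charts pc c (\<lambda>(a, y). E a y)"
proof -
  have pcin: "pc \<in> prod_structure (var Gm) Z (torus_structure Gm) \<Theta>"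
    by (rule prod_chart_in[OF c\<Theta> chart fun_alg_Z])
  obtain c1 where c1: "c1 \<in> \<Theta>" "meets pc c1 (\<lambda>(a, y). E a y)"
    using pos_E pcin unfolding positive_morphism_def by blast
  obtain q r where cp: "chart_pair Z c q r" using chartE[OF chart] by blast
  obtain q1 r1' where cp1: "chart_pair Z c1 q1 r1'" using chartE[OF \<Theta>[OF c1(1)]] by blast
  obtain g where g: "g \<in> reg (bvar X)" "\<forall>y\<in>pts Z. r y = g y" using Z_reg_ex[OF chart_r[OF cp]] by blast
  obtain z0 where z0: "z0 \<in> cdom c" using chart_ne[OF cp] by blast
  have y0: "f z0 \<in> pts Z" "r (f z0) \<noteq> 0" using bij_betwE[OF chart_bij[OF cp]] z0 by auto
  have g1: "generic (var (torus (Suc d))) (\<lambda>w. w \<in> cdom pc \<and> E (w 0) (f (drp w)) \<in> cmap c1 ` cdom c1)"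
    using c1(2) unfolding meets_def E_cmap by (simp add: pc_simps(1))
  have g2: "generic (var (torus (Suc d))) (\<lambda>w. g (E (w 0) (f (drp w))) \<noteq> 0)"
    by (rule E_generic_nz[OF g(1) y0(1)]) (use g(2) y0 in auto)
  have im: "f ` cdom c = {y\<in>pts Z. r y \<noteq> 0}" "cmap c1 ` cdom c1 \<subseteq> pts Z"
    using chart_bij[OF cp] chart_bij[OF cp1] by (auto simp: bij_betw_def)
  have "generic (var (torus (Suc d))) (\<lambda>w. w \<in> cdom pc \<and> E (w 0) (f (drp w)) \<in> f ` cdom c)"
  proof (rule generic_mono[OF generic_conj[OF g1 g2]])
    fix w assume w: "(w \<in> cdom pc \<and> E (w 0) (f (drp w)) \<in> cmap c1 ` cdom c1) \<and> g (E (w 0) (f (drp w))) \<noteq> 0"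
    then have "E (w 0) (f (drp w)) \<in> pts Z" using im(2) by blast
    then show "w \<in> cdom pc \<and> E (w 0) (f (drp w)) \<in> f ` cdom c" using w g(2) unfolding im(1) by auto
  qed
  then have "meets pc c (\<lambda>(a, y). E a y)" unfolding meets_def E_cmap by (simp add: pc_simps(1))
  then show ?thesis using pos_E pcin c\<Theta> unfolding positive_morphism_def by blast
qed

lemma h_positive: "positive_map (Suc d) d h"
  using positive_in_chartsD(1)[OF E_in_charts] by (simp add: pc_simps(1))

text \<open>By \<open>E_generic_nz\<close> a regular function that is nonzero somewhere on
  \<open>Xm\<close> is nonzero at the image point, so this point is generic on \<open>Xm\<close>;
  \<open>chart_gpt\<close> transports genericity to its coordinates.\<close>

lemma h_GP:
  assumes w: "case_nat a z \<in> GP (Suc d)"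
  shows "E a (f z) = f (h (case_nat a z))" "h (case_nat a z) \<in> GP d"
proof -
  let ?w = "case_nat a z"
  have 1: "E a (f z) = f (h ?w) \<and> h ?w \<in> cdom c"
    using generic_GP[OF positive_in_chartsD(2)[OF E_in_charts, unfolded pc_simps(1)] w] unfolding E_cmap by simp
  then show "E a (f z) = f (h ?w)" by blast
  obtain q r where cp: "chart_pair Z c q r" using chartE[OF chart] by blast
  have fz: "f (h ?w) \<in> pts Z" using 1 bij_betwE[OF chart_bij[OF cp]] by blast
  have "s y = 0" if s: "s \<in> reg Z" "s (f (h ?w)) = 0" and y: "y \<in> pts Z" for s y
  proof (rule ccontr)
    assume ne: "s y \<noteq> 0"
    obtain g where g: "g \<in> reg (bvar X)" "\<forall>y\<in>pts Z. s y = g y" using Z_reg_ex[OF s(1)] by blast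
    have "g y \<noteq> 0" using g(2) ne y by auto
    from generic_GP[OF E_generic_nz[OF g(1) y this] w] have "g (f (h ?w)) \<noteq> 0" using 1 by simp
    then show False using g(2) fz s(2) by auto
  qed
  then have "f (h ?w) \<in> gpt Z" using fz by (auto simp: gpt_def)
  from chart_gpt[OF chart this] obtain z' where z': "z' \<in> GP d" "z' \<in> cdom c" "f z' = f (h ?w)" by blast
  then have "z' = h ?w" using chart_bij[OF cp] 1 by (auto simp: bij_betw_def inj_on_def)
  then show "h ?w \<in> GP d" using z'(1) by simp
qed

lemma E_opp:
  assumes w: "case_nat a z \<in> GP (Suc d)"
  shows "x ((a - 1) / ph (f z)) \<otimes>\<^bsub>G\<^esub> bp X (f z) \<otimes>\<^bsub>G\<^esub> x ((inverse a - 1) / ep (f z)) \<in> opp D"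
proof -
  have "f z \<in> pts (bvar X)" using GP_phi_eps(3)[OF GP_drop(1)[OF w]] by (simp add: Z_pts)
  moreover have "E a (f z) \<in> pts Z" unfolding h_GP(1)[OF w] using GP_phi_eps(3)[OF h_GP(2)[OF w]] .
  ultimately show ?thesis using E_bp[of "f z" a] by (simp add: Z_pts)
qed

text \<open>
  Composing the operators with parameters \<open>a\<close> and \<open>b\<close> gives the one with parameter \<open>g\<close>, since the
  right factor of \<open>x s p x t\<close> in the opposite Borel subgroup is determined by the left one. As \<open>b\<close>
  varies, this determines the effect of the operator on \<open>phi\<close> and \<open>eps\<close>.
\<close>

lemma shift:
  assumes w: "case_nat a z \<in> GP (Suc d)"
  shows "ph (f (h (case_nat a z))) = ph (f z) / a" "ep (f (h (case_nat a z))) = a * ep (f z)"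
proof -
  interpret Gr: Group.group G by (rule groupG)
  let ?y = "f z" and ?y' = "f (h (case_nat a z))"
  have z: "z \<in> GP d" "a \<noteq> 0" using GP_drop[OF w] by auto
  have z': "h (case_nat a z) \<in> GP d" by (rule h_GP(2)[OF w])
  note nz = GP_phi_eps(1,2)[OF z(1)] GP_phi_eps(1,2)[OF z']
  \<comment> \<open>The ratios \<open>\<rho>\<close> and \<open>\<sigma>\<close> will turn out to be
    \<open>a\<close> and its inverse. The parameter \<open>g b\<close> of the composite is read off
    from the left factors alone.\<close>
  define \<rho> where "\<rho> = ph ?y / ph ?y'"
  define \<sigma> where "\<sigma> = ep ?y / ep ?y'"
  have \<rho>\<sigma>: "\<rho> \<noteq> 0" "\<sigma> \<noteq> 0" using nz by (auto simp: \<rho>_def \<sigma>_def)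
  define g where "g = (\<lambda>b. a + (b - 1) * \<rho>)"
  define S1 where "S1 = {b. b \<noteq> 0 \<and> case_nat b (h (case_nat a z)) \<notin> GP (Suc d)}"
  define S2 where "S2 = {b. b \<noteq> 0 \<and> case_nat b z \<notin> GP (Suc d)}"
  let ?T = "insert 0 S1 \<union> g -` (insert 0 S2)"
  have "countable (insert 0 S1)" "countable (insert 0 S2)"
    unfolding S1_def S2_def using GP_slice[OF z'] GP_slice[OF z(1)] by simp_all
  moreover have ig: "inj g" using \<rho>\<sigma> by (auto simp: g_def inj_on_def)
  have "countable (g ` (g -` (insert 0 S2)))"
    by (rule countable_subset[OF _ \<open>countable (insert 0 S2)\<close>]) auto
  then have "countable (g -` (insert 0 S2))"
    using countable_image_inj_eq[OF inj_on_subset[OF ig]] by blast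
  ultimately have "countable ?T" by simp
  from infinite_co_countable[OF this] have inf: "infinite (UNIV - ?T)" .
  \<comment> \<open>Equating the right factors gives
    \<open>g b * (1 / a + (1 / b - 1) * \<sigma>) = 1\<close>; multiplied by \<open>b\<close> this
    is a quadratic polynomial in \<open>b\<close>. It has infinitely many zeros, and its constant
    and leading coefficients determine \<open>\<rho>\<close> and \<open>\<sigma>\<close>.\<close>
  let ?p = "[:(a - \<rho>) * \<sigma>, (a - \<rho>) * (inverse a - \<sigma>) + \<rho> * \<sigma> - 1, \<rho> * (inverse a - \<sigma>):]"
  have yX: "?y \<in> pts (bvar X)" "?y' \<in> pts (bvar X)"
    using GP_phi_eps(3)[OF z(1)] GP_phi_eps(3)[OF z'] by (auto simp: Z_pts)
  have py: "bp X ?y \<in> carrier G" using bicr(3) yX(1) by (auto simp: morphism_def var_def)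
  have pz: "poly ?p b = 0" if b: "b \<in> UNIV - ?T" for b
  proof -
    have b1: "b \<noteq> 0" "case_nat b (h (case_nat a z)) \<in> GP (Suc d)" using b by (auto simp: S1_def)
    have b2: "g b \<noteq> 0" "case_nat (g b) z \<in> GP (Suc d)" using b by (auto simp: S2_def)
    let ?s = "(a - 1) / ph ?y" and ?t = "(inverse a - 1) / ep ?y"
      and ?s' = "(b - 1) / ph ?y'" and ?t' = "(inverse b - 1) / ep ?y'"
    have py': "bp X ?y' = x ?s \<otimes>\<^bsub>G\<^esub> bp X ?y \<otimes>\<^bsub>G\<^esub> x ?t" using E_bp[OF yX(1), of a] h_GP(1)[OF w] by simp
    have "x ?s' \<otimes>\<^bsub>G\<^esub> bp X ?y' \<otimes>\<^bsub>G\<^esub> x ?t' \<in> opp D" by (rule E_opp[OF b1(2)])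
    also have "x ?s' \<otimes>\<^bsub>G\<^esub> bp X ?y' \<otimes>\<^bsub>G\<^esub> x ?t' = x (?s' + ?s) \<otimes>\<^bsub>G\<^esub> bp X ?y \<otimes>\<^bsub>G\<^esub> x (?t + ?t')"
      unfolding py' x_add using py x_carrier by (simp add: Gr.m_assoc)
    also have "?s' + ?s = (g b - 1) / ph ?y" using nz by (simp add: g_def \<rho>_def field_simps)
    finally have "?t + ?t' = (inverse (g b) - 1) / ep ?y" using opp_unique[OF py _ E_opp[OF b2(2)]] by blast
    moreover have "ep ?y * (?t + ?t') = (inverse a - 1) + (inverse b - 1) * \<sigma>"
      using nz by (simp add: \<sigma>_def distrib_left)
    ultimately have "inverse a + (inverse b - 1) * \<sigma> = inverse (g b)" using nz by simp
    then have "g b * (inverse a + (inverse b - 1) * \<sigma>) = 1" using b2(1) by simp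
    then have "b * (g b * (inverse a + (inverse b - 1) * \<sigma>)) = b" by simp
    then show ?thesis using b1(1) by (simp add: g_def algebra_simps)
  qed
  have "UNIV - ?T \<subseteq> {b. poly ?p b = 0}"
    by (rule subsetI, rule CollectI, rule pz)
  then have "\<not> finite {b. poly ?p b = 0}" using inf finite_subset by metis
  then have "?p = 0" using poly_roots_finite by blast
  then have "(a - \<rho>) * \<sigma> = 0" "\<rho> * (inverse a - \<sigma>) = 0" by (auto simp only: pCons_eq_0_iff)
  then have "\<rho> = a" "\<sigma> = inverse a" using \<rho>\<sigma> by auto
  then show "ph ?y' = ph ?y / a" "ep ?y' = a * ep ?y" using nz z(2) by (auto simp: \<rho>_def \<sigma>_def field_simps)
qed

section \<open>The tropical operator and its effect on orders of growth\<close>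

abbreviation "te \<equiv> trop_e D X c i"

lemma te_eq: "te n b = trop_map (Suc d) d h (case_nat n b)"
  by (simp add: trop_e_def)

lemma case_nat_lattice: "b \<in> cochar_lattice d \<Longrightarrow> case_nat n b \<in> cochar_lattice (Suc d)"
  by (auto simp: cochar_lattice_def split: nat.split)

lemma te_lattice: "b \<in> cochar_lattice d \<Longrightarrow> te n b \<in> cochar_lattice d"
  unfolding te_eq by (rule positive_map_pord(1)[OF h_positive case_nat_lattice])

text \<open>A single admissible sequence on the larger torus supplies the parameter, the point
  before and the point after the operator. Any relation between these three thus becomes a relation
  between orders.\<close>

lemma te_sequences:
  assumes b: "b \<in> cochar_lattice d"
  obtains a z where "adm d b z" "adm d (te n b) (\<lambda>k. h (case_nat (a k) (z k)))" "pord a n"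
    "\<And>k. case_nat (a k) (z k) \<in> GP (Suc d)"
proof -
  obtain w where w: "adm (Suc d) (case_nat n b) w" using adm_exists[OF case_nat_lattice[OF b]] by blast
  define a where "a = (\<lambda>k. w k 0)"
  define z where "z = (\<lambda>k. drp (w k))"
  have wk: "case_nat (a k) (z k) = w k" for k by (simp add: a_def z_def case_nat_eta)
  then have gp: "case_nat (a k) (z k) \<in> GP (Suc d)" for k using w by (simp add: adm_def)
  have "pord (\<lambda>k. w k j) (case_nat n b j)" if "j < Suc d" for j using w that by (simp add: adm_def)
  from this[of 0] this[of "Suc _"] have p: "pord a n" "\<And>j. j < d \<Longrightarrow> pord (\<lambda>k. z k j) (b j)"
    by (simp_all add: a_def z_def)
  have "adm d b z" unfolding adm_def using GP_drop(1)[OF gp] p by blast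
  moreover have "adm d (te n b) (\<lambda>k. h (case_nat (a k) (z k)))"
    unfolding adm_def te_eq using h_GP(2)[OF gp] positive_map_pord(2)[where v = w, OF h_positive case_nat_lattice[OF b]] w
    by (simp add: wk)
  ultimately show thesis using that p(1) gp by blast
qed

lemma trop_te_invariant:
  assumes H: "positive d H" and inv: "\<And>a z. case_nat a z \<in> GP (Suc d) \<Longrightarrow> H (h (case_nat a z)) = H z"
    and b: "b \<in> cochar_lattice d"
  shows "trop d H (te n b) = trop d H b"
proof -
  obtain a z where s: "adm d b z" "adm d (te n b) (\<lambda>k. h (case_nat (a k) (z k)))" "pord a n"
    "\<And>k. case_nat (a k) (z k) \<in> GP (Suc d)" by (rule te_sequences[OF b, where n = n]) blast
  obtain m where m: "trop d H b = Fin m" "pord (\<lambda>k. H (z k)) m" using positive_pord[OF H b] s(1) by blast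
  have "pord (\<lambda>k. H (h (case_nat (a k) (z k)))) m" using m(2) inv[OF s(4)] by simp
  from trop_from_pord[OF H te_lattice[OF b] s(2) this] show ?thesis using m(1) by simp
qed

lemma trop_phi_te:
  assumes b: "b \<in> cochar_lattice d" and m: "trop_in c ph b = Fin m" shows "trop_in c ph (te n b) = Fin (m - n)"
proof -
  obtain a z where s: "adm d b z" "adm d (te n b) (\<lambda>k. h (case_nat (a k) (z k)))" "pord a n"
    "\<And>k. case_nat (a k) (z k) \<in> GP (Suc d)" by (rule te_sequences[OF b, where n = n]) blast
  have "pord (\<lambda>k. ph (f (z k))) m" using positive_pord[OF pos_phi b] s(1) m by (auto simp: trop_in_def)
  from pord_divide[OF this s(3)] have "pord (\<lambda>k. ph (f (h (case_nat (a k) (z k))))) (m - n)"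
    by (simp add: shift[OF s(4)])
  from trop_from_pord[OF pos_phi te_lattice[OF b] s(2) this] show ?thesis by (simp add: trop_in_def)
qed

lemma trop_eps_te:
  assumes b: "b \<in> cochar_lattice d" and m: "trop_in c ep b = Fin m" shows "trop_in c ep (te n b) = Fin (n + m)"
proof -
  obtain a z where s: "adm d b z" "adm d (te n b) (\<lambda>k. h (case_nat (a k) (z k)))" "pord a n"
    "\<And>k. case_nat (a k) (z k) \<in> GP (Suc d)" by (rule te_sequences[OF b, where n = n]) blast
  have "pord (\<lambda>k. ep (f (z k))) m" using positive_pord[OF pos_eps b] s(1) m by (auto simp: trop_in_def)
  from pord_mult[OF s(3) this] have "pord (\<lambda>k. ep (f (h (case_nat (a k) (z k))))) (n + m)"
    by (simp add: shift[OF s(4)])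
  from trop_from_pord[OF pos_eps te_lattice[OF b] s(2) this] show ?thesis by (simp add: trop_in_def)
qed

lemma trop_finite:
  assumes "positive d (\<lambda>z. g (f z))" "b \<in> cochar_lattice d" shows "\<exists>m. trop_in c g b = Fin m"
  using positive_pord[OF assms] by (auto simp: trop_in_def)

text \<open>The change of \<open>bf\<close> under the operator has terms of both signs. With the
  negative ones moved across, both sides are sums of positive functions, and equality of their
  orders is an equality of minima.\<close>

lemma trop_bf_te:
  assumes pos_f: "positive d (\<lambda>z. bf X (f z))" and b: "b \<in> cochar_lattice d"
    and m: "trop_in c (bf X) b = Fin m" "trop_in c (bf X) (te n b) = Fin m'" "trop_in c ph b = Fin p" "trop_in c ep b = Fin e"
  shows "min (min m' (- p)) (- e) = min (min m (n - p)) (- (n + e))"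
proof -
  obtain a z where s: "adm d b z" "adm d (te n b) (\<lambda>k. h (case_nat (a k) (z k)))" "pord a n"
    "\<And>k. case_nat (a k) (z k) \<in> GP (Suc d)" by (rule te_sequences[OF b, where n = n]) blast
  let ?u = "\<lambda>k. h (case_nat (a k) (z k))"
  have o: "pord (\<lambda>k. ph (f (z k))) p" "pord (\<lambda>k. ep (f (z k))) e" "pord (\<lambda>k. bf X (f (z k))) m" "pord (\<lambda>k. bf X (f (?u k))) m'"
    using positive_pord[OF pos_phi b] positive_pord[OF pos_eps b] positive_pord[OF pos_f b]
      positive_pord[OF pos_f te_lattice[OF b, where n = n]] s m
    by (auto simp: trop_in_def)
  have zk: "z k \<in> GP d" "a k \<noteq> 0" for k using GP_drop[OF s(4)] by auto
  have "bf X (f (?u k)) + inverse (ph (f (z k))) + inverse (ep (f (z k))) =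
      bf X (f (z k)) + a k / ph (f (z k)) + inverse (a k * ep (f (z k)))" for k
  proof -
    have "f (z k) \<in> pts (bvar X)" using GP_phi_eps(3)[OF zk(1)] by (simp add: Z_pts)
    from E_bf[OF this, of "a k"] show ?thesis
      unfolding h_GP(1)[OF s(4)[of k], symmetric] by (simp add: divide_inverse algebra_simps)
  qed
  moreover have "pord (\<lambda>k. bf X (f (?u k)) + inverse (ph (f (z k))) + inverse (ep (f (z k)))) (min (min m' (- p)) (- e))"
    by (intro pord_add pord_inverse o)
  moreover have "pord (\<lambda>k. bf X (f (z k)) + a k / ph (f (z k)) + inverse (a k * ep (f (z k)))) (min (min m (n - p)) (- (n + e)))"
    by (intro pord_add pord_inverse pord_divide pord_mult o s)
  ultimately show ?thesis using pord_unique by simp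
qed

text \<open>The rational parameters used below give points that are not generic; identities are
  extended to them by continuity in the parameter.\<close>

lemma leval_case_nat_isCont:
  assumes "r \<noteq> 0" shows "isCont (\<lambda>a. leval P (case_nat a z)) r"
proof -
  have "isCont (\<lambda>a. case_nat a z j powi k) r" for j k
    using assms by (cases j) (auto intro!: continuous_intros)
  then show ?thesis unfolding leval_def monomial_def
    by (intro continuous_sum continuous_mult continuous_const continuous_prod)
qed

text \<open>
  The function \<open>F a = bf + (a - 1) / phi + (1 / a - 1) / eps\<close>, which is \<open>bf\<close> after the operator, is
  positive, so its values at \<open>a = 1, 2, 4\<close> have the same tropicalization, and the
  identity \<open>F 1 + F 4 = 2 * F 2 + 1 / phi + 1 / (4 * eps)\<close> bounds it.
\<close>

lemma trop_bf_le:
  assumes pos_f: "positive d (\<lambda>z. bf X (f z))" and b: "b \<in> cochar_lattice d"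
    and m: "trop_in c (bf X) b = Fin m" "trop_in c ph b = Fin p" "trop_in c ep b = Fin e"
  shows "m \<le> - p" "m \<le> - e"
proof -
  have bfZ: "bf X \<in> reg Z" using lin unfolding Xm_def by (auto simp: linear_bicrystal_def intro: reg_subvarI)
  have "positive (cdim pc) (\<lambda>w. bf X ((\<lambda>(a, y). E a y) (cmap pc w)))"
    by (rule pos_transfer[OF chart_regdom[OF chart bfZ] pos_f chart_GP(1)[OF chart] E_in_charts])
  then have "positive (Suc d) (\<lambda>w. bf X (E (w 0) (f (drp w))))" unfolding E_cmap by (simp add: pc_simps(1))
  then obtain P Q where PQ: "P \<noteq> 0" "nonneg_coeffs P" "nonneg_coeffs Q" "P \<in> laurents (Suc d)" "Q \<in> laurents (Suc d)" "Q \<noteq> 0"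
    "generic (var (torus (Suc d))) (\<lambda>w. bf X (E (w 0) (f (drp w))) = leval P w / leval Q w)"
    by (auto simp: positive_def is_quotient_def)
  define F where "F = (\<lambda>r z. bf X (f z) + (r - 1) / ph (f z) + (inverse r - 1) / ep (f z))"
  \<comment> \<open>The identity holds for all but countably many parameters. If it failed at
    \<open>r\<close>, then by continuity it would fail on a ball, which is uncountable.\<close>
  have FE: "leval P (case_nat r z) = leval Q (case_nat r z) * F r z" if z: "z \<in> GP d" and r: "r \<noteq> 0" for r z
  proof (rule ccontr)
    let ?g = "\<lambda>a. leval P (case_nat a z) - leval Q (case_nat a z) * F a z"
    assume "leval P (case_nat r z) \<noteq> leval Q (case_nat r z) * F r z"
    then have gr: "?g r \<noteq> 0" by simp
    have z0: "?g a = 0" if a: "case_nat a z \<in> GP (Suc d)" for a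
    proof -
      have "f z \<in> pts (bvar X)" using GP_phi_eps(3)[OF z] by (simp add: Z_pts)
      then have "F a z = leval P (case_nat a z) / leval Q (case_nat a z)"
        using generic_GP[OF PQ(7) a] E_bf by (simp add: F_def)
      moreover have "leval Q (case_nat a z) \<noteq> 0" using GP_leval[OF a PQ(5)] PQ(6) by blast
      ultimately show ?thesis by simp
    qed
    have "isCont ?g r" unfolding F_def using r GP_phi_eps(1,2)[OF z]
      by (intro continuous_intros leval_case_nat_isCont) auto
    then obtain \<delta> where \<delta>: "\<delta> > 0" "\<And>y. dist r y < \<delta> \<Longrightarrow> ?g y \<noteq> 0"
      using continuous_at_avoid[of r ?g 0] gr by metis
    have "ball r \<delta> \<subseteq> insert 0 {a. a \<noteq> 0 \<and> case_nat a z \<notin> GP (Suc d)}"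
    proof
      fix y assume "y \<in> ball r \<delta>"
      then have "?g y \<noteq> 0" using \<delta>(2) by simp
      then have "case_nat y z \<notin> GP (Suc d)" using z0 by metis
      then show "y \<in> insert 0 {a. a \<noteq> 0 \<and> case_nat a z \<notin> GP (Suc d)}" by simp
    qed
    moreover have "countable (insert 0 {a. a \<noteq> 0 \<and> case_nat a z \<notin> GP (Suc d)})" using GP_slice[OF z] by simp
    ultimately have "countable (ball r \<delta>)" by (rule countable_subset)
    then show False using uncountable_ball[OF \<delta>(1)] by blast
  qed
  obtain \<zeta> where \<zeta>: "\<zeta> \<in> GP d" "\<And>j. rpos (\<zeta> j)" using GP_exists by blast
  define z where "z = (\<lambda>k. scal b k \<zeta>)"
  have adm: "adm d b z" unfolding z_def by (rule adm_scal[OF \<zeta> b])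
  have zr: "rpos (z k j)" for k j
    unfolding z_def scal_def by (intro rpos_mult \<zeta>(2) rpos_power_int) (auto simp: rpos_def intro: exI[of _ 2])
  \<comment> \<open>A constant parameter has order 0, hence the first coordinate 0 in
    \<open>case_nat 0 b\<close>; so the order of \<open>F r\<close> does not depend on
    \<open>r\<close>.\<close>
  define M where "M = newton_min P (case_nat 0 b) - newton_min Q (case_nat 0 b)"
  have FM: "pord (\<lambda>k. F r (z k)) M" if r: "rpos r" for r
  proof -
    have v: "pord (\<lambda>k. case_nat r (z k) j) (case_nat 0 b j)" if "j < Suc d" for j
      using adm that pord_const[OF r] by (cases j) (auto simp: adm_def)
    have "F r (z k) = leval P (case_nat r (z k)) / leval Q (case_nat r (z k))" for k
    proof -
      have "rpos (leval Q (case_nat r (z k)))" using PQ r zr by (intro leval_rpos) (auto split: nat.split)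
      then show ?thesis using FE[of "z k" r] adm rpos_nz[OF r] by (simp add: adm_def rpos_nz)
    qed
    then show ?thesis unfolding M_def
      using pord_divide[OF leval_pord[OF v PQ(4,2,1)] leval_pord[OF v PQ(5,3,6)]] by simp
  qed
  have rp: "rpos 1" "rpos 2" "rpos 4" "rpos (1/4)" by (auto simp: rpos_def intro: exI[of _ 1] exI[of _ 2] exI[of _ 4] exI[of _ "1/4"])
  have o: "pord (\<lambda>k. ph (f (z k))) p" "pord (\<lambda>k. ep (f (z k))) e" "pord (\<lambda>k. bf X (f (z k))) m"
    using positive_pord[OF pos_phi b] positive_pord[OF pos_eps b] positive_pord[OF pos_f b] adm m
    by (auto simp: trop_in_def)
  have "pord (\<lambda>k. bf X (f (z k))) M" using FM[OF rp(1)] by (simp add: F_def)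
  then have "M = m" using o(3) pord_unique by blast
  have "pord (\<lambda>k. F 1 (z k) + F 4 (z k)) (min M M)" by (intro pord_add FM rp)
  moreover have "pord (\<lambda>k. 2 * F 2 (z k) + inverse (ph (f (z k))) + 1/4 * inverse (ep (f (z k)))) (min (min (0 + M) (- p)) (0 + - e))"
    by (intro pord_add pord_mult pord_const pord_inverse FM rp o)
  moreover have "F 1 (z k) + F 4 (z k) = 2 * F 2 (z k) + inverse (ph (f (z k))) + 1/4 * inverse (ep (f (z k)))" for k
  proof -
    define A where "A = inverse (ph (f (z k)))"
    define B where "B = inverse (ep (f (z k)))"
    have FAB: "F r (z k) = bf X (f (z k)) + (r - 1) * A + (inverse r - 1) * B" for r
      by (simp add: F_def divide_inverse A_def B_def)
    show ?thesis unfolding FAB A_def[symmetric] B_def[symmetric] by (simp add: field_simps)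
  qed
  ultimately have "min M M = min (min (0 + M) (- p)) (0 + - e)" using pord_unique by simp
  then show "m \<le> - p" "m \<le> - e" using \<open>M = m\<close> by auto
qed

end

section \<open>Restrictions of crystals\<close>

text \<open>Only single steps are recorded: after a restriction the other powers are iterates of
  these, and may be undefined although \<open>\<tau> i n b\<close> lies in the set. In this form the
  property survives repeated restriction.\<close>

definition given_by :: "('g, 'i, 'b) crystal \<Rightarrow> 'i set \<Rightarrow> ('i \<Rightarrow> int \<Rightarrow> 'b \<Rightarrow> 'b) \<Rightarrow> bool" where
  "given_by C I \<tau> \<longleftrightarrow> (\<forall>i\<in>I. \<forall>s\<in>{1, -1}. \<forall>b\<in>celts C.
     cop C i s b = (if \<tau> i s b \<in> celts C then Some (\<tau> i s b) else None))"

lemma restrict_simps [simp]: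
  "celts (restrict_crystal C S) = celts C \<inter> S" "ceps (restrict_crystal C S) = ceps C"
  "cphi (restrict_crystal C S) = cphi C"
  by (simp_all add: restrict_crystal_def)

lemma restrict_cop:
  "cop (restrict_crystal C S) i n b = ((\<lambda>o'. Option.bind o' (rstep C S i (sgn n))) ^^ nat \<bar>n\<bar>) (Some b)"
  by (simp add: restrict_crystal_def)

lemma rstep_given_by:
  assumes "given_by C I \<tau>" "i \<in> I" "s \<in> {1, -1}" "b \<in> celts C \<inter> S"
  shows "rstep C S i s b = (if \<tau> i s b \<in> celts C \<inter> S then Some (\<tau> i s b) else None)"
proof -
  have "cop C i s b = (if \<tau> i s b \<in> celts C then Some (\<tau> i s b) else None)"
    using assms unfolding given_by_def by blast
  then show ?thesis using assms(4) by (simp add: rstep_def)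
qed

lemma given_by_restrict:
  assumes "given_by C I \<tau>" shows "given_by (restrict_crystal C S) I \<tau>"
  unfolding given_by_def
proof (intro ballI)
  fix i s b assume a: "i \<in> I" "s \<in> {1, - 1 :: int}" "b \<in> celts (restrict_crystal C S)"
  have "cop (restrict_crystal C S) i s b = rstep C S i s b"
    using a(2) by (auto simp: restrict_cop)
  then show "cop (restrict_crystal C S) i s b =
      (if \<tau> i s b \<in> celts (restrict_crystal C S) then Some (\<tau> i s b) else None)"
    using rstep_given_by[OF assms a(1,2)] a(3) by simp
qed

lemma bind_iter_None:
  fixes g :: "'b \<Rightarrow> 'b option" shows "((\<lambda>o'. Option.bind o' g) ^^ m) None = None"
  by (induction m) auto

text \<open>The function \<open>w\<close> counts the steps that remain possible inside
  \<open>A\<close>: it drops by one at each step and is 0 exactly where the next step leaves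
  \<open>A\<close>.\<close>

lemma bind_iter:
  fixes g :: "'b \<Rightarrow> 'b option"
  assumes g: "\<And>b. b \<in> A \<Longrightarrow> g b = (if t b \<in> A then Some (t b) else None)"
    and w: "\<And>b. b \<in> A \<Longrightarrow> t b \<in> A \<longleftrightarrow> w b > 0" "\<And>b. b \<in> A \<Longrightarrow> w b > 0 \<Longrightarrow> w (t b) = w b - (1::nat)" and b: "b \<in> A"
  shows "((\<lambda>o'. Option.bind o' g) ^^ m) (Some b) \<noteq> None \<longleftrightarrow> m \<le> w b"
  using b
proof (induction m arbitrary: b)
  case 0 then show ?case by simp
next
  case (Suc m)
  have "((\<lambda>o'. Option.bind o' g) ^^ Suc m) (Some b) = ((\<lambda>o'. Option.bind o' g) ^^ m) (g b)"
    by (simp add: funpow_Suc_right del: funpow.simps)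
  moreover have "((\<lambda>o'. Option.bind o' g) ^^ m) (Some (t b)) \<noteq> None \<longleftrightarrow> m \<le> w b - 1" if "t b \<in> A"
    using Suc.IH[OF that] w[OF Suc.prems] that by simp
  ultimately show ?case using g[OF Suc.prems] w(1)[OF Suc.prems] bind_iter_None[of m g]
    by (cases "t b \<in> A") auto
qed

lemma normal_restrict:
  assumes C: "given_by C I \<tau>"
    and e: "\<And>i b. i \<in> I \<Longrightarrow> b \<in> celts C \<inter> S \<Longrightarrow> ceps C i b = Fin (int (e i b))"
      "\<And>i b. i \<in> I \<Longrightarrow> b \<in> celts C \<inter> S \<Longrightarrow> \<tau> i 1 b \<in> celts C \<inter> S \<longleftrightarrow> e i b > 0"
      "\<And>i b. i \<in> I \<Longrightarrow> b \<in> celts C \<inter> S \<Longrightarrow> e i b > 0 \<Longrightarrow> e i (\<tau> i 1 b) = e i b - 1"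
    and p: "\<And>i b. i \<in> I \<Longrightarrow> b \<in> celts C \<inter> S \<Longrightarrow> cphi C i b = Fin (int (p i b))"
      "\<And>i b. i \<in> I \<Longrightarrow> b \<in> celts C \<inter> S \<Longrightarrow> \<tau> i (-1) b \<in> celts C \<inter> S \<longleftrightarrow> p i b > 0"
      "\<And>i b. i \<in> I \<Longrightarrow> b \<in> celts C \<inter> S \<Longrightarrow> p i b > 0 \<Longrightarrow> p i (\<tau> i (-1) b) = p i b - 1"
  shows "normal_crystal I (restrict_crystal C S)"
  unfolding normal_crystal_def
proof (intro ballI)
  fix b i assume b: "b \<in> celts (restrict_crystal C S)" and i: "i \<in> I"
  let ?A = "celts C \<inter> S"
  have bA: "b \<in> ?A" using b by simp
  have up: "cop (restrict_crystal C S) i (int m) b \<noteq> None \<longleftrightarrow> m \<le> e i b" for m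
  proof (cases "m = 0")
    case True then show ?thesis by (simp add: restrict_cop)
  next
    case False
    then have "cop (restrict_crystal C S) i (int m) b = ((\<lambda>o'. Option.bind o' (rstep C S i 1)) ^^ m) (Some b)"
      by (simp add: restrict_cop)
    then show ?thesis
      using bind_iter[of ?A "rstep C S i 1" "\<tau> i 1" "e i" b m, OF _ _ _ bA] rstep_given_by[OF C i] e(2,3)[OF i] by simp
  qed
  have down: "cop (restrict_crystal C S) i (- int m) b \<noteq> None \<longleftrightarrow> m \<le> p i b" for m
  proof (cases "m = 0")
    case True then show ?thesis by (simp add: restrict_cop)
  next
    case False
    then have "cop (restrict_crystal C S) i (- int m) b = ((\<lambda>o'. Option.bind o' (rstep C S i (-1))) ^^ m) (Some b)"
      by (simp add: restrict_cop sgn_minus)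
    then show ?thesis
      using bind_iter[of ?A "rstep C S i (-1)" "\<tau> i (-1)" "p i" b m, OF _ _ _ bA] rstep_given_by[OF C i] p(2,3)[OF i] by simp
  qed
  show "(\<exists>m::nat. ceps (restrict_crystal C S) i b = Fin (int m) \<and> cop (restrict_crystal C S) i (int m) b \<noteq> None \<and>
        (\<forall>n::nat. cop (restrict_crystal C S) i (int n) b \<noteq> None \<longrightarrow> n \<le> m)) \<and>
     (\<exists>m::nat. cphi (restrict_crystal C S) i b = Fin (int m) \<and> cop (restrict_crystal C S) i (- int m) b \<noteq> None \<and>
        (\<forall>n::nat. cop (restrict_crystal C S) i (- int n) b \<noteq> None \<longrightarrow> n \<le> m))"
  proof (intro conjI exI)
    show "ceps (restrict_crystal C S) i b = Fin (int (e i b))" using e(1)[OF i bA] by simp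
    show "cphi (restrict_crystal C S) i b = Fin (int (p i b))" using p(1)[OF i bA] by simp
    show "cop (restrict_crystal C S) i (int (e i b)) b \<noteq> None" unfolding up by simp
    show "cop (restrict_crystal C S) i (- int (p i b)) b \<noteq> None" unfolding down by simp
    show "\<forall>n. cop (restrict_crystal C S) i (int n) b \<noteq> None \<longrightarrow> n \<le> e i b" unfolding up by simp
    show "\<forall>n. cop (restrict_crystal C S) i (- int n) b \<noteq> None \<longrightarrow> n \<le> p i b" unfolding down by simp
  qed
qed

section \<open>Invariance of the highest weight and of the central charge\<close>

text \<open>The function witnessing density on \<open>Z\<close> is nonzero at the image of a generic
  point, so its numerator in the chart is a nonzero Laurent polynomial; multiplied by the chart
  denominator it defines the required open set.\<close>

lemma generic_pullback:
  assumes c: "toric_chart Z c" and A: "generic Z A" and R: "fun_alg \<rat> (pts Z) (reg Z)"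
  shows "generic (var (torus (cdim c))) (\<lambda>z. z \<in> cdom c \<and> A (cmap c z))"
proof -
  obtain q r where cp: "chart_pair Z c q r" using chartE[OF c] by blast
  obtain s where s: "s \<in> reg Z" "zdense Z {x\<in>pts Z. s x \<noteq> 0} (pts Z)" "\<forall>x\<in>pts Z. s x \<noteq> 0 \<longrightarrow> A x"
    using A unfolding generic_def by blast
  obtain a k where a: "a \<in> regfun (torus (cdim c))" "\<forall>z\<in>Tpts (cdim c). q z \<noteq> 0 \<longrightarrow> s (cmap c z) = a z / q z ^ k"
    using chart_fwd[OF cp princ_open_incl[OF s(1)]] unfolding princ_open_simps torus_simps by blast
  obtain la where la: "la \<in> laurents (cdim c)" "\<forall>z\<in>Tpts (cdim c). a z = leval la z" using reg_torus_leval[OF a(1)] by blast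
  obtain lq where lq: "lq \<in> laurents (cdim c)" "\<forall>z\<in>Tpts (cdim c). q z = leval lq z" using reg_torus_leval[OF chart_q[OF cp]] by blast
  obtain \<zeta> where \<zeta>: "\<zeta> \<in> GP (cdim c)" using GP_exists by blast
  have gs: "generic Z (\<lambda>x. s x \<noteq> 0)" unfolding generic_def using s(1,2) by blast
  have "s (cmap c \<zeta>) \<noteq> 0" by (rule generic_gpt[OF gs chart_GP(2)[OF c \<zeta>] R Rats_1])
  moreover have q\<zeta>: "q \<zeta> \<noteq> 0" using chart_GP(1)[OF c \<zeta>] by (simp add: chart_dom[OF cp])
  ultimately have "leval la \<zeta> \<noteq> 0" "leval lq \<zeta> \<noteq> 0" using a(2) la(2) lq(2) GP_Tpts[OF \<zeta>] by auto
  then have "la \<noteq> 0" "lq \<noteq> 0" by auto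
  have dom: "z \<in> cdom c \<and> A (cmap c z)" if z: "z \<in> Tpts (cdim c)" "leval (la * lq) z \<noteq> 0" for z
  proof -
    have nz: "leval la z \<noteq> 0" "leval lq z \<noteq> 0" using z(2) unfolding leval_factor_nz[OF z(1)] by auto
    then have zc: "z \<in> cdom c" using lq(2) z(1) by (simp add: chart_dom[OF cp])
    then have "cmap c z \<in> pts Z" using bij_betwE[OF chart_bij[OF cp]] by blast
    moreover have "s (cmap c z) \<noteq> 0" using a(2) la(2) lq(2) z(1) nz by auto
    ultimately show ?thesis using s(3) zc by blast
  qed
  show ?thesis unfolding generic_torus_iff
    by (rule bexI[of _ "la * lq"])
       (use dom laurents_mult_nz[OF la(1) lq(1) \<open>la \<noteq> 0\<close> \<open>lq \<noteq> 0\<close>] laurents_closed(4)[OF la(1) lq(1)] in auto)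
qed

section \<open>Double coset decompositions before and after the operator\<close>

context positive_crystal_chart
begin

text \<open>The factors that the operator adds are absorbed into the unipotent parts, which requires
  \<open>uni_mult\<close>; the middle part \<open>t v\<close> is unchanged, and the characters grow
  by the same amount as \<open>bf\<close>.\<close>

lemma E_decomp:
  assumes y: "y \<in> pts (bvar X)" "bp X y = u \<otimes>\<^bsub>G\<^esub> t \<otimes>\<^bsub>G\<^esub> v \<otimes>\<^bsub>G\<^esub> u'"
    and mem: "u \<in> uni D" "u' \<in> uni D" "t \<in> carrier G" "v \<in> carrier G"
  shows "\<exists>u1\<in>uni D. \<exists>u2\<in>uni D. bp X (E a y) = u1 \<otimes>\<^bsub>G\<^esub> t \<otimes>\<^bsub>G\<^esub> v \<otimes>\<^bsub>G\<^esub> u2 \<and>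
    chi_st D u1 + chi_st D u2 = chi_st D u + chi_st D u' + (a - 1) / ph y + (inverse a - 1) / ep y"
proof -
  interpret Gr: Group.group G by (rule groupG)
  let ?s = "(a - 1) / ph y" and ?t = "(inverse a - 1) / ep y"
  have "subgroup (bor D) G" using D by (auto simp: pinned_split_reductive_def borel_subgroup_def closed_subgroup_def)
  then have uc: "w \<in> carrier G" if "w \<in> uni D" for w using subgroup.mem_carrier uni_bor[OF D that] by fast
  have "bp X (E a y) = (x ?s \<otimes>\<^bsub>G\<^esub> u) \<otimes>\<^bsub>G\<^esub> t \<otimes>\<^bsub>G\<^esub> v \<otimes>\<^bsub>G\<^esub> (u' \<otimes>\<^bsub>G\<^esub> x ?t)"
    unfolding E_bp[OF y(1)] y(2) using mem uc x_carrier by (simp add: Gr.m_assoc)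
  moreover have "chi_st D (w \<otimes>\<^bsub>G\<^esub> w') = chi_st D w + chi_st D w'" if w: "w \<in> uni D" "w' \<in> uni D" for w w'
  proof -
    have "chi D j (w \<otimes>\<^bsub>G\<^esub> w') = chi D j w + chi D j w'" if j: "j \<in> idx D" for j
    proof -
      have "chi D j \<in> hom (subgrp G (uni D)) Ga" using D j by (auto simp: pinned_split_reductive_def alg_hom_def)
      from hom_mult[OF this, of w w'] show ?thesis using w by (simp add: subgrp_def Ga_def)
    qed
    then show ?thesis by (simp add: chi_st_def sum.distrib)
  qed
  ultimately show ?thesis using mem x_uni uni_mult[OF D] chi_st_x
    by (intro bexI[of _ "x ?s \<otimes>\<^bsub>G\<^esub> u"] bexI[of _ "u' \<otimes>\<^bsub>G\<^esub> x ?t"]) (simp_all add: algebra_simps)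
qed

text \<open>Positivity provides \<open>bp\<close> in the form \<open>t b\<close> with
  \<open>b\<close> in \<open>Bminus\<close>, while \<open>hw\<close> is defined by a decomposition
  with \<open>t\<close> next to \<open>wbar\<close>. Conjugating the left unipotent part by
  \<open>t\<close> passes from one to the other.\<close>

lemma hw_decomp:
  assumes hw: "is_hw D X w hw" and wb: "wbar D w \<in> carrier G" and y: "y \<in> pts Z"
    and tb: "bp X y = t \<otimes>\<^bsub>G\<^esub> b" "t \<in> tor D" "b \<in> Bminus D w"
  shows "hw y = t" "E a y \<in> pts Z \<Longrightarrow> hw (E a y) = t"
proof -
  interpret Gr: Group.group G by (rule groupG)
  obtain v v' where v: "v \<in> uni D" "v' \<in> uni D" "b = v \<otimes>\<^bsub>G\<^esub> wbar D w \<otimes>\<^bsub>G\<^esub> v'"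
    using tb(3) by (auto simp: Bminus_def double_coset_def)
  have "subgroup (bor D) G" using D by (auto simp: pinned_split_reductive_def borel_subgroup_def closed_subgroup_def)
  then have uc: "u \<in> carrier G" if "u \<in> uni D" for u using subgroup.mem_carrier uni_bor[OF D that] by fast
  have tc: "t \<in> carrier G"
    using D tb(2) by (auto simp: pinned_split_reductive_def split_maximal_torus_def closed_subgroup_def dest: subgroup.mem_carrier)
  let ?u = "t \<otimes>\<^bsub>G\<^esub> v \<otimes>\<^bsub>G\<^esub> inv\<^bsub>G\<^esub> t"
  have u: "?u \<in> uni D" by (rule uni_conj[OF D v(1) tb(2)])
  have py: "bp X y = ?u \<otimes>\<^bsub>G\<^esub> t \<otimes>\<^bsub>G\<^esub> wbar D w \<otimes>\<^bsub>G\<^esub> v'"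
    unfolding tb(1) v(3) using tc uc[OF v(1)] uc[OF v(2)] wb by (simp add: Gr.m_assoc)
  then show "hw y = t" using hw y u tb(2) v(2) unfolding is_hw_def by blast
  assume Ey: "E a y \<in> pts Z"
  have "y \<in> pts (bvar X)" using y by (simp add: Z_pts)
  from E_decomp[OF this py u v(2) tc wb, of a] obtain u1 u2 where
    "u1 \<in> uni D" "u2 \<in> uni D" "bp X (E a y) = u1 \<otimes>\<^bsub>G\<^esub> t \<otimes>\<^bsub>G\<^esub> wbar D w \<otimes>\<^bsub>G\<^esub> u2" by blast
  then show "hw (E a y) = t" using hw Ey tb(2) unfolding is_hw_def by blast
qed

text \<open>The image under the operator stays in \<open>XP\<close> with the same central factor
  \<open>t\<close>, so the defining equation of \<open>fP\<close> applies at both ends and its value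
  grows exactly as \<open>bf\<close> does.\<close>

lemma charge_E:
  assumes fP: "is_fP D L w fP" and wb: "wbar D w \<in> carrier G" and L: "centre D L \<subseteq> carrier G"
    and y: "y \<in> pts Z" "bp X y \<in> XP D L w"
  shows "central_charge X fP (E a y) = central_charge X fP y"
proof -
  obtain u t u' where u: "u \<in> uni D" "t \<in> centre D L" "u' \<in> uni D" "bp X y = u \<otimes>\<^bsub>G\<^esub> t \<otimes>\<^bsub>G\<^esub> wbar D w \<otimes>\<^bsub>G\<^esub> u'"
    using y(2) by (auto simp: XP_def)
  have yX: "y \<in> pts (bvar X)" using y by (simp add: Z_pts)
  have "t \<in> carrier G" using u(2) L by blast
  from E_decomp[OF yX u(4,1,3) this wb, of a] obtain u1 u2 where
    u1: "u1 \<in> uni D" "u2 \<in> uni D" "bp X (E a y) = u1 \<otimes>\<^bsub>G\<^esub> t \<otimes>\<^bsub>G\<^esub> wbar D w \<otimes>\<^bsub>G\<^esub> u2"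
    "chi_st D u1 + chi_st D u2 = chi_st D u + chi_st D u' + (a - 1) / ph y + (inverse a - 1) / ep y" by blast
  have "fP (bp X (E a y)) = chi_st D u1 + chi_st D u2" "fP (bp X y) = chi_st D u + chi_st D u'"
    using fP u u1 unfolding is_fP_def by simp_all
  then show ?thesis using u1(4) E_bf[OF yX, of a] by (simp add: central_charge_def)
qed

text \<open>Positivity of \<open>hw\<close> is deduced from that of \<open>bp\<close>: generically
  \<open>hw\<close> is the torus component of \<open>bp\<close> in the product of \<open>T\<close>
  with \<open>Bminus\<close>.\<close>

lemma hw_char_positive:
  assumes hw: "is_hw D X w hw" and wb: "wbar D w \<in> carrier G" and TB: "positive_to_TB D w Z \<Theta> (bp X)"
    and \<mu>: "\<mu> \<in> chars (subgrp G (tor D))"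
  shows "positive d (\<lambda>z. \<mu> (hw (f z)))"
proof -
  let ?T = "subgrp G (tor D)" and ?B = "subvar (var G) (Bminus D w)"
  let ?g = "\<lambda>y. inv_into (tor D \<times> Bminus D w) (\<lambda>(t, b). t \<otimes>\<^bsub>G\<^esub> b) (bp X y)"
  obtain c' where c': "c' \<in> prod_structure (var ?T) ?B (torus_structure ?T) (theta_minus D w)" "positive_in_charts c c' ?g"
    using TB c\<Theta> unfolding positive_to_TB_def positive_morphism_def by blast
  have th: "toric_chart ?B cb" if "cb \<in> theta_minus D w" for cb
    using that by (auto simp: theta_minus_def chart_class_def)
  note pc' = prod_structure_fst_char[OF c'(1) th \<mu>]
  have "regdom c' (\<lambda>p. \<mu> (fst p))" by (rule chart_regdom[OF pc'(1) prod_gens(1)[OF chars_reg[OF \<mu>]]])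
  from pos_transfer[OF this pc'(2) chart_GP(1)[OF pc'(1)] c'(2)]
  have "positive d (\<lambda>z. \<mu> (fst (?g (f z))))" .
  note pos = this
  have gen: "generic (var (torus d)) (\<lambda>z. z \<in> cdom c \<and> bp X (f z) \<in> (\<lambda>(t, b). t \<otimes>\<^bsub>G\<^esub> b) ` (tor D \<times> Bminus D w))"
    by (rule generic_pullback[OF chart _ fun_alg_Z]) (use TB in \<open>simp add: positive_to_TB_def\<close>)
  have eq: "\<mu> (hw (f z)) = \<mu> (fst (?g (f z)))"
    if z: "z \<in> cdom c \<and> bp X (f z) \<in> (\<lambda>(t, b). t \<otimes>\<^bsub>G\<^esub> b) ` (tor D \<times> Bminus D w)" for z
  proof -
    obtain q r where cp: "chart_pair Z c q r" using chartE[OF chart] by blast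
    have y: "f z \<in> pts Z" using z bij_betwE[OF chart_bij[OF cp]] by blast
    have im: "bp X (f z) \<in> (\<lambda>(t, b). t \<otimes>\<^bsub>G\<^esub> b) ` (tor D \<times> Bminus D w)" using z by blast
    note i = inv_into_into[OF im] f_inv_into_f[OF im]
    have "hw (f z) = fst (?g (f z))"
      by (rule hw_decomp(1)[OF hw wb y, of _ "snd (?g (f z))"]) (use i in \<open>auto simp: case_prod_unfold mem_Times_iff\<close>)
    then show ?thesis by simp
  qed
  show ?thesis by (rule positive_cong[OF pos], rule generic_mono[OF gen], rule eq)
qed

text \<open>The lift uses a choice of reduced word, so one must exist. Positivity of
  \<open>bp\<close> yields a chart of \<open>theta_minus D w\<close>, and every such chart comes
  from a reduced word.\<close>

lemma wbar_carrier:
  assumes TB: "positive_to_TB D w Z \<Theta> (bp X)" shows "wbar D w \<in> carrier G"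
proof -
  interpret Gr: Group.group G by (rule groupG)
  obtain c' where "c' \<in> prod_structure (var (subgrp G (tor D))) (subvar (var G) (Bminus D w))
      (torus_structure (subgrp G (tor D))) (theta_minus D w)"
    using TB c\<Theta> unfolding positive_to_TB_def positive_morphism_def by blast
  then obtain cb where "cb \<in> theta_minus D w" unfolding prod_structure_def by blast
  then obtain ws where "reduced_word D w ws" unfolding theta_minus_def by blast
  then have "reduced_word D w (SOME ws. reduced_word D w ws)" by (rule someI)
  then have "set (SOME ws. reduced_word D w ws) \<subseteq> idx D" by (simp add: reduced_word_def word_of_def)
  moreover have "sbar D j \<in> carrier G" if "j \<in> idx D" for j
  proof -
    have "phi2 D j \<in> hom SL2 G" using D that by (auto simp: pinned_split_reductive_def alg_hom_def)
    moreover have "mat2 0 (-1) 1 0 \<in> carrier SL2" by (simp add: SL2_def mat2_def det_2 vector_2)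
    ultimately show ?thesis unfolding sbar_def by (rule hom_in_carrier)
  qed
  moreover have "word_bar D ws \<in> carrier G" if "set ws \<subseteq> idx D" for ws
    using that calculation(2) by (induction ws) (auto simp: word_bar_def)
  ultimately show ?thesis unfolding wbar_def by blast
qed

lemma trop_charge_te:
  assumes fP: "is_fP D L w fP" and TB: "positive_to_TB D w Z \<Theta> (bp X)" and L: "centre D L \<subseteq> carrier G"
    and gen: "generic Z (\<lambda>y. bp X y \<in> XP D L w)" and pz: "positive_or_zero d (\<lambda>z. central_charge X fP (f z))"
    and b: "b \<in> cochar_lattice d"
  shows "trop_charge X fP c (te n b) = trop_charge X fP c b"
proof -
  let ?H = "\<lambda>z. central_charge X fP (f z)"
  obtain p q where pq: "nonneg_coeffs p" "nonneg_coeffs q" "is_quotient d p q ?H"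
    using pz by (auto simp: positive_or_zero_def)
  show ?thesis
  proof (cases "p = 0")
    \<comment> \<open>A vanishing central charge has tropicalization \<open>Pinf\<close> everywhere,
      so both sides agree.\<close>
    case True
    then have "generic (var (torus d)) (\<lambda>z. ?H z = 0)"
      using pq(3) by (auto simp: is_quotient_def elim!: generic_mono)
    then show ?thesis by (simp add: trop_charge_def trop_in_def trop_zero)
  next
    case False
    then have pos: "positive d ?H" using pq by (auto simp: positive_def)
    have "?H (h (case_nat a z)) = ?H z" if w: "case_nat a z \<in> GP (Suc d)" for a z
    proof -
      have z: "z \<in> GP d" using GP_drop[OF w] by blast
      have "bp X (f z) \<in> XP D L w" by (rule generic_gpt[OF gen chart_GP(2)[OF chart z] fun_alg_Z Rats_1])
      from charge_E[OF fP wbar_carrier[OF TB] L GP_phi_eps(3)[OF z] this, of a] show ?thesis using h_GP(1)[OF w] by simp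
    qed
    from trop_te_invariant[OF pos this b] show ?thesis by (simp add: trop_charge_def trop_in_def)
  qed
qed

lemma trop_hw_te:
  assumes hw: "is_hw D X w hw" and TB: "positive_to_TB D w Z \<Theta> (bp X)" and b: "b \<in> cochar_lattice d"
  shows "trop_to_torus d (subgrp G (tor D)) (\<lambda>z. hw (f z)) (te n b) = trop_to_torus d (subgrp G (tor D)) (\<lambda>z. hw (f z)) b"
proof -
  note wb = wbar_carrier[OF TB]
  have gen: "generic Z (\<lambda>y. bp X y \<in> (\<lambda>(t, b). t \<otimes>\<^bsub>G\<^esub> b) ` (tor D \<times> Bminus D w))"
    using TB by (simp add: positive_to_TB_def)
  have "trop d (\<lambda>z. \<mu> (hw (f z))) (te n b) = trop d (\<lambda>z. \<mu> (hw (f z))) b"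
    if \<mu>: "\<mu> \<in> chars (subgrp G (tor D))" for \<mu>
  proof (rule trop_te_invariant[OF hw_char_positive[OF hw wb TB \<mu>] _ b])
    fix a z assume w: "case_nat a z \<in> GP (Suc d)"
    have z: "z \<in> GP d" using GP_drop[OF w] by blast
    have "bp X (f z) \<in> (\<lambda>(t, b). t \<otimes>\<^bsub>G\<^esub> b) ` (tor D \<times> Bminus D w)"
      by (rule generic_gpt[OF gen chart_GP(2)[OF chart z] fun_alg_Z Rats_1])
    then obtain t b' where tb: "bp X (f z) = t \<otimes>\<^bsub>G\<^esub> b'" "t \<in> tor D" "b' \<in> Bminus D w" by auto
    have "E a (f z) \<in> pts Z" unfolding h_GP(1)[OF w] using GP_phi_eps(3)[OF h_GP(2)[OF w]] .
    then have "hw (E a (f z)) = hw (f z)"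
      using hw_decomp(2)[OF hw wb GP_phi_eps(3)[OF z] tb] hw_decomp(1)[OF hw wb GP_phi_eps(3)[OF z] tb] by simp
    then show "\<mu> (hw (f (h (case_nat a z)))) = \<mu> (hw (f z))" unfolding h_GP(1)[OF w] by simp
  qed
  \<comment> \<open>The cocharacter in \<open>trop_to_torus\<close> depends on \<open>hw\<close>
    only through its tropicalized characters.\<close>
  then show ?thesis by (simp add: trop_to_torus_def cong: conj_cong ball_cong)
qed

text \<open>Let \<open>m\<close>, \<open>p\<close>, \<open>e\<close> be the tropical values of
  \<open>bf\<close>, \<open>phi\<close>, \<open>eps\<close>; then \<open>0 \<le> m\<close>,
  \<open>m \<le> - p\<close> and \<open>m \<le> - e\<close>. If \<open>- e > 0\<close>, the right
  side of \<open>trop_bf_te\<close> for \<open>te 1\<close> is nonnegative, so \<open>bf\<close>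
  stays nonnegative. If \<open>e = 0\<close>, then \<open>m = 0\<close> and that side is
  \<open>- 1\<close>, which only the new value of \<open>bf\<close> can produce. For
  \<open>te (-1)\<close> the roles of \<open>p\<close> and \<open>e\<close> are exchanged.\<close>

lemma bf_te_nonneg:
  assumes pos_f: "positive d (\<lambda>z. bf X (f z))" and b: "b \<in> cochar_lattice d" and nn: "Fin 0 \<le> trop_in c (bf X) b"
  shows "\<exists>p e. - trop_in c ph b = Fin (int p) \<and> - trop_in c ep b = Fin (int e) \<and>
    (Fin 0 \<le> trop_in c (bf X) (te 1 b) \<longleftrightarrow> e > 0) \<and> (Fin 0 \<le> trop_in c (bf X) (te (-1) b) \<longleftrightarrow> p > 0) \<and>
    - trop_in c ep (te 1 b) = Fin (int e - 1) \<and> - trop_in c ph (te (-1) b) = Fin (int p - 1)"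
proof -
  obtain m where m: "trop_in c (bf X) b = Fin m" using trop_finite[OF pos_f b] by blast
  obtain p where p: "trop_in c ph b = Fin p" using trop_finite[OF pos_phi b] by blast
  obtain e where e: "trop_in c ep b = Fin e" using trop_finite[OF pos_eps b] by blast
  obtain m1 where m1: "trop_in c (bf X) (te 1 b) = Fin m1" using trop_finite[OF pos_f te_lattice[OF b]] by blast
  obtain m2 where m2: "trop_in c (bf X) (te (-1) b) = Fin m2" using trop_finite[OF pos_f te_lattice[OF b]] by blast
  have "0 \<le> m" using nn m by simp
  moreover have "m \<le> - p" "m \<le> - e" by (rule trop_bf_le[OF pos_f b m p e])+
  moreover have "min (min m1 (- p)) (- e) = min (min m (1 - p)) (- (1 + e))" by (rule trop_bf_te[OF pos_f b m m1 p e])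
  moreover have "min (min m2 (- p)) (- e) = min (min m (- 1 - p)) (- (- 1 + e))" by (rule trop_bf_te[OF pos_f b m m2 p e])
  ultimately have "0 \<le> - p" "0 \<le> - e" "0 \<le> m1 \<longleftrightarrow> nat (- e) > 0" "0 \<le> m2 \<longleftrightarrow> nat (- p) > 0"
    by (auto simp: min_def split: if_splits)
  then show ?thesis
    using trop_eps_te[OF b e, of 1] trop_phi_te[OF b p, of "-1"] m1 m2 p e
    by (intro exI[of _ "nat (- p)"] exI[of _ "nat (- e)"]) simp
qed

end

theorem claim6p12:
  fixes D :: "('g, 'i) pinned_group"
    and P L w :: "'g set"
    and X :: "('g, 'x) bicrystal"
    and \<Theta> :: "'x chart set"
    and fP :: "'g \<Rightarrow> complex"
    and hw :: "'x \<Rightarrow> 'g"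
    and c :: "'x chart"
  assumes "pinned_split_reductive D"
    and "standard_parabolic D P"
    and "levi_factor D P L"
    and "is_wP D L w"
    and "is_fP D L w fP"
    and "parabolic_bicrystal D X"
    and "strongly_positive_bicrystal D L w fP X \<Theta>"
    and "is_hw D X w hw"
    and "c \<in> \<Theta>"
  shows "(\<forall>i\<in>idx D. \<forall>n. \<forall>b\<in>cochar_lattice (cdim c).
            trop_charge X fP c (trop_e D X c i n b) = trop_charge X fP c b) \<and>
         (\<forall>\<nu>\<in>cochars (subgrp (grp D) (centre D L)).
            normal_crystal (idx D) (crystal_f_hw D X c hw \<nu>) \<and>
            (\<forall>n. celts (crystal_f_hw_n D X c hw fP \<nu> n) \<noteq> {} \<longrightarrow>
               subcrystal (crystal_f_hw_n D X c hw fP \<nu> n) (crystal_f_hw D X c hw \<nu>) \<and>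
               normal_crystal (idx D) (crystal_f_hw_n D X c hw fP \<nu> n)))"
proof -
  let ?G = "grp D" and ?lat = "cochar_lattice (cdim c)" and ?te = "trop_e D X c"
  let ?hwt = "trop_to_torus (cdim c) (subgrp ?G (tor D)) (\<lambda>z. hw (cmap c z))"
  have pb: "positive_bicrystal D w X \<Theta>" and gen: "generic (Xm D X) (\<lambda>x. bp X x \<in> XP D L w)"
    and pz: "positive_or_zero (cdim c) (\<lambda>z. central_charge X fP (cmap c z))"
    using assms(7,9) by (auto simp: strongly_positive_bicrystal_def positive_or_zero_fun_def)
  have toric: "toric_chart (Xm D X) c'" if "c' \<in> \<Theta>" for c'
    using pb that by (auto simp: positive_bicrystal_def positive_structure_def chart_class_def)
  have TB: "positive_to_TB D w (Xm D X) \<Theta> (bp X)" and pos_f: "positive (cdim c) (\<lambda>z. bf X (cmap c z))"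
    using pb assms(9) by (auto simp: positive_bicrystal_def positive_fun_def)
  have L: "centre D L \<subseteq> carrier ?G"
    using assms(3) subgroup.mem_carrier by (fastforce simp: levi_factor_def closed_subgroup_def centre_def)
  have loc: "positive_crystal_chart D X c i \<Theta>" if "i \<in> idx D" for i
    by unfold_locales
       (use assms(1,9) pb toric that in \<open>auto simp: positive_bicrystal_def positive_fun_def\<close>)
  have charge: "trop_charge X fP c (?te i n b) = trop_charge X fP c b" if "i \<in> idx D" "b \<in> ?lat" for i n b
    by (rule positive_crystal_chart.trop_charge_te[OF loc[OF that(1)] assms(5) TB L gen pz that(2)])
  have hwi: "?hwt (?te i n b) = ?hwt b" if "i \<in> idx D" "b \<in> ?lat" for i n b
    by (rule positive_crystal_chart.trop_hw_te[OF loc[OF that(1)] assms(8) TB that(2)])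
  have lat: "?te i n b \<in> ?lat" if "i \<in> idx D" "b \<in> ?lat" for i n b
    by (rule positive_crystal_chart.te_lattice[OF loc[OF that(1)] that(2)])
  let ?T = "trop_crystal D X c"
  have T: "given_by ?T (idx D) ?te"
    unfolding given_by_def using lat by (simp add: trop_crystal_def)
  \<comment> \<open>The default 0 covers the infinite values that the type admits; on the subsets
    considered the value is finite and nonnegative.\<close>
  define ev where "ev = (\<lambda>i b. case - trop_in c (eps D X i) b of Fin k \<Rightarrow> nat k | _ \<Rightarrow> 0)"
  define pv where "pv = (\<lambda>i b. case - trop_in c (phi D X i) b of Fin k \<Rightarrow> nat k | _ \<Rightarrow> 0)"
  \<comment> \<open>One criterion serves both crystals: highest weight and central charge are
    preserved, so whether an operator leaves the subset depends on \<open>bf\<close> alone.\<close>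
  have normal: "normal_crystal (idx D) (restrict_crystal C S)"
    if C: "given_by C (idx D) ?te" "ceps C = ceps ?T" "cphi C = cphi ?T"
      and S: "\<And>b. b \<in> celts C \<inter> S \<Longrightarrow> b \<in> ?lat \<and> Fin 0 \<le> trop_in c (bf X) b"
      and clos: "\<And>i n b. i \<in> idx D \<Longrightarrow> b \<in> celts C \<inter> S \<Longrightarrow>
        ?te i n b \<in> celts C \<inter> S \<longleftrightarrow> Fin 0 \<le> trop_in c (bf X) (?te i n b)" for C S
  proof -
    have "ceps C i b = Fin (int (ev i b)) \<and> cphi C i b = Fin (int (pv i b)) \<and>
        (?te i 1 b \<in> celts C \<inter> S \<longleftrightarrow> ev i b > 0) \<and> (?te i (-1) b \<in> celts C \<inter> S \<longleftrightarrow> pv i b > 0) \<and>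
        (ev i b > 0 \<longrightarrow> ev i (?te i 1 b) = ev i b - 1) \<and> (pv i b > 0 \<longrightarrow> pv i (?te i (-1) b) = pv i b - 1)"
      if i: "i \<in> idx D" and b: "b \<in> celts C \<inter> S" for i b
    proof -
      obtain p e where pe: "- trop_in c (phi D X i) b = Fin (int p)" "- trop_in c (eps D X i) b = Fin (int e)"
        "Fin 0 \<le> trop_in c (bf X) (?te i 1 b) \<longleftrightarrow> e > 0" "Fin 0 \<le> trop_in c (bf X) (?te i (-1) b) \<longleftrightarrow> p > 0"
        "- trop_in c (eps D X i) (?te i 1 b) = Fin (int e - 1)" "- trop_in c (phi D X i) (?te i (-1) b) = Fin (int p - 1)"
        using positive_crystal_chart.bf_te_nonneg[OF loc[OF i] pos_f] S[OF b] by blast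
      have "ev i b = e" "pv i b = p" "ev i (?te i 1 b) = e - 1" "pv i (?te i (-1) b) = p - 1"
        by (simp_all add: ev_def pv_def pe nat_diff_distrib)
      moreover have "ceps C i b = Fin (int e)" "cphi C i b = Fin (int p)"
        using pe(1,2) by (simp_all add: C trop_crystal_def)
      ultimately show ?thesis using clos[OF i b] pe(3,4) by simp
    qed
    then show ?thesis by (intro normal_restrict[OF C(1), where e = ev and p = pv]) blast+
  qed
  let ?C1 = "crystal_f D X c"
  have g1: "given_by ?C1 (idx D) ?te" unfolding crystal_f_def by (rule given_by_restrict[OF T])
  have e1: "celts ?C1 = {b\<in>?lat. Fin 0 \<le> trop_in c (bf X) b}" "ceps ?C1 = ceps ?T" "cphi ?C1 = cphi ?T"
    by (auto simp: crystal_f_def trop_crystal_def)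
  have "normal_crystal (idx D) (crystal_f_hw D X c hw \<nu>)" for \<nu>
    unfolding crystal_f_hw_def
    by (rule normal[OF g1 e1(2,3)]) (use lat hwi in \<open>auto simp: e1(1)\<close>)
  moreover have "subcrystal (crystal_f_hw_n D X c hw fP \<nu> n) (crystal_f_hw D X c hw \<nu>)" for \<nu> n
    unfolding subcrystal_def crystal_f_hw_n_def by (intro exI conjI) (rule Collect_restrict, rule refl)
  moreover have "normal_crystal (idx D) (crystal_f_hw_n D X c hw fP \<nu> n)" for \<nu> n
  proof -
    let ?C2 = "crystal_f_hw D X c hw \<nu>"
    have g2: "given_by ?C2 (idx D) ?te" unfolding crystal_f_hw_def by (rule given_by_restrict[OF g1])
    have e2: "celts ?C2 = {b\<in>?lat. Fin 0 \<le> trop_in c (bf X) b \<and> ?hwt b = \<nu>}" "ceps ?C2 = ceps ?T" "cphi ?C2 = cphi ?T"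
      by (auto simp: crystal_f_hw_def e1)
    show ?thesis unfolding crystal_f_hw_n_def
      by (rule normal[OF g2 e2(2,3)]) (use lat hwi charge in \<open>auto simp: e2(1)\<close>)
  qed
  ultimately show ?thesis by (simp add: charge)
qed

end
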